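(* Let $R$ be a commutative ring, let $\mathcal{W}\subseteq\mathcal{X}$ and $\mathcal{V}\subseteq\mathcal{Y}$ be subcategories of the category of $R$-modules, and let $M$ and $N$ be $R$-modules. (a) Assume that $M$ admits a proper $\mathcal{X}$-resolution. Then there is a bijection $\xi_{\mathcal{X}MN}\colon\operatorname{Ext}^1_{\mathcal{X}R}(M,N)\to\mathrm{e}_{\mathcal{X}R}(M,N)$ such that $\xi_{RMN}\circ\varkappa^1_{\mathcal{X}R}(M,N)=\iota\circ\xi_{\mathcal{X}MN}$, where $\iota\colon\mathrm{e}_{\mathcal{X}R}(M,N)\to\mathrm{e}_R(M,N)$ is the natural inclusion. In particular, the comparison map $\varkappa^1_{\mathcal{X}R}(M,N)\colon\operatorname{Ext}^1_{\mathcal{X}R}(M,N)\to\operatorname{Ext}^1_R(M,N)$ is injective. (b) Assume that $M$ admits a proper $\mathcal{X}$-resolution and a proper $\mathcal{W}$-resolution. Then $\xi_{\mathcal{W}MN}\circ\vartheta^1_{\mathcal{X}\mathcal{W}R}(M,N)=\iota\circ\xi_{\mathcal{X}MN}$, where $\xi_{\mathcal{X}MN}$ and $\xi_{\mathcal{W}MN}$ are the bijections as in (a) for $\mathcal{X}$ and for $\mathcal{W}$, and $\iota\colon\mathrm{e}_{\mathcal{X}R}(M,N)\to\mathrm{e}_{\mathcal{W}R}(M,N)$ is the natural inclusion. In particular, the comparison map $\vartheta^1_{\mathcal{X}\mathcal{W}R}(M,N)$ is injective. (c) Assume that $N$ admits a proper $\mathcal{Y}$-coresolution. Then there is a bijection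 $\xi'_{\mathcal{Y}MN}\colon\operatorname{Ext}^1_{R\mathcal{Y}}(M,N)\to\mathrm{e}_{R\mathcal{Y}}(M,N)$ such that $\xi'_{RMN}\circ\varkappa^1_{R\mathcal{Y}}(M,N)=\iota\circ\xi'_{\mathcal{Y}MN}$, where $\iota\colon\mathrm{e}_{R\mathcal{Y}}(M,N)\to\mathrm{e}_R(M,N)$ is the natural inclusion. In particular, the comparison map $\varkappa^1_{R\mathcal{Y}}(M,N)\colon\operatorname{Ext}^1_{R\mathcal{Y}}(M,N)\to\operatorname{Ext}^1_R(M,N)$ is injective. (d) Assume that $N$ admits a proper $\mathcal{Y}$-coresolution and a proper $\mathcal{V}$-coresolution. Then $\xi'_{\mathcal{V}MN}\circ\vartheta^1_{R\mathcal{Y}\mathcal{V}}(M,N)=\iota\circ\xi'_{\mathcal{Y}MN}$, where $\xi'_{\mathcal{Y}MN}$ and $\xi'_{\mathcal{V}MN}$ are the bijections as in (c) for $\mathcal{Y}$ and for $\mathcal{V}$, and $\iota\colon\mathrm{e}_{R\mathcal{Y}}(M,N)\to\mathrm{e}_{R\mathcal{V}}(M,N)$ is the natural inclusion. In particular, the comparison map $\vartheta^1_{R\mathcal{Y}\mathcal{V}}(M,N)$ is injective.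
   Context: A subcategory means a full additive subcategory closed under isomorphisms. A complex is $\operatorname{Hom}_R(\mathcal{X},-)$-exact if it becomes exact under $\operatorname{Hom}_R(X',-)$ for each $X'\in\mathcal{X}$; $\operatorname{Hom}_R(-,\mathcal{Y})$-exact is defined similarly with $\operatorname{Hom}_R(-,Y')$. An $\mathcal{X}$-resolution of $M$ is a complex $X=(\cdots\to X_1\to X_0\to0)$ of modules in $\mathcal{X}$ with $H_n(X)=0$ for $n>0$ and $H_0(X)\cong M$; it is proper if $\cdots\to X_1\to X_0\to M\to0$ is $\operatorname{Hom}_R(\mathcal{X},-)$-exact. Dually, a $\mathcal{Y}$-coresolution of $N$ is a complex $Y=(0\to Y_0\to Y_{-1}\to\cdots)$ of modules in $\mathcal{Y}$ with $0\to N\to Y_0\to Y_{-1}\to\cdots$ exact; it is proper if this sequence is $\operatorname{Hom}_R(-,\mathcal{Y})$-exact. For a proper $\mathcal{X}$-resolution $X$ of $M$, $\operatorname{Ext}^n_{\mathcal{X}R}(M,N)=H_{-n}(\operatorname{Hom}_R(X,N))$; for a proper $\mathcal{Y}$-coresolution $Y$ of $N$, $\operatorname{Ext}^n_{R\mathcal{Y}}(M,N)=H_{-n}(\operatorname{Hom}_R(M,Y))$. Comparison maps. Let $P$ be a projective resolution of $M$, and $W$, $X$ proper $\mathcal{W}$- and $\mathcal{X}$-resolutions of $M$. The identity of $M$ lifts to chain maps $P\to X$ and $W\to X$, unique up to homotopy; applying $H_{-n}(\operatorname{Hom}_R(-,N))$ gives $\varkappa^n_{\mathcal{X}R}(M,N)\colon\operatorname{Ext}^n_{\mathcal{X}R}(M,N)\to\operatorname{Ext}^n_R(M,N)$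 and $\vartheta^n_{\mathcal{X}\mathcal{W}R}(M,N)\colon\operatorname{Ext}^n_{\mathcal{X}R}(M,N)\to\operatorname{Ext}^n_{\mathcal{W}R}(M,N)$. Dually, for an injective resolution $I$ of $N$ and proper $\mathcal{Y}$- and $\mathcal{V}$-coresolutions $Y$, $V$ of $N$, the identity of $N$ extends to chain maps $Y\to I$ and $Y\to V$, unique up to homotopy, and applying $H_{-n}(\operatorname{Hom}_R(M,-))$ gives $\varkappa^n_{R\mathcal{Y}}(M,N)\colon\operatorname{Ext}^n_{R\mathcal{Y}}(M,N)\to\operatorname{Ext}^n_R(M,N)$ and $\vartheta^n_{R\mathcal{Y}\mathcal{V}}(M,N)\colon\operatorname{Ext}^n_{R\mathcal{Y}}(M,N)\to\operatorname{Ext}^n_{R\mathcal{V}}(M,N)$. Extensions. An extension of $M$ by $N$ is an exact sequence $0\to N\to T\to M\to0$; two are equivalent if there is a homomorphism $T\to T'$ compatible with $\operatorname{id}_N$ and $\operatorname{id}_M$. $\mathrm{e}_R(M,N)$ is the set of equivalence classes of extensions of $M$ by $N$; $\mathrm{e}_{\mathcal{X}R}(M,N)$ and $\mathrm{e}_{R\mathcal{Y}}(M,N)$ are the subsets of classes of $\operatorname{Hom}_R(\mathcal{X},-)$-exact, respectively $\operatorname{Hom}_R(-,\mathcal{Y})$-exact, extensions (similarly for $\mathcal{W}$, $\mathcal{V}$). The classical bijection $\xi_{RMN}\colon\operatorname{Ext}^1_R(M,N)\to\mathrm{e}_R(M,N)$: a class is represented by $\alpha\colon P_1\to N$ with $\alpha\partial^P_2=0$,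 inducing $\overline{\alpha}\colon P_1/\operatorname{Im}(\partial_2^P)\to N$; $\xi_{RMN}([\alpha])$ is the class of the pushout along $\overline{\alpha}$ of $0\to P_1/\operatorname{Im}(\partial_2^P)\to P_0\to M\to0$. Dually, $\xi'_{RMN}\colon\operatorname{Ext}^1_R(M,N)\to\mathrm{e}_R(M,N)$ is the bijection defined with an injective resolution $I$ of $N$: a class is represented by $\alpha\colon M\to\operatorname{Ker}(I_{-1}\to I_{-2})$ and is sent to the class of the pullback along $\alpha$ of $0\to N\to I_0\to\operatorname{Ker}(I_{-1}\to I_{-2})\to0$. *)

theory Defs
  imports "HOL-Algebra.Module" "HOL-Algebra.AbelCoset"
begin

section \<open>Modules\<close>

text \<open>
  Throughout, the category of modules over a commutative ring \<open>R :: 'r ring\<close> consists of the records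
  \<open>M :: ('r, 'm) module\<close> with \<open>module R M\<close> (locale of HOL-Algebra), for a fixed but arbitrary type
  \<open>'m\<close> that plays the part of the set-theoretic universe.  The fields \<open>mult\<close> and \<open>one\<close>, which the
  record inherits from rings, carry no meaning for modules.

  Homomorphisms are extensional functions, so that equality of homomorphisms is equality in HOL;
  they are composed with \<open>compose\<close>.
\<close>

definition hom_set :: "'r ring \<Rightarrow> ('r, 'a) module \<Rightarrow> ('r, 'b) module \<Rightarrow> ('a \<Rightarrow> 'b) set" where
  "hom_set R A B =
     {f \<in> carrier A \<rightarrow>\<^sub>E carrier B.
        (\<forall>x\<in>carrier A. \<forall>y\<in>carrier A. f (x \<oplus>\<^bsub>A\<^esub> y) = f x \<oplus>\<^bsub>B\<^esub> f y) \<and>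
        (\<forall>r\<in>carrier R. \<forall>x\<in>carrier A. f (r \<odot>\<^bsub>A\<^esub> x) = r \<odot>\<^bsub>B\<^esub> f x)}"

definition hom_module :: "'r ring \<Rightarrow> ('r, 'a) module \<Rightarrow> ('r, 'b) module \<Rightarrow> ('r, 'a \<Rightarrow> 'b) module" where
  "hom_module R A B =
     \<lparr>carrier = hom_set R A B, mult = undefined, one = undefined,
      zero = (\<lambda>x\<in>carrier A. \<zero>\<^bsub>B\<^esub>),
      add = (\<lambda>f g. \<lambda>x\<in>carrier A. f x \<oplus>\<^bsub>B\<^esub> g x),
      smult = (\<lambda>r f. \<lambda>x\<in>carrier A. r \<odot>\<^bsub>B\<^esub> f x)\<rparr>"

definition zero_hom :: "('r, 'a) module \<Rightarrow> ('r, 'b) module \<Rightarrow> 'a \<Rightarrow> 'b" where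
  "zero_hom A B = (\<lambda>x\<in>carrier A. \<zero>\<^bsub>B\<^esub>)"

definition isomorphic :: "'r ring \<Rightarrow> ('r, 'a) module \<Rightarrow> ('r, 'b) module \<Rightarrow> bool" where
  "isomorphic R A B \<longleftrightarrow> (\<exists>f\<in>hom_set R A B. bij_betw f (carrier A) (carrier B))"

definition zero_module :: "('r, 'a) module" where
  "zero_module =
     \<lparr>carrier = {undefined}, mult = undefined, one = undefined,
      zero = undefined, add = (\<lambda>x y. undefined), smult = (\<lambda>r x. undefined)\<rparr>"

definition direct_sum :: "('r, 'a) module \<Rightarrow> ('r, 'b) module \<Rightarrow> ('r, 'a \<times> 'b) module" where
  "direct_sum A B =
     \<lparr>carrier = carrier A \<times> carrier B, mult = undefined, one = undefined,
      zero = (\<zero>\<^bsub>A\<^esub>, \<zero>\<^bsub>B\<^esub>),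
      add = (\<lambda>x y. (fst x \<oplus>\<^bsub>A\<^esub> fst y, snd x \<oplus>\<^bsub>B\<^esub> snd y)),
      smult = (\<lambda>r x. (r \<odot>\<^bsub>A\<^esub> fst x, r \<odot>\<^bsub>B\<^esub> snd x))\<rparr>"

definition quot_module :: "('r, 'a) module \<Rightarrow> 'a set \<Rightarrow> ('r, 'a set) module" where
  "quot_module A H =
     \<lparr>carrier = a_rcosets\<^bsub>A\<^esub> H, mult = undefined, one = undefined,
      zero = H,
      add = set_add A,
      smult = (\<lambda>r C. \<Union>x\<in>C. H +>\<^bsub>A\<^esub> (r \<odot>\<^bsub>A\<^esub> x))\<rparr>"

text \<open>The map on \<open>A / H\<close> induced by a map on \<open>A\<close> that vanishes on \<open>H\<close>.\<close>

definition induced_map :: "('r, 'a) module \<Rightarrow> 'a set \<Rightarrow> ('a \<Rightarrow> 'b) \<Rightarrow> 'a set \<Rightarrow> 'b" where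
  "induced_map A H f = (\<lambda>C\<in>carrier (quot_module A H). the_elem (f ` C))"

definition projective :: "'r ring \<Rightarrow> ('r, 'm) module \<Rightarrow> bool" where
  "projective R P \<longleftrightarrow> module R P \<and>
     (\<forall>(A :: ('r, 'm) module) (B :: ('r, 'm) module). module R A \<longrightarrow> module R B \<longrightarrow>
        (\<forall>g\<in>hom_set R A B. g ` carrier A = carrier B \<longrightarrow>
          (\<forall>f\<in>hom_set R P B. \<exists>h\<in>hom_set R P A. compose (carrier P) g h = f)))"

definition injective :: "'r ring \<Rightarrow> ('r, 'm) module \<Rightarrow> bool" where
  "injective R I \<longleftrightarrow> module R I \<and>
     (\<forall>(A :: ('r, 'm) module) (B :: ('r, 'm) module). module R A \<longrightarrow> module R B \<longrightarrow>
        (\<forall>g\<in>hom_set R A B. inj_on g (carrier A) \<longrightarrow>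
          (\<forall>f\<in>hom_set R A I. \<exists>h\<in>hom_set R B I. compose (carrier A) h g = f)))"

text \<open>
  A full subcategory is given by its set of objects.  Additivity is closure under finite direct
  sums, the empty one included; closure under isomorphisms is built into the formulation.
\<close>

definition subcategory :: "'r ring \<Rightarrow> ('r, 'm) module set \<Rightarrow> bool" where
  "subcategory R \<X> \<longleftrightarrow>
     (\<forall>A\<in>\<X>. module R A) \<and>
     (\<forall>A\<in>\<X>. \<forall>B. module R B \<and> isomorphic R A B \<longrightarrow> B \<in> \<X>) \<and>
     (\<forall>Z. module R Z \<and> carrier Z = {\<zero>\<^bsub>Z\<^esub>} \<longrightarrow> Z \<in> \<X>) \<and>
     (\<forall>A\<in>\<X>. \<forall>B\<in>\<X>. \<forall>S. module R S \<and> isomorphic R S (direct_sum A B) \<longrightarrow> S \<in> \<X>)"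


section \<open>Complexes\<close>

text \<open>
  Complexes are indexed homologically by the integers: \<open>Diff C n\<close> maps \<open>Obj C n\<close> to
  \<open>Obj C (n - 1)\<close>.
\<close>

record ('r, 'm) cplx =
  Obj :: "int \<Rightarrow> ('r, 'm) module"
  Diff :: "int \<Rightarrow> 'm \<Rightarrow> 'm"

definition is_complex :: "'r ring \<Rightarrow> ('r, 'm) cplx \<Rightarrow> bool" where
  "is_complex R C \<longleftrightarrow>
     (\<forall>n. module R (Obj C n)) \<and>
     (\<forall>n. Diff C n \<in> hom_set R (Obj C n) (Obj C (n - 1))) \<and>
     (\<forall>n. compose (carrier (Obj C (n + 1))) (Diff C n) (Diff C (n + 1)) =
          zero_hom (Obj C (n + 1)) (Obj C (n - 1)))"

definition cycles :: "('r, 'm) cplx \<Rightarrow> int \<Rightarrow> 'm set" where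
  "cycles C n = {x \<in> carrier (Obj C n). Diff C n x = \<zero>\<^bsub>Obj C (n - 1)\<^esub>}"

definition boundaries :: "('r, 'm) cplx \<Rightarrow> int \<Rightarrow> 'm set" where
  "boundaries C n = Diff C (n + 1) ` carrier (Obj C (n + 1))"

definition homology :: "('r, 'm) cplx \<Rightarrow> int \<Rightarrow> ('r, 'm set) module" where
  "homology C n = quot_module ((Obj C n)\<lparr>carrier := cycles C n\<rparr>) (boundaries C n)"

definition exact_complex :: "('r, 'm) cplx \<Rightarrow> bool" where
  "exact_complex C \<longleftrightarrow> (\<forall>n. cycles C n = boundaries C n)"

definition chain_map ::
  "'r ring \<Rightarrow> ('r, 'm) cplx \<Rightarrow> ('r, 'm) cplx \<Rightarrow> (int \<Rightarrow> 'm \<Rightarrow> 'm) \<Rightarrow> bool" where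
  "chain_map R C D f \<longleftrightarrow>
     (\<forall>n. f n \<in> hom_set R (Obj C n) (Obj D n)) \<and>
     (\<forall>n. compose (carrier (Obj C n)) (Diff D n) (f n) =
          compose (carrier (Obj C n)) (f (n - 1)) (Diff C n))"

text \<open>
  The map \<open>H\<^sub>n C \<rightarrow> H\<^sub>n D\<close> induced by a chain map whose component in degree \<open>n\<close> is \<open>\<phi>\<close>: the class of
  \<open>z\<close> goes to the class of \<open>\<phi> z\<close>.
\<close>

definition homology_map ::
  "('r, 'm) cplx \<Rightarrow> ('r, 'k) cplx \<Rightarrow> ('m \<Rightarrow> 'k) \<Rightarrow> int \<Rightarrow> 'm set \<Rightarrow> 'k set" where
  "homology_map C D \<phi> n =
     (\<lambda>c\<in>carrier (homology C n). \<Union>z\<in>c. boundaries D n +>\<^bsub>Obj D n\<^esub> \<phi> z)"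

text \<open>\<open>Hom(A, C)\<close> and \<open>Hom(C, B)\<close>; for the latter the usual sign of the differential is omitted, as
  it affects neither cycles nor boundaries.\<close>

definition Hom_from :: "'r ring \<Rightarrow> ('r, 'm) module \<Rightarrow> ('r, 'm) cplx \<Rightarrow> ('r, 'm \<Rightarrow> 'm) cplx" where
  "Hom_from R A C =
     \<lparr>Obj = (\<lambda>n. hom_module R A (Obj C n)),
      Diff = (\<lambda>n. \<lambda>f\<in>hom_set R A (Obj C n). compose (carrier A) (Diff C n) f)\<rparr>"

definition Hom_to :: "'r ring \<Rightarrow> ('r, 'm) cplx \<Rightarrow> ('r, 'm) module \<Rightarrow> ('r, 'm \<Rightarrow> 'm) cplx" where
  "Hom_to R C B =
     \<lparr>Obj = (\<lambda>n. hom_module R (Obj C (- n)) B),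
      Diff = (\<lambda>n. \<lambda>f\<in>hom_set R (Obj C (- n)) B.
                 compose (carrier (Obj C (1 - n))) f (Diff C (1 - n)))\<rparr>"

definition Hom_from_exact :: "'r ring \<Rightarrow> ('r, 'm) module set \<Rightarrow> ('r, 'm) cplx \<Rightarrow> bool" where
  "Hom_from_exact R \<X> C \<longleftrightarrow> (\<forall>A\<in>\<X>. exact_complex (Hom_from R A C))"

definition Hom_to_exact :: "'r ring \<Rightarrow> ('r, 'm) module set \<Rightarrow> ('r, 'm) cplx \<Rightarrow> bool" where
  "Hom_to_exact R \<Y> C \<longleftrightarrow> (\<forall>B\<in>\<Y>. exact_complex (Hom_to R C B))"


section \<open>Resolutions and coresolutions\<close>

text \<open>
  A resolution carries its augmentation \<open>\<epsilon> : X\<^sub>0 \<rightarrow> M\<close> (equivalently, the isomorphism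
  \<open>H\<^sub>0 X \<cong> M\<close>); \<open>augment X \<epsilon> M\<close> is \<open>\<dots> \<rightarrow> X\<^sub>1 \<rightarrow> X\<^sub>0 \<rightarrow> M \<rightarrow> 0\<close> with \<open>M\<close> in degree \<open>-1\<close>.
  Dually, \<open>coaugment Y \<eta> N\<close> is \<open>0 \<rightarrow> N \<rightarrow> Y\<^sub>0 \<rightarrow> Y\<^sub>-\<^sub>1 \<rightarrow> \<dots>\<close> with \<open>N\<close> in degree \<open>1\<close>.
\<close>

definition augment :: "('r, 'm) cplx \<Rightarrow> ('m \<Rightarrow> 'm) \<Rightarrow> ('r, 'm) module \<Rightarrow> ('r, 'm) cplx" where
  "augment X \<epsilon> M =
     \<lparr>Obj = (Obj X)(- 1 := M),
      Diff = (Diff X)(0 := \<epsilon>, - 1 := zero_hom M (Obj X (- 2)))\<rparr>"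

definition coaugment :: "('r, 'm) cplx \<Rightarrow> ('m \<Rightarrow> 'm) \<Rightarrow> ('r, 'm) module \<Rightarrow> ('r, 'm) cplx" where
  "coaugment Y \<eta> N =
     \<lparr>Obj = (Obj Y)(1 := N),
      Diff = (Diff Y)(1 := \<eta>, 2 := zero_hom (Obj Y 2) N)\<rparr>"

definition resolution ::
  "'r ring \<Rightarrow> ('r, 'm) module set \<Rightarrow> ('r, 'm) module \<Rightarrow> ('r, 'm) cplx \<Rightarrow> ('m \<Rightarrow> 'm) \<Rightarrow> bool" where
  "resolution R \<X> M X \<epsilon> \<longleftrightarrow>
     is_complex R X \<and>
     (\<forall>n\<ge>0. Obj X n \<in> \<X>) \<and> (\<forall>n<0. carrier (Obj X n) = {\<zero>\<^bsub>Obj X n\<^esub>}) \<and>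
     \<epsilon> \<in> hom_set R (Obj X 0) M \<and> exact_complex (augment X \<epsilon> M)"

definition proper_resolution ::
  "'r ring \<Rightarrow> ('r, 'm) module set \<Rightarrow> ('r, 'm) module \<Rightarrow> ('r, 'm) cplx \<Rightarrow> ('m \<Rightarrow> 'm) \<Rightarrow> bool" where
  "proper_resolution R \<X> M X \<epsilon> \<longleftrightarrow>
     resolution R \<X> M X \<epsilon> \<and> Hom_from_exact R \<X> (augment X \<epsilon> M)"

definition projective_resolution ::
  "'r ring \<Rightarrow> ('r, 'm) module \<Rightarrow> ('r, 'm) cplx \<Rightarrow> ('m \<Rightarrow> 'm) \<Rightarrow> bool" where
  "projective_resolution R M P \<epsilon> \<longleftrightarrow> resolution R {A. projective R A} M P \<epsilon>"

definition coresolution ::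
  "'r ring \<Rightarrow> ('r, 'm) module set \<Rightarrow> ('r, 'm) module \<Rightarrow> ('r, 'm) cplx \<Rightarrow> ('m \<Rightarrow> 'm) \<Rightarrow> bool" where
  "coresolution R \<Y> N Y \<eta> \<longleftrightarrow>
     is_complex R Y \<and>
     (\<forall>n\<le>0. Obj Y n \<in> \<Y>) \<and> (\<forall>n>0. carrier (Obj Y n) = {\<zero>\<^bsub>Obj Y n\<^esub>}) \<and>
     \<eta> \<in> hom_set R N (Obj Y 0) \<and> exact_complex (coaugment Y \<eta> N)"

definition proper_coresolution ::
  "'r ring \<Rightarrow> ('r, 'm) module set \<Rightarrow> ('r, 'm) module \<Rightarrow> ('r, 'm) cplx \<Rightarrow> ('m \<Rightarrow> 'm) \<Rightarrow> bool" where
  "proper_coresolution R \<Y> N Y \<eta> \<longleftrightarrow>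
     coresolution R \<Y> N Y \<eta> \<and> Hom_to_exact R \<Y> (coaugment Y \<eta> N)"

definition injective_resolution ::
  "'r ring \<Rightarrow> ('r, 'm) module \<Rightarrow> ('r, 'm) cplx \<Rightarrow> ('m \<Rightarrow> 'm) \<Rightarrow> bool" where
  "injective_resolution R N I \<eta> \<longleftrightarrow> coresolution R {A. injective R A} N I \<eta>"


section \<open>Relative Ext and comparison maps\<close>

text \<open>
  \<open>Ext_res R X N n\<close> is the Ext module computed from a resolution \<open>X\<close> of the first argument: the
  relative one for a proper resolution, the absolute one for a projective resolution.  Likewise
  \<open>Ext_cores R M Y n\<close> is computed from a coresolution \<open>Y\<close> of the second argument.
\<close>

definition Ext_res ::
  "'r ring \<Rightarrow> ('r, 'm) cplx \<Rightarrow> ('r, 'm) module \<Rightarrow> int \<Rightarrow> ('r, ('m \<Rightarrow> 'm) set) module" where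
  "Ext_res R X N n = homology (Hom_to R X N) (- n)"

definition Ext_cores ::
  "'r ring \<Rightarrow> ('r, 'm) module \<Rightarrow> ('r, 'm) cplx \<Rightarrow> int \<Rightarrow> ('r, ('m \<Rightarrow> 'm) set) module" where
  "Ext_cores R M Y n = homology (Hom_from R M Y) (- n)"

definition lift_of_id ::
  "'r ring \<Rightarrow> ('r, 'm) cplx \<Rightarrow> ('m \<Rightarrow> 'm) \<Rightarrow> ('r, 'm) cplx \<Rightarrow> ('m \<Rightarrow> 'm) \<Rightarrow>
   (int \<Rightarrow> 'm \<Rightarrow> 'm) \<Rightarrow> bool" where
  "lift_of_id R P \<epsilon>P X \<epsilon>X f \<longleftrightarrow>
     chain_map R P X f \<and> compose (carrier (Obj P 0)) \<epsilon>X (f 0) = \<epsilon>P"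

definition extension_of_id ::
  "'r ring \<Rightarrow> ('r, 'm) module \<Rightarrow> ('r, 'm) cplx \<Rightarrow> ('m \<Rightarrow> 'm) \<Rightarrow> ('r, 'm) cplx \<Rightarrow> ('m \<Rightarrow> 'm) \<Rightarrow>
   (int \<Rightarrow> 'm \<Rightarrow> 'm) \<Rightarrow> bool" where
  "extension_of_id R N Y \<eta>Y I \<eta>I f \<longleftrightarrow>
     chain_map R Y I f \<and> compose (carrier N) (f 0) \<eta>Y = \<eta>I"

text \<open>
  \<open>comparison_res R P \<epsilon>P X \<epsilon>X N n\<close> maps the Ext computed from \<open>X\<close> to the one computed from \<open>P\<close>, by
  means of a lift \<open>P \<rightarrow> X\<close> of the identity.  This is \<open>\<kappa>\<close> if \<open>P\<close> is a projective resolution, and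
  \<open>\<theta>\<close> if \<open>P\<close> is a proper resolution by objects of a smaller subcategory.  Such a lift is
  unique up to homotopy, so that the choice of \<open>f\<close> is immaterial.  Similarly for
  \<open>comparison_cores\<close>, with an extension \<open>Y \<rightarrow> I\<close> of the identity.
\<close>

definition comparison_res ::
  "'r ring \<Rightarrow> ('r, 'm) cplx \<Rightarrow> ('m \<Rightarrow> 'm) \<Rightarrow> ('r, 'm) cplx \<Rightarrow> ('m \<Rightarrow> 'm) \<Rightarrow> ('r, 'm) module \<Rightarrow>
   int \<Rightarrow> ('m \<Rightarrow> 'm) set \<Rightarrow> ('m \<Rightarrow> 'm) set" where
  "comparison_res R P \<epsilon>P X \<epsilon>X N n =
     (let f = (SOME f. lift_of_id R P \<epsilon>P X \<epsilon>X f)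
      in homology_map (Hom_to R X N) (Hom_to R P N)
           (\<lambda>\<alpha>. compose (carrier (Obj P n)) \<alpha> (f n)) (- n))"

definition comparison_cores ::
  "'r ring \<Rightarrow> ('r, 'm) module \<Rightarrow> ('r, 'm) module \<Rightarrow> ('r, 'm) cplx \<Rightarrow> ('m \<Rightarrow> 'm) \<Rightarrow>
   ('r, 'm) cplx \<Rightarrow> ('m \<Rightarrow> 'm) \<Rightarrow> int \<Rightarrow> ('m \<Rightarrow> 'm) set \<Rightarrow> ('m \<Rightarrow> 'm) set" where
  "comparison_cores R M N Y \<eta>Y I \<eta>I n =
     (let f = (SOME f. extension_of_id R N Y \<eta>Y I \<eta>I f)
      in homology_map (Hom_from R M Y) (Hom_from R M I)
           (\<lambda>\<alpha>. compose (carrier M) (f (- n)) \<alpha>) (- n))"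


section \<open>Extensions\<close>

text \<open>
  A triple \<open>(T, i, p)\<close> stands for \<open>0 \<rightarrow> N \<rightarrow> T \<rightarrow> M \<rightarrow> 0\<close>.  The middle term may live on a type
  different from \<open>'m\<close>: the pushouts and pullbacks below are built on types of pairs.  The members of
  \<open>ext_class\<close>, however, are always extensions in the category of modules on \<open>'m\<close>.
\<close>

type_synonym ('r, 'm, 't) ext = "('r, 't) module \<times> ('m \<Rightarrow> 't) \<times> ('t \<Rightarrow> 'm)"

text \<open>\<open>N\<close>, \<open>T\<close> and \<open>M\<close> are put in degrees 1, 0 and -1.\<close>

definition ext_complex ::
  "('r, 'm) module \<Rightarrow> ('r, 'm) module \<Rightarrow> ('r, 'm, 'm) ext \<Rightarrow> ('r, 'm) cplx" where
  "ext_complex M N = (\<lambda>(T, i, p).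
     let ob = (\<lambda>_. zero_module)(1 := N, 0 := T, - 1 := M)
     in \<lparr>Obj = ob, Diff = (\<lambda>n. zero_hom (ob n) (ob (n - 1)))(1 := i, 0 := p)\<rparr>)"

definition is_extension ::
  "'r ring \<Rightarrow> ('r, 'm) module \<Rightarrow> ('r, 'm) module \<Rightarrow> ('r, 'm, 'm) ext \<Rightarrow> bool" where
  "is_extension R M N = (\<lambda>(T, i, p).
     module R T \<and> i \<in> hom_set R N T \<and> p \<in> hom_set R T M \<and>
     exact_complex (ext_complex M N (T, i, p)))"

definition ext_equiv ::
  "'r ring \<Rightarrow> ('r, 'm) module \<Rightarrow> ('r, 'm, 't) ext \<Rightarrow> ('r, 'm, 's) ext \<Rightarrow> bool" where
  "ext_equiv R N = (\<lambda>(T, i, p) (T', i', p').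
     \<exists>h\<in>hom_set R T T'. compose (carrier N) h i = i' \<and> compose (carrier T) p' h = p)"

definition ext_class ::
  "'r ring \<Rightarrow> ('r, 'm) module \<Rightarrow> ('r, 'm) module \<Rightarrow> ('r, 'm, 't) ext \<Rightarrow> ('r, 'm, 'm) ext set" where
  "ext_class R M N E = {E'. is_extension R M N E' \<and> ext_equiv R N E E'}"

definition e_all ::
  "'r ring \<Rightarrow> ('r, 'm) module \<Rightarrow> ('r, 'm) module \<Rightarrow> ('r, 'm, 'm) ext set set" where
  "e_all R M N = {ext_class R M N E | E :: ('r, 'm, 'm) ext. is_extension R M N E}"

definition e_from ::
  "'r ring \<Rightarrow> ('r, 'm) module set \<Rightarrow> ('r, 'm) module \<Rightarrow> ('r, 'm) module \<Rightarrow>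
   ('r, 'm, 'm) ext set set" where
  "e_from R \<X> M N = {ext_class R M N E | E :: ('r, 'm, 'm) ext.
     is_extension R M N E \<and> Hom_from_exact R \<X> (ext_complex M N E)}"

definition e_to ::
  "'r ring \<Rightarrow> ('r, 'm) module set \<Rightarrow> ('r, 'm) module \<Rightarrow> ('r, 'm) module \<Rightarrow>
   ('r, 'm, 'm) ext set set" where
  "e_to R \<Y> M N = {ext_class R M N E | E :: ('r, 'm, 'm) ext.
     is_extension R M N E \<and> Hom_to_exact R \<Y> (ext_complex M N E)}"

text \<open>
  The pushout of \<open>0 \<rightarrow> A \<rightarrow> B \<rightarrow> M \<rightarrow> 0\<close> (maps \<open>j\<close>, \<open>p\<close>) along \<open>a : A \<rightarrow> N\<close>, with middle term
  \<open>(N \<oplus> B) / {(a u, - j u) | u \<in> A}\<close>.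
\<close>

definition pushout_extension ::
  "('r, 'm) module \<Rightarrow> ('r, 'a) module \<Rightarrow> ('r, 'm) module \<Rightarrow> ('a \<Rightarrow> 'm) \<Rightarrow> ('m \<Rightarrow> 'm) \<Rightarrow> ('a \<Rightarrow> 'm) \<Rightarrow>
   ('r, 'm, ('m \<times> 'm) set) ext" where
  "pushout_extension N A B j p a =
     (let S = direct_sum N B;
          K = (\<lambda>u. (a u, \<ominus>\<^bsub>B\<^esub> j u)) ` carrier A
      in (quot_module S K,
          \<lambda>x\<in>carrier N. K +>\<^bsub>S\<^esub> (x, \<zero>\<^bsub>B\<^esub>),
          induced_map S K (\<lambda>y. p (snd y))))"

text \<open>
  The pullback of \<open>0 \<rightarrow> N \<rightarrow> B \<rightarrow> K \<rightarrow> 0\<close> (maps \<open>j\<close>, \<open>q\<close>) along \<open>a : M \<rightarrow> K\<close>, with middle term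
  \<open>{(b, x) \<in> B \<oplus> M. q b = a x}\<close>.
\<close>

definition pullback_extension ::
  "('r, 'm) module \<Rightarrow> ('r, 'm) module \<Rightarrow> ('r, 'm) module \<Rightarrow> ('m \<Rightarrow> 'm) \<Rightarrow> ('m \<Rightarrow> 'm) \<Rightarrow> ('m \<Rightarrow> 'm) \<Rightarrow>
   ('r, 'm, 'm \<times> 'm) ext" where
  "pullback_extension M N B j q a =
     (let T = (direct_sum B M)\<lparr>carrier := {y \<in> carrier B \<times> carrier M. q (fst y) = a (snd y)}\<rparr>
      in (T, \<lambda>x\<in>carrier N. (j x, \<zero>\<^bsub>M\<^esub>), \<lambda>y\<in>carrier T. snd y))"

text \<open>
  The classical maps \<open>\<xi>\<close> and \<open>\<xi>'\<close> from \<open>Ext\<^sup>1\<close>, computed with a projective resolution of \<open>M\<close> or an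
  injective resolution of \<open>N\<close>, to \<open>e_all R M N\<close>.  An element \<open>c\<close> of \<open>Ext\<^sup>1\<close> is the set of the
  cocycles that represent it, and all of them give the same class of extensions; the union is that
  class.
\<close>

definition xi ::
  "'r ring \<Rightarrow> ('r, 'm) module \<Rightarrow> ('r, 'm) module \<Rightarrow> ('r, 'm) cplx \<Rightarrow> ('m \<Rightarrow> 'm) \<Rightarrow>
   ('m \<Rightarrow> 'm) set \<Rightarrow> ('r, 'm, 'm) ext set" where
  "xi R M N P \<epsilon> c =
     (\<Union>\<alpha>\<in>c. ext_class R M N
        (pushout_extension N (quot_module (Obj P 1) (boundaries P 1)) (Obj P 0)
           (induced_map (Obj P 1) (boundaries P 1) (Diff P 1)) \<epsilon>
           (induced_map (Obj P 1) (boundaries P 1) \<alpha>)))"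

definition xi' ::
  "'r ring \<Rightarrow> ('r, 'm) module \<Rightarrow> ('r, 'm) module \<Rightarrow> ('r, 'm) cplx \<Rightarrow> ('m \<Rightarrow> 'm) \<Rightarrow>
   ('m \<Rightarrow> 'm) set \<Rightarrow> ('r, 'm, 'm) ext set" where
  "xi' R M N I \<eta> c =
     (\<Union>\<alpha>\<in>c. ext_class R M N (pullback_extension M N (Obj I 0) \<eta> (Diff I 0) \<alpha>))"

text \<open>
  Bijections \<open>Ext\<^sup>1 \<rightarrow> e_from R \<X> M N\<close> and \<open>Ext\<^sup>1 \<rightarrow> e_to R \<Y> M N\<close> compatible with the classical ones,
  whatever resolution is used for the latter.  The natural inclusion of \<open>e_from R \<X> M N\<close> or
  \<open>e_to R \<Y> M N\<close> into \<open>e_all R M N\<close> is an inclusion of sets and hence invisible in the equations.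
\<close>

definition relative_xi ::
  "'r ring \<Rightarrow> ('r, 'm) module set \<Rightarrow> ('r, 'm) module \<Rightarrow> ('r, 'm) module \<Rightarrow>
   ('r, 'm) cplx \<Rightarrow> ('m \<Rightarrow> 'm) \<Rightarrow> (('m \<Rightarrow> 'm) set \<Rightarrow> ('r, 'm, 'm) ext set) \<Rightarrow> bool" where
  "relative_xi R \<X> M N X \<epsilon>X \<xi> \<longleftrightarrow>
     bij_betw \<xi> (carrier (Ext_res R X N 1)) (e_from R \<X> M N) \<and>
     (\<forall>P \<epsilon>P. projective_resolution R M P \<epsilon>P \<longrightarrow>
        (\<forall>c\<in>carrier (Ext_res R X N 1).
           xi R M N P \<epsilon>P (comparison_res R P \<epsilon>P X \<epsilon>X N 1 c) = \<xi> c))"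

definition relative_xi' ::
  "'r ring \<Rightarrow> ('r, 'm) module set \<Rightarrow> ('r, 'm) module \<Rightarrow> ('r, 'm) module \<Rightarrow>
   ('r, 'm) cplx \<Rightarrow> ('m \<Rightarrow> 'm) \<Rightarrow> (('m \<Rightarrow> 'm) set \<Rightarrow> ('r, 'm, 'm) ext set) \<Rightarrow> bool" where
  "relative_xi' R \<Y> M N Y \<eta>Y \<xi> \<longleftrightarrow>
     bij_betw \<xi> (carrier (Ext_cores R M Y 1)) (e_to R \<Y> M N) \<and>
     (\<forall>I \<eta>I. injective_resolution R N I \<eta>I \<longrightarrow>
        (\<forall>c\<in>carrier (Ext_cores R M Y 1).
           xi' R M N I \<eta>I (comparison_cores R M N Y \<eta>Y I \<eta>I 1 c) = \<xi> c))"

end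

theory Submission
  imports Defs
begin

text \<open>
  Let \<open>X\<close> be a resolution of \<open>M\<close> with augmentation \<open>\<epsilon>\<close> and \<open>\<alpha> : X\<^sub>1 \<rightarrow> N\<close> a cocycle.  By the universal
  property of the pushout, an extension \<open>(T, i, p)\<close> belongs to the class of the pushout along \<open>\<alpha>\<close> if
  and only if there is \<open>g : X\<^sub>0 \<rightarrow> T\<close> with \<open>p g = \<epsilon>\<close> and \<open>g \<partial>\<^sub>1 = i \<alpha>\<close>.  In this form everything is
  a diagram chase: adding \<open>i \<beta>\<close> to \<open>g\<close> changes \<open>\<alpha>\<close> by the coboundary \<open>\<beta> \<partial>\<^sub>1\<close>, and two such \<open>g\<close> for the
  same \<open>T\<close> differ by some \<open>i \<beta>\<close>; if \<open>X\<close> is proper, then \<open>g\<close> exists precisely when the extension is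
  \<open>Hom(\<X>, -)\<close>-exact; and composing \<open>g\<close> with a lift \<open>f : P \<rightarrow> X\<close> of the identity shows that \<open>\<alpha>\<close> and \<open>\<alpha> f\<^sub>1\<close>
  define the same class.  So \<open>xi\<close>, computed with \<open>X\<close> in place of a projective resolution, is the
  bijection sought, and the comparison maps are injective because they commute with these bijections.
  Pullbacks are treated dually, with maps \<open>T \<rightarrow> Y\<^sub>0\<close>.
\<close>

section \<open>Homomorphisms\<close>

text \<open>The obstacle is the universe. Classes consist of extensions with middle term on the type
  \<open>'m\<close>, while pushouts and pullbacks live on types built from pairs. If no copy on
  \<open>'m\<close> were available, a class could be empty and distinct cohomology classes could
  have the same image. Infinity of \<open>'m\<close> provides the copy: pairs embed into
  \<open>'m\<close>, and a coset of pairs is coded by a representative. A second constraint is that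
  no projective or injective resolution on \<open>'m\<close> is supplied when the bijections are
  built. They are therefore constructed from the given proper resolution itself, without passing
  through the absolute Ext; compatibility with the classical map is checked against each projective
  or injective resolution that happens to exist. The lift chosen by \<open>SOME\<close> is harmless
  in this check: two classes coincide once they share a single extension, so every lift of the
  identity leads to the same class.\<close>

lemma hom_setI:
  assumes "module R A"
    and "\<And>x. x \<in> carrier A \<Longrightarrow> f x \<in> carrier B"
    and "\<And>x y. x \<in> carrier A \<Longrightarrow> y \<in> carrier A \<Longrightarrow> f (x \<oplus>\<^bsub>A\<^esub> y) = f x \<oplus>\<^bsub>B\<^esub> f y"
    and "\<And>r x. r \<in> carrier R \<Longrightarrow> x \<in> carrier A \<Longrightarrow> f (r \<odot>\<^bsub>A\<^esub> x) = r \<odot>\<^bsub>B\<^esub> f x"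
  shows "restrict f (carrier A) \<in> hom_set R A B"
proof -
  interpret A: module R A by fact
  show ?thesis
    using assms(2-) by (simp add: hom_set_def)
qed

lemma hom_closed: "f \<in> hom_set R A B \<Longrightarrow> x \<in> carrier A \<Longrightarrow> f x \<in> carrier B"
  by (auto simp: hom_set_def)

lemma hom_add:
  "f \<in> hom_set R A B \<Longrightarrow> x \<in> carrier A \<Longrightarrow> y \<in> carrier A \<Longrightarrow> f (x \<oplus>\<^bsub>A\<^esub> y) = f x \<oplus>\<^bsub>B\<^esub> f y"
  by (simp add: hom_set_def)

lemma hom_smult:
  "f \<in> hom_set R A B \<Longrightarrow> r \<in> carrier R \<Longrightarrow> x \<in> carrier A \<Longrightarrow> f (r \<odot>\<^bsub>A\<^esub> x) = r \<odot>\<^bsub>B\<^esub> f x"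
  by (simp add: hom_set_def)

lemma hom_extensional: "f \<in> hom_set R A B \<Longrightarrow> f \<in> extensional (carrier A)"
  by (simp add: hom_set_def PiE_def)

lemma compose_eqI:
  "f \<in> hom_set R A B \<Longrightarrow> (\<And>x. x \<in> carrier A \<Longrightarrow> g (h x) = f x) \<Longrightarrow> compose (carrier A) g h = f"
  by (rule extensionalityI[OF compose_extensional hom_extensional]) (auto simp: compose_eq)

lemma compose_eqD: "compose A g h = f \<Longrightarrow> x \<in> A \<Longrightarrow> g (h x) = f x"
  by (metis compose_eq)

lemma restrict_hom: "f \<in> hom_set R A B \<Longrightarrow> restrict f (carrier A) = f"
  by (simp add: extensional_restrict hom_extensional)

lemma hom_zero:
  assumes "module R A" "module R B" "f \<in> hom_set R A B"
  shows "f \<zero>\<^bsub>A\<^esub> = \<zero>\<^bsub>B\<^esub>"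
proof -
  interpret A: module R A by fact
  interpret B: module R B by fact
  have "f \<zero>\<^bsub>A\<^esub> \<oplus>\<^bsub>B\<^esub> f \<zero>\<^bsub>A\<^esub> = f \<zero>\<^bsub>A\<^esub>"
    using hom_add[OF assms(3), of "\<zero>\<^bsub>A\<^esub>" "\<zero>\<^bsub>A\<^esub>"] by simp
  then show ?thesis
    using hom_closed[OF assms(3)] B.add.l_cancel_one' by simp
qed

lemma hom_uminus:
  assumes "module R A" "module R B" "f \<in> hom_set R A B" "x \<in> carrier A"
  shows "f (\<ominus>\<^bsub>A\<^esub> x) = \<ominus>\<^bsub>B\<^esub> f x"
proof -
  interpret A: module R A by fact
  interpret B: module R B by fact
  have "f (\<ominus>\<^bsub>A\<^esub> x) \<oplus>\<^bsub>B\<^esub> f x = \<zero>\<^bsub>B\<^esub>"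
    using hom_add[OF assms(3), of "\<ominus>\<^bsub>A\<^esub> x" x] hom_zero[OF assms(1-3)] assms(4)
    by (simp add: A.l_neg)
  then show ?thesis
    using assms hom_closed[OF assms(3)] by (metis A.a_inv_closed B.minus_equality)
qed

lemma hom_diff:
  assumes "module R A" "module R B" "f \<in> hom_set R A B" "x \<in> carrier A" "y \<in> carrier A"
  shows "f (x \<ominus>\<^bsub>A\<^esub> y) = f x \<ominus>\<^bsub>B\<^esub> f y"
proof -
  interpret A: module R A by fact
  interpret B: module R B by fact
  show ?thesis
    using assms hom_add[OF assms(3)] hom_uminus[OF assms(1-3)] by (simp add: a_minus_def)
qed

lemma module_diff_add_cancel:
  assumes "module R A" "x \<in> carrier A" "y \<in> carrier A"
  shows "(x \<ominus>\<^bsub>A\<^esub> y) \<oplus>\<^bsub>A\<^esub> y = x"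
proof -
  interpret A: module R A by fact
  show ?thesis using assms by (simp add: a_minus_def A.a_assoc A.l_neg)
qed

lemma module_diff_zero_iff:
  assumes "module R A" "x \<in> carrier A" "y \<in> carrier A"
  shows "x \<ominus>\<^bsub>A\<^esub> y = \<zero>\<^bsub>A\<^esub> \<longleftrightarrow> x = y"
proof -
  interpret A: module R A by fact
  show ?thesis
    using module_diff_add_cancel[OF assms] assms by (auto simp: a_minus_def A.r_neg)
qed

lemma hom_inj_on_iff:
  assumes "module R A" "module R B" "f \<in> hom_set R A B"
  shows "inj_on f (carrier A) \<longleftrightarrow> (\<forall>x\<in>carrier A. f x = \<zero>\<^bsub>B\<^esub> \<longrightarrow> x = \<zero>\<^bsub>A\<^esub>)"
proof -
  interpret A: module R A by fact
  interpret B: module R B by fact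
  note f = hom_zero[OF assms] hom_diff[OF assms] hom_closed[OF assms(3)]
  show ?thesis
  proof (intro iffI ballI impI inj_onI)
    fix x assume "inj_on f (carrier A)" "x \<in> carrier A" "f x = \<zero>\<^bsub>B\<^esub>"
    then show "x = \<zero>\<^bsub>A\<^esub>"
      using f(1) by (metis A.zero_closed inj_onD)
  next
    fix x y assume "\<forall>x\<in>carrier A. f x = \<zero>\<^bsub>B\<^esub> \<longrightarrow> x = \<zero>\<^bsub>A\<^esub>" "x \<in> carrier A" "y \<in> carrier A" "f x = f y"
    then show "x = y"
      using f(2,3) module_diff_zero_iff[OF assms(1)] module_diff_zero_iff[OF assms(2)]
      by (metis A.minus_closed)
  qed
qed

lemma hom_compose:
  assumes "module R A" "f \<in> hom_set R A B" "g \<in> hom_set R B C"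
  shows "compose (carrier A) g f \<in> hom_set R A C"
  unfolding compose_def using assms
  by (intro hom_setI) (auto simp: hom_closed hom_add hom_smult)

lemma hom_id: "module R A \<Longrightarrow> (\<lambda>x\<in>carrier A. x) \<in> hom_set R A A"
  by (rule hom_setI) auto

lemma zero_hom_in_hom_set: "module R A \<Longrightarrow> module R B \<Longrightarrow> zero_hom A B \<in> hom_set R A B"
proof -
  assume "module R A" "module R B"
  interpret B: module R B by fact
  show ?thesis
    unfolding zero_hom_def by (rule hom_setI) (simp_all add: \<open>module R A\<close>)
qed

lemma hom_add_in_hom_set:
  assumes "module R A" "module R B" "f \<in> hom_set R A B" "g \<in> hom_set R A B"
  shows "(\<lambda>x\<in>carrier A. f x \<oplus>\<^bsub>B\<^esub> g x) \<in> hom_set R A B"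
proof -
  interpret B: module R B by fact
  show ?thesis
    using assms
    by (intro hom_setI)
      (auto simp: hom_closed[OF assms(3)] hom_closed[OF assms(4)] hom_add[OF assms(3)] hom_add[OF assms(4)]
        hom_smult[OF assms(3)] hom_smult[OF assms(4)] B.smult_r_distr B.a_ac)
qed

lemma hom_uminus_in_hom_set:
  assumes "module R A" "module R B" "f \<in> hom_set R A B"
  shows "(\<lambda>x\<in>carrier A. \<ominus>\<^bsub>B\<^esub> f x) \<in> hom_set R A B"
proof -
  interpret B: module R B by fact
  show ?thesis
    using assms
    by (intro hom_setI)
      (auto simp: hom_closed[OF assms(3)] hom_add[OF assms(3)]
        hom_smult[OF assms(3)] B.smult_r_minus B.minus_add)
qed

lemma hom_diff_in_hom_set:
  assumes "module R A" "module R B" "f \<in> hom_set R A B" "g \<in> hom_set R A B"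
  shows "(\<lambda>x\<in>carrier A. f x \<ominus>\<^bsub>B\<^esub> g x) \<in> hom_set R A B"
  using hom_add_in_hom_set[OF assms(1-3) hom_uminus_in_hom_set[OF assms(1,2,4)]]
  by (simp add: a_minus_def cong: restrict_cong)

text \<open>Linearity of the inverse of \<open>i\<close> on its image is read off after applying the
  injective \<open>i\<close>. For an extension that image is the kernel of \<open>p\<close>, so this
  is the universal property of the kernel; on the resolution side it produces the cocycles and the
  maps \<open>\<beta>\<close>.\<close>

lemma factor_through_mono:
  assumes "module R A" "module R N" "module R T" "i \<in> hom_set R N T" "inj_on i (carrier N)"
    and "f \<in> hom_set R A T" "f ` carrier A \<subseteq> i ` carrier N"
  obtains h where "h \<in> hom_set R A N" "\<And>x. x \<in> carrier A \<Longrightarrow> i (h x) = f x"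
proof -
  interpret N: module R N by fact
  interpret A: module R A by fact
  define h where "h = (\<lambda>x. inv_into (carrier N) i (f x))"
  have h: "h x \<in> carrier N" "i (h x) = f x" if "x \<in> carrier A" for x
  proof -
    have "f x \<in> i ` carrier N" using that assms(7) by blast
    then show "h x \<in> carrier N" "i (h x) = f x"
      by (simp_all add: h_def inv_into_into f_inv_into_f)
  qed
  have "restrict h (carrier A) \<in> hom_set R A N"
  proof (rule hom_setI)
    show "h (x \<oplus>\<^bsub>A\<^esub> y) = h x \<oplus>\<^bsub>N\<^esub> h y" if "x \<in> carrier A" "y \<in> carrier A" for x y
      using that by (intro inj_onD[OF assms(5)]) (simp_all add: h hom_add[OF assms(4)] hom_add[OF assms(6)])
    show "h (r \<odot>\<^bsub>A\<^esub> x) = r \<odot>\<^bsub>N\<^esub> h x" if "r \<in> carrier R" "x \<in> carrier A" for r x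
      using that by (intro inj_onD[OF assms(5)]) (simp_all add: h hom_smult[OF assms(4)] hom_smult[OF assms(6)])
  qed (use h assms in auto)
  then show ?thesis
    using that h by simp
qed

text \<open>\<open>f\<close> is constant on the fibres of \<open>p\<close>, so composing it with any
  section \<open>s\<close> of \<open>p\<close>, linear or not, gives a linear map. This serves as
  the universal property of quotients and of \<open>T \<rightarrow> M\<close> alike.\<close>

lemma factor_through_epi:
  assumes "module R T" "module R M" "module R B" "p \<in> hom_set R T M" "p ` carrier T = carrier M"
    and "f \<in> hom_set R T B" "\<And>x. x \<in> carrier T \<Longrightarrow> p x = \<zero>\<^bsub>M\<^esub> \<Longrightarrow> f x = \<zero>\<^bsub>B\<^esub>"
  obtains h where "h \<in> hom_set R M B" "\<And>x. x \<in> carrier T \<Longrightarrow> h (p x) = f x"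
proof -
  interpret T: module R T by fact
  interpret M: module R M by fact
  define s where "s = inv_into (carrier T) p"
  have s: "s x \<in> carrier T" "p (s x) = x" if "x \<in> carrier M" for x
    using that unfolding s_def assms(5)[symmetric] by (simp_all add: inv_into_into f_inv_into_f)
  have f_eq: "f x = f y" if "x \<in> carrier T" "y \<in> carrier T" "p x = p y" for x y
  proof -
    have "f (x \<ominus>\<^bsub>T\<^esub> y) = \<zero>\<^bsub>B\<^esub>"
      using that hom_closed[OF assms(4)]
      by (intro assms(7)) (simp_all add: hom_diff[OF assms(1,2,4)] module_diff_zero_iff[OF assms(2)])
    then show ?thesis
      using that hom_closed[OF assms(6)] module_diff_zero_iff[OF assms(3)]
      by (simp add: hom_diff[OF assms(1,3,6)])
  qed
  have "(\<lambda>x\<in>carrier M. f (s x)) \<in> hom_set R M B"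
  proof (rule hom_setI)
    show "f (s (x \<oplus>\<^bsub>M\<^esub> y)) = f (s x) \<oplus>\<^bsub>B\<^esub> f (s y)" if "x \<in> carrier M" "y \<in> carrier M" for x y
      using that f_eq[of "s (x \<oplus>\<^bsub>M\<^esub> y)" "s x \<oplus>\<^bsub>T\<^esub> s y"]
      by (simp add: s hom_add[OF assms(4)] hom_add[OF assms(6)])
    show "f (s (r \<odot>\<^bsub>M\<^esub> x)) = r \<odot>\<^bsub>B\<^esub> f (s x)" if "r \<in> carrier R" "x \<in> carrier M" for r x
      using that f_eq[of "s (r \<odot>\<^bsub>M\<^esub> x)" "r \<odot>\<^bsub>T\<^esub> s x"]
      by (simp add: s hom_smult[OF assms(4)] hom_smult[OF assms(6)])
  qed (use s assms hom_closed[OF assms(6)] in auto)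
  moreover have "f (s (p x)) = f x" if "x \<in> carrier T" for x
    using that hom_closed[OF assms(4)] by (intro f_eq) (simp_all add: s)
  ultimately show ?thesis
    by (intro that[of "\<lambda>x\<in>carrier M. f (s x)"]) (simp_all add: hom_closed[OF assms(4)])
qed

lemma submodule_image:
  assumes "module R A" "module R B" "f \<in> hom_set R A B"
  shows "submodule (f ` carrier A) R B"
proof -
  interpret A: module R A by fact
  interpret B: module R B by fact
  note f = hom_zero[OF assms, symmetric] hom_uminus[OF assms, symmetric]
    hom_add[OF assms(3), symmetric] hom_smult[OF assms(3), symmetric]
  show ?thesis
    by (rule B.submoduleI) (auto simp: f hom_closed[OF assms(3)])
qed

section \<open>Quotients, direct sums and transport of structure\<close>

text \<open>All module axioms are inherited along a surjection compatible with the operations.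
  \<open>B\<close> is a mere record here, so the lemma covers quotients as well as copies on another
  type.\<close>

lemma module_surjI:
  assumes "module R A"
    and "\<pi> ` carrier A = carrier B" "\<zero>\<^bsub>B\<^esub> = \<pi> \<zero>\<^bsub>A\<^esub>"
    and add: "\<And>x y. x \<in> carrier A \<Longrightarrow> y \<in> carrier A \<Longrightarrow> \<pi> x \<oplus>\<^bsub>B\<^esub> \<pi> y = \<pi> (x \<oplus>\<^bsub>A\<^esub> y)"
    and smult: "\<And>r x. r \<in> carrier R \<Longrightarrow> x \<in> carrier A \<Longrightarrow> r \<odot>\<^bsub>B\<^esub> \<pi> x = \<pi> (r \<odot>\<^bsub>A\<^esub> x)"
  shows "module R B" "restrict \<pi> (carrier A) \<in> hom_set R A B"
proof -
  interpret A: module R A by fact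
  note carr = assms(2)[symmetric]
  have "abelian_group B"
  proof (rule abelian_groupI)
    show "\<exists>y\<in>carrier B. y \<oplus>\<^bsub>B\<^esub> x = \<zero>\<^bsub>B\<^esub>" if "x \<in> carrier B" for x
    proof -
      obtain a where "a \<in> carrier A" "x = \<pi> a"
        using \<open>x \<in> carrier B\<close> carr by auto
      then show ?thesis
        by (intro bexI[of _ "\<pi> (\<ominus>\<^bsub>A\<^esub> a)"]) (simp_all add: add assms(3) carr A.l_neg)
    qed
  qed (auto simp: carr assms(3) add A.a_ac)
  then show "module R B"
    by (rule moduleI[OF A.is_cring])
      (auto simp: carr add smult A.smult_l_distr A.smult_r_distr A.smult_assoc1)
  show "restrict \<pi> (carrier A) \<in> hom_set R A B"
    using assms(1) by (rule hom_setI) (simp_all add: carr add smult)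
qed

text \<open>\<open>N \<oplus> B\<close> is realised on a type of pairs; an infinite type is equipotent to its square, so that
  such modules and their quotients can be copied back to the given type.\<close>

definition transport :: "('a \<Rightarrow> 'b) \<Rightarrow> ('r, 'a) module \<Rightarrow> ('r, 'b) module" where
  "transport \<phi> A =
     (let \<psi> = inv_into (carrier A) \<phi> in
      \<lparr>carrier = \<phi> ` carrier A, mult = undefined, one = undefined, zero = \<phi> \<zero>\<^bsub>A\<^esub>,
       add = (\<lambda>x y. \<phi> (\<psi> x \<oplus>\<^bsub>A\<^esub> \<psi> y)), smult = (\<lambda>r x. \<phi> (r \<odot>\<^bsub>A\<^esub> \<psi> x))\<rparr>)"

lemma transport:
  assumes "module R A" "inj_on \<phi> (carrier A)"
  shows "module R (transport \<phi> A)" "restrict \<phi> (carrier A) \<in> hom_set R A (transport \<phi> A)"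
    "bij_betw \<phi> (carrier A) (carrier (transport \<phi> A))"
proof -
  have *: "\<phi> ` carrier A = carrier (transport \<phi> A)" "\<zero>\<^bsub>transport \<phi> A\<^esub> = \<phi> \<zero>\<^bsub>A\<^esub>"
    by (simp_all add: transport_def Let_def)
  have **: "\<phi> x \<oplus>\<^bsub>transport \<phi> A\<^esub> \<phi> y = \<phi> (x \<oplus>\<^bsub>A\<^esub> y)" if "x \<in> carrier A" "y \<in> carrier A" for x y
    using that assms(2) by (simp add: transport_def Let_def)
  have ***: "r \<odot>\<^bsub>transport \<phi> A\<^esub> \<phi> x = \<phi> (r \<odot>\<^bsub>A\<^esub> x)" if "x \<in> carrier A" for r x
    using that assms(2) by (simp add: transport_def Let_def)
  show "module R (transport \<phi> A)" "restrict \<phi> (carrier A) \<in> hom_set R A (transport \<phi> A)"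
    by (rule module_surjI[OF assms(1) * ** ***]; simp)+
  show "bij_betw \<phi> (carrier A) (carrier (transport \<phi> A))"
    using assms(2) * by (simp add: bij_betw_def)
qed

lemma module_direct_sum:
  assumes "module R A" "module R B"
  shows "module R (direct_sum A B)"
proof -
  interpret A: module R A by fact
  interpret B: module R B by fact
  note [simp] = direct_sum_def
  have "abelian_group (direct_sum A B)"
  proof (rule abelian_groupI)
    show "\<exists>y\<in>carrier (direct_sum A B). y \<oplus>\<^bsub>direct_sum A B\<^esub> x = \<zero>\<^bsub>direct_sum A B\<^esub>"
      if "x \<in> carrier (direct_sum A B)" for x
      using that by (intro bexI[of _ "(\<ominus>\<^bsub>A\<^esub> fst x, \<ominus>\<^bsub>B\<^esub> snd x)"]) (auto simp: A.l_neg B.l_neg)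
  qed (auto simp: A.a_ac B.a_ac)
  then show ?thesis
    by (rule moduleI[OF A.is_cring])
      (auto simp: A.smult_l_distr B.smult_l_distr A.smult_r_distr B.smult_r_distr
        A.smult_assoc1 B.smult_assoc1)
qed

lemma abelian_subgroup_submodule: "module R A \<Longrightarrow> submodule H R A \<Longrightarrow> abelian_subgroup H A"
  by (simp add: abelian_subgroupI3 additive_subgroup.intro module.axioms(2) submodule.axioms(1))

lemma coset_eq_iff:
  assumes "module R A" "submodule H R A" "x \<in> carrier A" "y \<in> carrier A"
  shows "H +>\<^bsub>A\<^esub> x = H +>\<^bsub>A\<^esub> y \<longleftrightarrow> x \<ominus>\<^bsub>A\<^esub> y \<in> H"
proof -
  interpret abelian_subgroup H A by (rule abelian_subgroup_submodule[OF assms(1,2)])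
  show ?thesis
    using a_repr_independence'[OF _ assms(4), of x] a_rcos_self[OF assms(3)] a_rcos_module[OF assms(4,3)]
    by (auto simp: a_minus_def)
qed

lemma quot_module:
  assumes "module R A" "submodule H R A"
  shows "module R (quot_module A H)"
    and "(\<lambda>x\<in>carrier A. H +>\<^bsub>A\<^esub> x) \<in> hom_set R A (quot_module A H)"
    and "carrier (quot_module A H) = (\<lambda>x. H +>\<^bsub>A\<^esub> x) ` carrier A"
    and "\<And>x. x \<in> carrier A \<Longrightarrow> H +>\<^bsub>A\<^esub> x = \<zero>\<^bsub>quot_module A H\<^esub> \<longleftrightarrow> x \<in> H"
proof -
  interpret A: module R A by fact
  interpret H: abelian_subgroup H A by (rule abelian_subgroup_submodule[OF assms])
  let ?Q = "quot_module A H"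
  have carr: "(\<lambda>x. H +>\<^bsub>A\<^esub> x) ` carrier A = carrier ?Q"
    by (auto simp: quot_module_def A_RCOSETS_def')
  have zero: "\<zero>\<^bsub>?Q\<^esub> = H +>\<^bsub>A\<^esub> \<zero>\<^bsub>A\<^esub>"
    using H.a_rcos_const[OF H.zero_closed] by (simp add: quot_module_def)
  have add: "(H +>\<^bsub>A\<^esub> x) \<oplus>\<^bsub>?Q\<^esub> (H +>\<^bsub>A\<^esub> y) = H +>\<^bsub>A\<^esub> (x \<oplus>\<^bsub>A\<^esub> y)"
    if "x \<in> carrier A" "y \<in> carrier A" for x y
    using H.a_rcos_sum[OF that] by (simp add: quot_module_def)
  have smult: "r \<odot>\<^bsub>?Q\<^esub> (H +>\<^bsub>A\<^esub> x) = H +>\<^bsub>A\<^esub> (r \<odot>\<^bsub>A\<^esub> x)" if r: "r \<in> carrier R" and x: "x \<in> carrier A" for r x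
  proof -
    \<comment> \<open>Scalar multiplication on the quotient is a union over all representatives
      \<open>y\<close>; as \<open>H\<close> absorbs scalars, every \<open>y\<close> contributes the
      same coset.\<close>
    have "H +>\<^bsub>A\<^esub> (r \<odot>\<^bsub>A\<^esub> y) = H +>\<^bsub>A\<^esub> (r \<odot>\<^bsub>A\<^esub> x)" if "y \<in> H +>\<^bsub>A\<^esub> x" for y
    proof -
      have y: "y \<in> carrier A" using H.a_elemrcos_carrier[OF x that] .
      then have "y \<ominus>\<^bsub>A\<^esub> x \<in> H"
        using that x by (simp add: a_minus_def H.a_rcos_module)
      then have "r \<odot>\<^bsub>A\<^esub> (y \<ominus>\<^bsub>A\<^esub> x) \<in> H"
        by (rule submodule.smult_closed[OF assms(2) r])
      then have "r \<odot>\<^bsub>A\<^esub> y \<ominus>\<^bsub>A\<^esub> r \<odot>\<^bsub>A\<^esub> x \<in> H"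
        using r x y by (simp add: a_minus_def A.smult_r_distr A.smult_r_minus)
      then show ?thesis
        using r x y by (subst coset_eq_iff[OF assms]) simp_all
    qed
    then have "(\<Union>y\<in>H +>\<^bsub>A\<^esub> x. H +>\<^bsub>A\<^esub> (r \<odot>\<^bsub>A\<^esub> y)) = H +>\<^bsub>A\<^esub> (r \<odot>\<^bsub>A\<^esub> x)"
      using H.a_rcos_self[OF x] by blast
    then show ?thesis
      by (simp add: quot_module_def)
  qed
  show "module R ?Q" "(\<lambda>x\<in>carrier A. H +>\<^bsub>A\<^esub> x) \<in> hom_set R A ?Q"
    by (rule module_surjI[OF assms(1) carr zero add smult]; assumption)+
  show "carrier ?Q = (\<lambda>x. H +>\<^bsub>A\<^esub> x) ` carrier A"
    by (simp add: carr)
  show "H +>\<^bsub>A\<^esub> x = \<zero>\<^bsub>?Q\<^esub> \<longleftrightarrow> x \<in> H" if "x \<in> carrier A" for x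
    unfolding zero using that module_diff_add_cancel[OF assms(1) that A.zero_closed]
    by (subst coset_eq_iff[OF assms]) simp_all
qed

text \<open>Only the restriction of \<open>f\<close> is assumed linear because the pushout applies
  this to \<open>\<lambda>y. \<epsilon> (snd y)\<close>, which is not extensional. Linearity on
  cosets is not computed from \<open>the_elem\<close>; it is borrowed from a factorization
  \<open>h\<close> with the same values.\<close>

lemma induced_map:
  assumes "module R A" "module R B" "submodule H R A" "restrict f (carrier A) \<in> hom_set R A B"
    and "\<And>x. x \<in> H \<Longrightarrow> f x = \<zero>\<^bsub>B\<^esub>"
  shows "\<And>x. x \<in> carrier A \<Longrightarrow> induced_map A H f (H +>\<^bsub>A\<^esub> x) = f x"
    and "induced_map A H f \<in> hom_set R (quot_module A H) B"
proof -
  interpret A: module R A by fact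
  interpret H: abelian_subgroup H A by (rule abelian_subgroup_submodule[OF assms(1,3)])
  show *: "induced_map A H f (H +>\<^bsub>A\<^esub> x) = f x" if x: "x \<in> carrier A" for x
  proof -
    have "f y = f x" if "y \<in> H +>\<^bsub>A\<^esub> x" for y
    proof -
      have y: "y \<in> carrier A" using H.a_elemrcos_carrier[OF x that] .
      then have "y \<ominus>\<^bsub>A\<^esub> x \<in> H"
        using that x by (simp add: a_minus_def H.a_rcos_module)
      then show ?thesis
        using assms(5) x y hom_diff[OF assms(1,2,4) y x] hom_closed[OF assms(4) x]
          hom_closed[OF assms(4) y] module_diff_zero_iff[OF assms(2), of "f y" "f x"] by simp
    qed
    then have "f ` (H +>\<^bsub>A\<^esub> x) = {f x}"
      using H.a_rcos_self[OF x] by blast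
    moreover have "H +>\<^bsub>A\<^esub> x \<in> carrier (quot_module A H)"
      using x by (simp add: quot_module(3)[OF assms(1,3)])
    ultimately show ?thesis
      by (simp add: induced_map_def)
  qed
  note Q = quot_module[OF assms(1,3)]
  obtain h where h: "h \<in> hom_set R (quot_module A H) B" "\<And>x. x \<in> carrier A \<Longrightarrow> h (H +>\<^bsub>A\<^esub> x) = f x"
    by (rule factor_through_epi[OF assms(1) Q(1) assms(2) Q(2) _ assms(4)])
      (use Q(3,4) assms(5) in auto)
  have "induced_map A H f = h"
  proof (rule extensionalityI[OF _ hom_extensional[OF h(1)]])
    show "induced_map A H f C = h C" if "C \<in> carrier (quot_module A H)" for C
      using that * h(2) unfolding Q(3) by auto
  qed (simp add: induced_map_def)
  with h(1) show "induced_map A H f \<in> hom_set R (quot_module A H) B" by simp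
qed

section \<open>Short exact sequences\<close>

text \<open>Elementwise exactness with the middle term on an arbitrary type, so that pushouts and
  pullbacks qualify before they are copied to \<open>'m\<close>; \<open>is_extension\<close> cannot
  speak about them.\<close>

definition short_exact ::
  "'r ring \<Rightarrow> ('r, 'm) module \<Rightarrow> ('r, 'm) module \<Rightarrow> ('r, 'm, 't) ext \<Rightarrow> bool" where
  "short_exact R M N = (\<lambda>(T, i, p).
     module R T \<and> i \<in> hom_set R N T \<and> p \<in> hom_set R T M \<and> inj_on i (carrier N) \<and>
     {x \<in> carrier T. p x = \<zero>\<^bsub>M\<^esub>} = i ` carrier N \<and> p ` carrier T = carrier M)"

lemma short_exactD:
  assumes "short_exact R M N (T, i, p)"
  shows "module R T" "i \<in> hom_set R N T" "p \<in> hom_set R T M" "inj_on i (carrier N)"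
    "p ` carrier T = carrier M"
    and "\<And>x. x \<in> carrier N \<Longrightarrow> p (i x) = \<zero>\<^bsub>M\<^esub>"
    and "\<And>y. y \<in> carrier T \<Longrightarrow> p y = \<zero>\<^bsub>M\<^esub> \<Longrightarrow> y \<in> i ` carrier N"
  using assms by (auto simp: short_exact_def)

lemma is_extension_iff_short_exact:
  assumes "module R M" "module R N"
  shows "is_extension R M N E \<longleftrightarrow> short_exact R M N E"
proof -
  obtain T i p where E: "E = (T, i, p)" by (cases E) auto
  interpret M: module R M by fact
  interpret N: module R N by fact
  have "exact_complex (ext_complex M N E) \<longleftrightarrow>
      inj_on i (carrier N) \<and> {x \<in> carrier T. p x = \<zero>\<^bsub>M\<^esub>} = i ` carrier N \<and> p ` carrier T = carrier M"
    if T: "module R T" and i: "i \<in> hom_set R N T"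
  proof -
    let ?C = "ext_complex M N E"
    note defs = E ext_complex_def Let_def cycles_def boundaries_def zero_hom_def zero_module_def
    \<comment> \<open>Outside the three degrees the module is \<open>zero_module\<close>. In degree
      -2 its only element has to be a boundary, which holds because \<open>M\<close> contains
      zero.\<close>
    have "cycles ?C n = boundaries ?C n" if "n \<noteq> 1" "n \<noteq> 0" "n \<noteq> - 1" for n
      using that M.zero_closed by (auto simp: defs)
    then have "exact_complex ?C \<longleftrightarrow> (\<forall>n\<in>{1, 0, - 1}. cycles ?C n = boundaries ?C n)"
      unfolding exact_complex_def by blast
    moreover have "cycles ?C 1 = boundaries ?C 1 \<longleftrightarrow> inj_on i (carrier N)"
      using hom_zero[OF assms(2) T i] by (auto simp: defs hom_inj_on_iff[OF assms(2) T i])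
    moreover have "cycles ?C 0 = {x \<in> carrier T. p x = \<zero>\<^bsub>M\<^esub>}" "boundaries ?C 0 = i ` carrier N"
        "cycles ?C (- 1) = carrier M" "boundaries ?C (- 1) = p ` carrier T"
      by (auto simp: defs)
    ultimately show ?thesis by auto
  qed
  then show ?thesis
    by (auto simp: is_extension_def short_exact_def E)
qed

lemma ext_equiv_trans:
  assumes "short_exact R M N E" "ext_equiv R N E E'" "ext_equiv R N E' E''"
  shows "ext_equiv R N E E''"
proof -
  obtain T i p T' i' p' T'' i'' p'' where E: "E = (T, i, p)" "E' = (T', i', p')" "E'' = (T'', i'', p'')"
    by (cases E; cases E'; cases E'') auto
  note T = short_exactD[OF assms(1)[unfolded E(1)]]
  obtain h where h: "h \<in> hom_set R T T'" "compose (carrier N) h i = i'" "compose (carrier T) p' h = p"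
    using assms(2) by (auto simp: ext_equiv_def E)
  obtain k where k: "k \<in> hom_set R T' T''" "compose (carrier N) k i' = i''" "compose (carrier T') p'' k = p'"
    using assms(3) by (auto simp: ext_equiv_def E)
  have "compose (carrier N) (compose (carrier T) k h) i = i''"
    unfolding k(2)[symmetric] h(2)[symmetric]
    using hom_closed[OF T(2)] by (intro extensionalityI[OF compose_extensional compose_extensional])
      (simp add: compose_eq)
  moreover have "compose (carrier T) p'' (compose (carrier T) k h) = p"
    unfolding h(3)[symmetric] k(3)[symmetric]
    using hom_closed[OF h(1)] by (intro extensionalityI[OF compose_extensional compose_extensional])
      (simp add: compose_eq)
  ultimately show ?thesis
    using hom_compose[OF T(1) h(1) k(1)] by (auto simp: ext_equiv_def E)
qed

text \<open>By the short five lemma, a morphism of extensions is an isomorphism.\<close>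

lemma ext_equiv_sym:
  assumes "module R M" "module R N" "short_exact R M N E" "short_exact R M N E'" "ext_equiv R N E E'"
  shows "ext_equiv R N E' E"
proof -
  obtain T i p T' i' p' where E: "E = (T, i, p)" "E' = (T', i', p')"
    by (cases E; cases E') auto
  note T = short_exactD[OF assms(3)[unfolded E]]
  note T' = short_exactD[OF assms(4)[unfolded E]]
  interpret T: module R T by (rule T(1))
  interpret T': module R T' by (rule T'(1))
  obtain h where h: "h \<in> hom_set R T T'" "compose (carrier N) h i = i'" "compose (carrier T) p' h = p"
    using assms(5) by (auto simp: ext_equiv_def E)
  have hi: "h (i x) = i' x" if "x \<in> carrier N" for x using h(2) that by (rule compose_eqD)
  have ph: "p' (h x) = p x" if "x \<in> carrier T" for x using h(3) that by (rule compose_eqD)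
  have inj: "x = \<zero>\<^bsub>T\<^esub>" if x: "x \<in> carrier T" "h x = \<zero>\<^bsub>T'\<^esub>" for x
  proof -
    have "p x = \<zero>\<^bsub>M\<^esub>"
      using ph[OF x(1)] x(2) hom_zero[OF T'(1) assms(1) T'(3)] by simp
    then obtain n where n: "n \<in> carrier N" "x = i n" using T(7)[OF x(1)] by auto
    then have "i' n = \<zero>\<^bsub>T'\<^esub>" using hi x(2) by simp
    then have "n = \<zero>\<^bsub>N\<^esub>"
      using n(1) T'(4) hom_inj_on_iff[OF assms(2) T'(1,2)] by blast
    then show ?thesis using n hom_zero[OF assms(2) T(1,2)] by simp
  qed
  have surj: "\<exists>x\<in>carrier T. h x = y" if y: "y \<in> carrier T'" for y
  proof -
    have "p' y \<in> p ` carrier T" using y hom_closed[OF T'(3)] T(5) by simp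
    then obtain x where x: "x \<in> carrier T" "p x = p' y" by (metis imageE)
    have hx: "h x \<in> carrier T'" by (rule hom_closed[OF h(1) x(1)])
    have "p' (y \<ominus>\<^bsub>T'\<^esub> h x) = \<zero>\<^bsub>M\<^esub>"
      using x y hx ph[OF x(1)] hom_closed[OF T'(3) y] module_diff_zero_iff[OF assms(1)]
      by (simp add: hom_diff[OF T'(1) assms(1) T'(3)])
    then have "y \<ominus>\<^bsub>T'\<^esub> h x \<in> i' ` carrier N" using T'(7) y hx by simp
    then obtain n where n: "n \<in> carrier N" "y \<ominus>\<^bsub>T'\<^esub> h x = i' n" by auto
    have "h (i n \<oplus>\<^bsub>T\<^esub> x) = y"
      using n x hx y hi[OF n(1)] module_diff_add_cancel[OF T'(1) y hx]
      by (simp add: hom_add[OF h(1)] hom_closed[OF T(2)])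
    then show ?thesis using n x hom_closed[OF T(2)] by (metis T.a_closed)
  qed
  have h_surj: "h ` carrier T = carrier T'" using surj hom_closed[OF h(1)] by fast
  \<comment> \<open>The inverse of \<open>h\<close> is obtained by factoring the identity of
    \<open>T\<close> through \<open>h\<close>, which is onto with trivial kernel.\<close>
  obtain k where k: "k \<in> hom_set R T' T" "\<And>x. x \<in> carrier T \<Longrightarrow> k (h x) = (\<lambda>x\<in>carrier T. x) x"
    by (rule factor_through_epi[OF T(1) T'(1) T(1) h(1) h_surj hom_id[OF T(1)]]) (use inj in auto)
  have "compose (carrier N) k i' = i"
    using T(2) by (rule compose_eqI) (use k(2) hi hom_closed[OF T(2)] in \<open>metis restrict_apply'\<close>)
  moreover have "compose (carrier T') p k = p'"
    using T'(3) by (rule compose_eqI) (use k(2) ph surj in \<open>metis restrict_apply'\<close>)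
  ultimately show ?thesis using k(1) by (auto simp: ext_equiv_def E)
qed

text \<open>The structure maps are carried along \<open>\<phi>\<close>, so that
  \<open>\<phi>\<close> itself is the equivalence. With \<open>\<phi>\<close> into \<open>'m\<close>
  this yields members of \<open>ext_class\<close> from extensions built on other types.\<close>

lemma short_exact_transport:
  fixes T :: "('r, 't) module" and M N :: "('r, 'm) module" and \<phi> :: "'t \<Rightarrow> 'u"
  assumes "module R M" "module R N" "short_exact R M N (T, i, p)" "inj_on \<phi> (carrier T)"
  obtains E' :: "('r, 'm, 'u) ext" where "short_exact R M N E'" "ext_equiv R N (T, i, p) E'"
proof -
  note T = short_exactD[OF assms(3)]
  let ?T = "transport \<phi> T"
  let ?h = "restrict \<phi> (carrier T)"
  note h = transport[OF T(1) assms(4)]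
  have surj: "?h ` carrier T = carrier ?T" using h(3) by (simp add: bij_betw_def)
  have "inj_on ?h (carrier T)" using assms(4) by (simp add: inj_on_def)
  then have ker: "p x = \<zero>\<^bsub>M\<^esub>" if "x \<in> carrier T" "?h x = \<zero>\<^bsub>?T\<^esub>" for x
    using that hom_inj_on_iff[OF T(1) h(1,2)] hom_zero[OF T(1) assms(1) T(3)] by blast
  obtain p' where p': "p' \<in> hom_set R ?T M" "\<And>x. x \<in> carrier T \<Longrightarrow> p' (?h x) = p x"
    by (rule factor_through_epi[OF T(1) h(1) assms(1) h(2) surj T(3)]) (blast intro: ker)+
  define i' where "i' = compose (carrier N) ?h i"
  have i'_eq: "i' x = \<phi> (i x)" if "x \<in> carrier N" for x
    using that hom_closed[OF T(2)] by (simp add: i'_def compose_eq)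
  have "{x \<in> carrier ?T. p' x = \<zero>\<^bsub>M\<^esub>} = i' ` carrier N"
    using T(6,7) p'(2) i'_eq hom_closed[OF T(2)] unfolding surj[symmetric] by (auto simp: image_iff) metis+
  moreover have "inj_on i' (carrier N)"
    using T(4) assms(4) hom_closed[OF T(2)] by (simp add: inj_on_def i'_eq)
  moreover have "p' ` carrier ?T = carrier M"
    unfolding T(5)[symmetric] surj[symmetric] using p'(2) by (auto simp: image_iff)
  ultimately have "short_exact R M N (?T, i', p')"
    using h(1) p'(1) hom_compose[OF assms(2) T(2) h(2)] by (simp add: short_exact_def i'_def)
  moreover have "ext_equiv R N (T, i, p) (?T, i', p')"
    using p'(2) by (auto simp: ext_equiv_def i'_def intro!: bexI[OF _ h(2)] compose_eqI[OF T(3)])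
  ultimately show ?thesis by (rule that)
qed

lemma infinite_imp_inj_square:
  assumes "infinite (UNIV :: 'm set)"
  obtains \<phi> :: "'m \<times> 'm \<Rightarrow> 'm" where "inj \<phi>"
  using card_of_Times_same_infinite[OF assms] unfolding card_of_ordIso[symmetric]
  by (auto simp: bij_betw_def)

section \<open>Pushouts and pullbacks\<close>

text \<open>A morphism from the pushout that restricts to \<open>i\<close> on \<open>N\<close> is
  determined by its restriction \<open>g\<close> to \<open>X0\<close>, and \<open>g\<close> is
  admissible when \<open>g d = i \<alpha>\<close>. The second claim records this together with
  compatibility over \<open>M\<close>; later arguments use it in place of the quotient.\<close>

lemma pushout_extension:
  fixes M N X0 X1 :: "('r, 'm) module" and d \<epsilon> \<alpha> :: "'m \<Rightarrow> 'm" and R :: "'r ring"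
  assumes mods: "module R M" "module R N" "module R X0" "module R X1"
    and \<epsilon>: "\<epsilon> \<in> hom_set R X0 M" "\<epsilon> ` carrier X0 = carrier M"
    and d: "d \<in> hom_set R X1 X0" "{x \<in> carrier X0. \<epsilon> x = \<zero>\<^bsub>M\<^esub>} = d ` carrier X1"
    and B: "submodule B R X1" "{x \<in> carrier X1. d x = \<zero>\<^bsub>X0\<^esub>} = B"
    and \<alpha>: "\<alpha> \<in> hom_set R X1 N" "\<forall>x\<in>B. \<alpha> x = \<zero>\<^bsub>N\<^esub>"
  defines "E \<equiv> pushout_extension N (quot_module X1 B) X0 (induced_map X1 B d) \<epsilon> (induced_map X1 B \<alpha>)"
  shows "short_exact R M N E"
    and "\<And>T i p. short_exact R M N (T, i, p) \<Longrightarrow> ext_equiv R N E (T, i, p) \<longleftrightarrow>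
      (\<exists>g\<in>hom_set R X0 T. (\<forall>x\<in>carrier X0. p (g x) = \<epsilon> x) \<and> (\<forall>x\<in>carrier X1. g (d x) = i (\<alpha> x)))"
    and "infinite (UNIV :: 'm set) \<Longrightarrow> \<exists>E' :: ('r, 'm, 'm) ext. short_exact R M N E' \<and> ext_equiv R N E E'"
proof -
  interpret M: module R M by fact
  interpret N: module R N by fact
  interpret X0: module R X0 by fact
  interpret X1: module R X1 by fact
  define S where "S = direct_sum N X0"
  \<comment> \<open>\<open>K\<close> is taken as the image of a map defined on \<open>X1\<close>
    itself. The formula in \<open>pushout_extension\<close> runs over cosets of \<open>B\<close> and
    gives the same set, because both induced maps return the value at a representative.\<close>
  define \<kappa> where "\<kappa> = (\<lambda>x\<in>carrier X1. (\<alpha> x, \<ominus>\<^bsub>X0\<^esub> d x))"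
  define K where "K = \<kappa> ` carrier X1"
  have S: "module R S" unfolding S_def using mods(2,3) by (rule module_direct_sum)
  have \<kappa>: "\<kappa> \<in> hom_set R X1 S"
    unfolding \<kappa>_def using hom_closed[OF \<alpha>(1)] hom_closed[OF d(1)]
    by (intro hom_setI[OF mods(4)])
      (auto simp: S_def direct_sum_def hom_add[OF \<alpha>(1)] hom_add[OF d(1)] hom_smult[OF \<alpha>(1)] hom_smult[OF d(1)]
        X0.minus_add X0.smult_r_minus)
  have K: "submodule K R S" unfolding K_def by (rule submodule_image[OF mods(4) S \<kappa>])
  note Q = quot_module[OF S K]
  let ?Q = "quot_module S K"
  define \<pi> where "\<pi> = (\<lambda>x\<in>carrier S. K +>\<^bsub>S\<^esub> x)"
  have \<pi>: "\<pi> \<in> hom_set R S ?Q" unfolding \<pi>_def by (rule Q(2))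
  have \<pi>_surj: "\<pi> ` carrier S = carrier ?Q" by (simp add: Q(3) \<pi>_def)
  have \<pi>_zero: "\<pi> x = \<zero>\<^bsub>?Q\<^esub> \<longleftrightarrow> x \<in> K" if "x \<in> carrier S" for x
    using Q(4)[OF that] that by (simp add: \<pi>_def)
  have \<pi>_eq: "\<pi> x = \<pi> y" if "x \<in> carrier S" "y \<in> carrier S" "x \<ominus>\<^bsub>S\<^esub> y \<in> K" for x y
    using that coset_eq_iff[OF S K] by (simp add: \<pi>_def)
  have S_carr: "carrier S = carrier N \<times> carrier X0" by (simp add: S_def direct_sum_def)
  have S_diff: "(n, b) \<ominus>\<^bsub>S\<^esub> (n', b') = (n \<ominus>\<^bsub>N\<^esub> n', b \<ominus>\<^bsub>X0\<^esub> b')"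
    if "n \<in> carrier N" "n' \<in> carrier N" "b \<in> carrier X0" "b' \<in> carrier X0" for n n' b b'
  proof -
    interpret S: module R S by (rule S)
    have "(n \<ominus>\<^bsub>N\<^esub> n', b \<ominus>\<^bsub>X0\<^esub> b') \<oplus>\<^bsub>S\<^esub> (n', b') = (n, b)"
      using that module_diff_add_cancel[OF mods(2)] module_diff_add_cancel[OF mods(3)]
      by (simp add: S_def direct_sum_def)
    then show ?thesis
      using that by (simp add: a_minus_def S.add.inv_solve_right' S_carr)
  qed
  have "(\<lambda>u. (induced_map X1 B \<alpha> u, \<ominus>\<^bsub>X0\<^esub> induced_map X1 B d u)) ` carrier (quot_module X1 B) = K"
  proof -
    have "induced_map X1 B \<alpha> (B +>\<^bsub>X1\<^esub> x) = \<alpha> x" if "x \<in> carrier X1" for x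
      by (rule induced_map(1)[OF mods(4,2) B(1) _ _ that]) (simp_all add: restrict_hom[OF \<alpha>(1)] \<alpha>)
    moreover have "induced_map X1 B d (B +>\<^bsub>X1\<^esub> x) = d x" if "x \<in> carrier X1" for x
      by (rule induced_map(1)[OF mods(4,3) B(1) _ _ that]) (use B(2) in \<open>auto simp: restrict_hom[OF d(1)] d\<close>)
    ultimately show ?thesis
      by (auto simp: quot_module(3)[OF mods(4) B(1)] image_image K_def \<kappa>_def cong: image_cong_simp)
  qed
  then have E: "E = (?Q, \<lambda>x\<in>carrier N. K +>\<^bsub>S\<^esub> (x, \<zero>\<^bsub>X0\<^esub>), induced_map S K (\<lambda>y. \<epsilon> (snd y)))"
    unfolding E_def pushout_extension_def Let_def S_def[symmetric] by simp
  define \<iota> where "\<iota> = (\<lambda>x\<in>carrier N. K +>\<^bsub>S\<^esub> (x, \<zero>\<^bsub>X0\<^esub>))"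
  define \<rho> where "\<rho> = induced_map S K (\<lambda>y. \<epsilon> (snd y))"
  have \<iota>_eq: "\<iota> x = \<pi> (x, \<zero>\<^bsub>X0\<^esub>)" if "x \<in> carrier N" for x
    using that by (simp add: \<iota>_def \<pi>_def S_carr)
  have S_ops: "(n, b) \<oplus>\<^bsub>S\<^esub> (n', b') = (n \<oplus>\<^bsub>N\<^esub> n', b \<oplus>\<^bsub>X0\<^esub> b')"
      "r \<odot>\<^bsub>S\<^esub> (n, b) = (r \<odot>\<^bsub>N\<^esub> n, r \<odot>\<^bsub>X0\<^esub> b)" for r n b n' b'
    by (simp_all add: S_def direct_sum_def)
  have \<iota>: "\<iota> \<in> hom_set R N ?Q"
  proof -
    have "(\<lambda>x\<in>carrier N. (x, \<zero>\<^bsub>X0\<^esub>)) \<in> hom_set R N S"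
      by (rule hom_setI[OF mods(2)]) (simp_all add: S_carr S_ops)
    from hom_compose[OF mods(2) this \<pi>] show ?thesis
      by (simp add: compose_def \<iota>_def \<pi>_def S_carr cong: restrict_cong)
  qed
  have \<epsilon>S: "(\<lambda>y\<in>carrier S. \<epsilon> (snd y)) \<in> hom_set R S M"
    using hom_closed[OF \<epsilon>(1)]
    by (intro hom_setI[OF S]) (auto simp: S_carr S_ops hom_add[OF \<epsilon>(1)] hom_smult[OF \<epsilon>(1)])
  have \<epsilon>d: "\<epsilon> (d x) = \<zero>\<^bsub>M\<^esub>" if "x \<in> carrier X1" for x
    using that d(2) by auto
  have \<epsilon>K: "\<epsilon> (snd y) = \<zero>\<^bsub>M\<^esub>" if "y \<in> K" for y
    using that hom_closed[OF d(1)] by (auto simp: K_def \<kappa>_def hom_uminus[OF mods(3,1) \<epsilon>(1)] \<epsilon>d M.add.inv_one)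
  note \<rho> = induced_map[OF S mods(1) K \<epsilon>S \<epsilon>K, folded \<rho>_def]
  have \<rho>_eq: "\<rho> (\<pi> (n, b)) = \<epsilon> b" if "n \<in> carrier N" "b \<in> carrier X0" for n b
    using that \<rho>(1)[of "(n, b)"] by (simp add: \<pi>_def S_carr)
  have E: "E = (?Q, \<iota>, \<rho>)" by (simp add: E \<iota>_def \<rho>_def)
  show short_exact: "short_exact R M N E"
    unfolding E short_exact_def prod.case
  proof (intro conjI Q(1) \<iota> \<rho>(2))
    show "inj_on \<iota> (carrier N)"
      unfolding hom_inj_on_iff[OF mods(2) Q(1) \<iota>]
    proof (intro ballI impI)
      fix n assume n: "n \<in> carrier N" "\<iota> n = \<zero>\<^bsub>?Q\<^esub>"
      then have "(n, \<zero>\<^bsub>X0\<^esub>) \<in> K"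
        using \<pi>_zero[of "(n, \<zero>\<^bsub>X0\<^esub>)"] by (simp add: \<iota>_eq S_carr)
      then obtain x where x: "x \<in> carrier X1" "n = \<alpha> x" "\<zero>\<^bsub>X0\<^esub> = \<ominus>\<^bsub>X0\<^esub> d x"
        by (auto simp: K_def \<kappa>_def)
      \<comment> \<open>\<open>d x = 0\<close> puts \<open>x\<close> into \<open>B\<close>, where
        \<open>\<alpha>\<close> vanishes by the cocycle condition: this makes \<open>N\<close>
        embed.\<close>
      then have "d x = \<zero>\<^bsub>X0\<^esub>"
        using hom_closed[OF d(1)] by (metis X0.add.inv_eq_1_iff)
      then show "n = \<zero>\<^bsub>N\<^esub>" using x B(2) \<alpha>(2) by blast
    qed
    show "{x \<in> carrier ?Q. \<rho> x = \<zero>\<^bsub>M\<^esub>} = \<iota> ` carrier N"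
    proof (intro equalityI subsetI)
      fix y assume "y \<in> {x \<in> carrier ?Q. \<rho> x = \<zero>\<^bsub>M\<^esub>}"
      then obtain n b where y: "n \<in> carrier N" "b \<in> carrier X0" "y = \<pi> (n, b)" "\<epsilon> b = \<zero>\<^bsub>M\<^esub>"
        using \<rho>_eq unfolding \<pi>_surj[symmetric] S_carr by auto
      then obtain x where x: "x \<in> carrier X1" "b = d x" using d(2) by auto
      have \<alpha>x: "\<alpha> x \<in> carrier N" using hom_closed[OF \<alpha>(1) x(1)] .
      \<comment> \<open>With \<open>b = d x\<close>, the pair \<open>(n, d x)\<close> agrees with
        \<open>(n + \<alpha> x, 0)\<close> modulo \<open>K\<close>; their difference is
        \<open>\<kappa> (- x)\<close>, hence the double minus.\<close>
      have "(n, b) \<ominus>\<^bsub>S\<^esub> (n \<oplus>\<^bsub>N\<^esub> \<alpha> x, \<zero>\<^bsub>X0\<^esub>) = (\<ominus>\<^bsub>N\<^esub> \<alpha> x, \<ominus>\<^bsub>X0\<^esub> (\<ominus>\<^bsub>X0\<^esub> b))"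
        using y \<alpha>x by (subst S_diff) (simp_all add: a_minus_def N.minus_add N.r_neg2)
      also have "\<dots> = \<kappa> (\<ominus>\<^bsub>X1\<^esub> x)"
        using x by (simp add: \<kappa>_def hom_uminus[OF mods(4,2) \<alpha>(1)] hom_uminus[OF mods(4,3) d(1)])
      finally have "(n, b) \<ominus>\<^bsub>S\<^esub> (n \<oplus>\<^bsub>N\<^esub> \<alpha> x, \<zero>\<^bsub>X0\<^esub>) \<in> K"
        using x by (simp add: K_def)
      then have "y = \<iota> (n \<oplus>\<^bsub>N\<^esub> \<alpha> x)"
        using y \<alpha>x by (simp add: \<iota>_eq S_carr \<pi>_eq)
      then show "y \<in> \<iota> ` carrier N" using y(1) \<alpha>x by simp
    next
      fix y assume "y \<in> \<iota> ` carrier N"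
      then show "y \<in> {x \<in> carrier ?Q. \<rho> x = \<zero>\<^bsub>M\<^esub>}"
        using hom_closed[OF \<iota>] hom_zero[OF mods(3,1) \<epsilon>(1)] by (auto simp: \<iota>_eq \<rho>_eq)
    qed
    have "\<rho> ` carrier ?Q = \<epsilon> ` carrier X0"
      unfolding \<pi>_surj[symmetric] S_carr using \<rho>_eq by (auto simp: image_iff) (blast | metis N.zero_closed)+
    then show "\<rho> ` carrier ?Q = carrier M" by (simp add: \<epsilon>)
  qed
  show "ext_equiv R N E (T, i, p) \<longleftrightarrow>
      (\<exists>g\<in>hom_set R X0 T. (\<forall>x\<in>carrier X0. p (g x) = \<epsilon> x) \<and> (\<forall>x\<in>carrier X1. g (d x) = i (\<alpha> x)))"
    (is "_ \<longleftrightarrow> ?R") if "short_exact R M N (T, i, p)" for T :: "('r, 't) module" and i p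
  proof -
    note T = short_exactD[OF that]
    interpret T: module R T by (rule T(1))
    show ?thesis
    proof
      assume "ext_equiv R N E (T, i, p)"
      then obtain h where h: "h \<in> hom_set R ?Q T" "compose (carrier N) h \<iota> = i"
          "compose (carrier ?Q) p h = \<rho>"
        by (auto simp: ext_equiv_def E)
      \<comment> \<open>\<open>g\<close> is \<open>h\<close> on the summand \<open>X0\<close>. The
        identity \<open>g d = i \<alpha>\<close> below is the relation that identifies
        \<open>(\<alpha> x, 0)\<close> with \<open>(0, d x)\<close>.\<close>
      define g where "g = (\<lambda>b\<in>carrier X0. h (\<pi> (\<zero>\<^bsub>N\<^esub>, b)))"
      have \<pi>_closed: "\<pi> (n, b) \<in> carrier ?Q" if "n \<in> carrier N" "b \<in> carrier X0" for n b
        using that by (intro hom_closed[OF \<pi>]) (simp add: S_carr)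
      have "(\<lambda>b\<in>carrier X0. (\<zero>\<^bsub>N\<^esub>, b)) \<in> hom_set R X0 S"
        by (rule hom_setI[OF mods(3)]) (simp_all add: S_carr S_ops)
      from hom_compose[OF mods(3) hom_compose[OF mods(3) this \<pi>] h(1)]
      have g: "g \<in> hom_set R X0 T"
        by (simp add: g_def compose_def cong: restrict_cong)
      have "p (g b) = \<epsilon> b" if "b \<in> carrier X0" for b
        using that compose_eqD[OF h(3), of "\<pi> (\<zero>\<^bsub>N\<^esub>, b)"] by (simp add: g_def \<pi>_closed \<rho>_eq)
      moreover have "g (d x) = i (\<alpha> x)" if x: "x \<in> carrier X1" for x
      proof -
        note cl = hom_closed[OF d(1) x] hom_closed[OF \<alpha>(1) x]
        have "(\<alpha> x, \<zero>\<^bsub>X0\<^esub>) \<ominus>\<^bsub>S\<^esub> (\<zero>\<^bsub>N\<^esub>, d x) = \<kappa> x"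
          using x cl by (subst S_diff) (simp_all add: \<kappa>_def a_minus_def)
        then have "\<pi> (\<alpha> x, \<zero>\<^bsub>X0\<^esub>) = \<pi> (\<zero>\<^bsub>N\<^esub>, d x)"
          using x cl by (intro \<pi>_eq) (simp_all add: S_carr K_def)
        then show ?thesis
          using cl compose_eqD[OF h(2) cl(2)] by (simp add: g_def \<iota>_eq)
      qed
      ultimately show ?R using g by blast
    next
      assume ?R
      then obtain g where g: "g \<in> hom_set R X0 T" "\<And>x. x \<in> carrier X0 \<Longrightarrow> p (g x) = \<epsilon> x"
          "\<And>x. x \<in> carrier X1 \<Longrightarrow> g (d x) = i (\<alpha> x)"
        by blast
      note cl = hom_closed[OF T(2)] hom_closed[OF g(1)]
      \<comment> \<open>The map on the direct sum with components \<open>i\<close> and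
        \<open>g\<close>; the relation \<open>g d = i \<alpha>\<close> makes it vanish on
        \<open>K\<close>, so it descends to the pushout.\<close>
      define f where "f = (\<lambda>y\<in>carrier S. i (fst y) \<oplus>\<^bsub>T\<^esub> g (snd y))"
      have f: "f \<in> hom_set R S T"
        unfolding f_def using cl
        by (intro hom_setI[OF S])
          (auto simp: S_carr S_ops hom_add[OF T(2)] hom_add[OF g(1)] hom_smult[OF T(2)] hom_smult[OF g(1)]
            T.a_ac T.smult_r_distr)
      have fK: "f y = \<zero>\<^bsub>T\<^esub>" if y: "y \<in> K" for y
      proof -
        obtain x where x: "x \<in> carrier X1" "y = (\<alpha> x, \<ominus>\<^bsub>X0\<^esub> d x)"
          using y unfolding K_def \<kappa>_def by auto
        then show ?thesis
          using cl hom_closed[OF d(1)] hom_closed[OF \<alpha>(1)]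
          by (simp add: f_def S_carr hom_uminus[OF mods(3) T(1) g(1)] g(3) T.r_neg)
      qed
      obtain h where h: "h \<in> hom_set R ?Q T" "\<And>y. y \<in> carrier S \<Longrightarrow> h (\<pi> y) = f y"
        by (rule factor_through_epi[OF S Q(1) T(1) \<pi> \<pi>_surj f]) (blast intro: fK dest: \<pi>_zero[THEN iffD1])+
      have "h (\<iota> n) = i n" if "n \<in> carrier N" for n
        using that cl hom_zero[OF mods(3) T(1) g(1)] by (simp add: \<iota>_eq h(2) S_carr f_def)
      moreover have "p (h y) = \<rho> y" if yQ: "y \<in> carrier ?Q" for y
      proof -
        obtain n b where y: "n \<in> carrier N" "b \<in> carrier X0" "y = \<pi> (n, b)"
          using yQ unfolding \<pi>_surj[symmetric] S_carr by auto
        then show ?thesis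
          using cl hom_closed[OF \<epsilon>(1)]
          by (simp add: h(2) S_carr f_def \<rho>_eq hom_add[OF T(3)] T(6) g(2))
      qed
      ultimately show "ext_equiv R N E (T, i, p)"
        unfolding E ext_equiv_def prod.case
        by (intro bexI[OF _ h(1)] conjI compose_eqI[OF T(2)] compose_eqI[OF \<rho>(2)])
    qed
  qed
  show "\<exists>E' :: ('r, 'm, 'm) ext. short_exact R M N E' \<and> ext_equiv R N E E'"
    if inf: "infinite (UNIV :: 'm set)"
  proof -
    obtain \<phi> :: "'m \<times> 'm \<Rightarrow> 'm" where "inj \<phi>" by (rule infinite_imp_inj_square[OF inf])
    \<comment> \<open>Each coset is first replaced by a representative pair, which loses nothing
      since \<open>inv_into\<close> of a surjection is injective, and the pair is then coded in
      \<open>'m\<close>.\<close>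
    then have "inj_on (\<phi> \<circ> inv_into (carrier S) \<pi>) (carrier ?Q)"
      unfolding \<pi>_surj[symmetric]
      by (intro comp_inj_on inj_on_inv_into) (auto intro: inj_on_subset)
    then show ?thesis
      using short_exact_transport[OF mods(1,2) short_exact[unfolded E]] E by metis
  qed
qed

lemma submodule_kernel:
  assumes "module R A" "module R B" "f \<in> hom_set R A B"
  shows "submodule {x \<in> carrier A. f x = \<zero>\<^bsub>B\<^esub>} R A"
proof -
  interpret A: module R A by fact
  interpret B: module R B by fact
  show ?thesis
    by (rule A.submoduleI)
      (auto simp: hom_zero[OF assms] hom_uminus[OF assms] hom_add[OF assms(3)] hom_smult[OF assms(3)] B.add.inv_one)
qed

text \<open>A morphism into the pullback, compatible over \<open>M\<close>, is determined by its
  component \<open>g\<close> in \<open>Y0\<close>. The criterion therefore concerns morphisms from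
  \<open>(T, i, p)\<close> to the pullback, the direction opposite to the one in
  \<open>ext_class\<close>.\<close>

lemma pullback_extension:
  fixes M N Y0 Y1 :: "('r, 'm) module" and d \<eta> \<alpha> :: "'m \<Rightarrow> 'm" and R :: "'r ring"
  assumes mods: "module R M" "module R N" "module R Y0" "module R Y1"
    and \<eta>: "\<eta> \<in> hom_set R N Y0" "inj_on \<eta> (carrier N)"
    and d: "d \<in> hom_set R Y0 Y1" "{x \<in> carrier Y0. d x = \<zero>\<^bsub>Y1\<^esub>} = \<eta> ` carrier N"
    and \<alpha>: "\<alpha> \<in> hom_set R M Y1" "\<alpha> ` carrier M \<subseteq> d ` carrier Y0"
  defines "E \<equiv> pullback_extension M N Y0 \<eta> d \<alpha>"
  shows "short_exact R M N E"
    and "\<And>T i p. short_exact R M N (T, i, p) \<Longrightarrow> ext_equiv R N (T, i, p) E \<longleftrightarrow>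
      (\<exists>g\<in>hom_set R T Y0. (\<forall>x\<in>carrier N. g (i x) = \<eta> x) \<and> (\<forall>x\<in>carrier T. d (g x) = \<alpha> (p x)))"
    and "infinite (UNIV :: 'm set) \<Longrightarrow> \<exists>E' :: ('r, 'm, 'm) ext. short_exact R M N E' \<and> ext_equiv R N E E'"
proof -
  interpret M: module R M by fact
  interpret N: module R N by fact
  interpret Y0: module R Y0 by fact
  interpret Y1: module R Y1 by fact
  define S where "S = direct_sum Y0 M"
  define H where "H = {y \<in> carrier Y0 \<times> carrier M. d (fst y) = \<alpha> (snd y)}"
  define P where "P = S\<lparr>carrier := H\<rparr>"
  define \<iota> where "\<iota> = (\<lambda>x\<in>carrier N. (\<eta> x, \<zero>\<^bsub>M\<^esub>))"
  define \<rho> where "\<rho> = (\<lambda>y\<in>H. snd y)"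
  have E: "E = (P, \<iota>, \<rho>)"
    by (simp add: E_def pullback_extension_def P_def S_def H_def \<iota>_def \<rho>_def Let_def)
  have S_simps: "carrier S = carrier Y0 \<times> carrier M" "(n, b) \<oplus>\<^bsub>S\<^esub> (n', b') = (n \<oplus>\<^bsub>Y0\<^esub> n', b \<oplus>\<^bsub>M\<^esub> b')"
      "r \<odot>\<^bsub>S\<^esub> (n, b) = (r \<odot>\<^bsub>Y0\<^esub> n, r \<odot>\<^bsub>M\<^esub> b)" for r n b n' b'
    by (simp_all add: S_def direct_sum_def)
  have S: "module R S" unfolding S_def using mods(3,1) by (rule module_direct_sum)
  have P_simps: "carrier P = H" "(n, b) \<oplus>\<^bsub>P\<^esub> (n', b') = (n \<oplus>\<^bsub>Y0\<^esub> n', b \<oplus>\<^bsub>M\<^esub> b')"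
      "r \<odot>\<^bsub>P\<^esub> (n, b) = (r \<odot>\<^bsub>Y0\<^esub> n, r \<odot>\<^bsub>M\<^esub> b)" for r n b n' b'
    by (simp_all add: P_def S_simps)
  have H_iff: "(b, m) \<in> H \<longleftrightarrow> b \<in> carrier Y0 \<and> m \<in> carrier M \<and> d b = \<alpha> m" for b m
    by (simp add: H_def)
  note cl = hom_closed[OF d(1)] hom_closed[OF \<alpha>(1)] hom_closed[OF \<eta>(1)]
  have P: "module R P"
  proof -
    \<comment> \<open>The middle term is the kernel of the difference of the two maps to
      \<open>Y1\<close>, hence a submodule of the direct sum.\<close>
    have "(\<lambda>y\<in>carrier S. d (fst y) \<ominus>\<^bsub>Y1\<^esub> \<alpha> (snd y)) \<in> hom_set R S Y1"
    proof (rule hom_diff_in_hom_set[OF S mods(4), THEN back_subst[of "\<lambda>f. f \<in> hom_set R S Y1"]])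
      show "(\<lambda>y\<in>carrier S. d (fst y)) \<in> hom_set R S Y1" "(\<lambda>y\<in>carrier S. \<alpha> (snd y)) \<in> hom_set R S Y1"
        by (rule hom_setI[OF S];
            auto simp: S_simps cl hom_add[OF d(1)] hom_smult[OF d(1)] hom_add[OF \<alpha>(1)] hom_smult[OF \<alpha>(1)])+
    qed (simp cong: restrict_cong)
    then have "submodule {y \<in> carrier S. (\<lambda>y\<in>carrier S. d (fst y) \<ominus>\<^bsub>Y1\<^esub> \<alpha> (snd y)) y = \<zero>\<^bsub>Y1\<^esub>} R S"
      by (rule submodule_kernel[OF S mods(4)])
    also have "{y \<in> carrier S. (\<lambda>y\<in>carrier S. d (fst y) \<ominus>\<^bsub>Y1\<^esub> \<alpha> (snd y)) y = \<zero>\<^bsub>Y1\<^esub>} = H"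
      using cl module_diff_zero_iff[OF mods(4)] by (auto simp: H_def S_simps)
    finally show ?thesis
      unfolding P_def using S by (rule submodule.submodule_is_module)
  qed
  have d\<eta>: "d (\<eta> x) = \<zero>\<^bsub>Y1\<^esub>" if "x \<in> carrier N" for x
    using that d(2) by auto
  note \<alpha>0 = hom_zero[OF mods(1,4) \<alpha>(1)]
  have \<iota>: "\<iota> \<in> hom_set R N P"
    unfolding \<iota>_def by (rule hom_setI[OF mods(2)])
      (simp_all add: P_simps H_iff cl d\<eta> \<alpha>0 hom_add[OF \<eta>(1)] hom_smult[OF \<eta>(1)])
  have \<rho>: "\<rho> \<in> hom_set R P M"
    unfolding \<rho>_def P_simps(1)[symmetric] using P
    by (rule hom_setI) (auto simp: P_simps H_iff)
  show short_exact: "short_exact R M N E"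
    unfolding E short_exact_def prod.case
  proof (intro conjI P \<iota> \<rho>)
    show "inj_on \<iota> (carrier N)"
      using \<eta>(2) by (simp add: inj_on_def \<iota>_def)
    show "{x \<in> carrier P. \<rho> x = \<zero>\<^bsub>M\<^esub>} = \<iota> ` carrier N"
    proof -
      have "\<exists>n\<in>carrier N. b = \<eta> n" if "b \<in> carrier Y0" "d b = \<zero>\<^bsub>Y1\<^esub>" for b
        using d(2) that by blast
      then show ?thesis
        by (fastforce simp: P_simps H_iff \<rho>_def \<iota>_def \<alpha>0 cl d\<eta>)
    qed
    show "\<rho> ` carrier P = carrier M"
    proof (intro equalityI subsetI)
      fix m assume m: "m \<in> carrier M"
      \<comment> \<open>\<open>\<alpha>\<close> has values in the image of \<open>d\<close>; this
        makes the pullback surject onto \<open>M\<close>.\<close>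
      then obtain b where "b \<in> carrier Y0" "d b = \<alpha> m" using \<alpha>(2) by (metis image_subset_iff imageE)
      then have "(b, m) \<in> H" using m by (simp add: H_iff)
      then show "m \<in> \<rho> ` carrier P" by (force simp: \<rho>_def P_simps)
    qed (use hom_closed[OF \<rho>] in auto)
  qed
  show "ext_equiv R N (T, i, p) E \<longleftrightarrow>
      (\<exists>g\<in>hom_set R T Y0. (\<forall>x\<in>carrier N. g (i x) = \<eta> x) \<and> (\<forall>x\<in>carrier T. d (g x) = \<alpha> (p x)))"
    (is "_ \<longleftrightarrow> ?R") if "short_exact R M N (T, i, p)" for T :: "('r, 't) module" and i p
  proof -
    note T = short_exactD[OF that]
    interpret T: module R T by (rule T(1))
    show ?thesis
    proof
      assume "ext_equiv R N (T, i, p) E"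
      then obtain h where h: "h \<in> hom_set R T P" "compose (carrier N) h i = \<iota>"
          "compose (carrier T) \<rho> h = p"
        by (auto simp: ext_equiv_def E)
      have hH: "h x \<in> H" "fst (h x) \<in> carrier Y0" "d (fst (h x)) = \<alpha> (snd (h x))"
        if "x \<in> carrier T" for x
        using hom_closed[OF h(1) that] by (auto simp: P_simps H_def)
      define g where "g = (\<lambda>x\<in>carrier T. fst (h x))"
      have fst_simps: "fst (x \<oplus>\<^bsub>P\<^esub> y) = fst x \<oplus>\<^bsub>Y0\<^esub> fst y" "fst (r \<odot>\<^bsub>P\<^esub> x) = r \<odot>\<^bsub>Y0\<^esub> fst x" for r x y
        by (cases x; cases y; simp add: P_simps)+
      have g: "g \<in> hom_set R T Y0"
        unfolding g_def using hH
        by (intro hom_setI[OF T(1)]) (simp_all add: hom_add[OF h(1)] hom_smult[OF h(1)] fst_simps)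
      have "g (i x) = \<eta> x" if "x \<in> carrier N" for x
        using that compose_eqD[OF h(2) that] hom_closed[OF T(2)] by (simp add: g_def \<iota>_def)
      moreover have "d (g x) = \<alpha> (p x)" if "x \<in> carrier T" for x
        using that hH[OF that] compose_eqD[OF h(3) that] by (simp add: g_def \<rho>_def)
      ultimately show ?R using g by blast
    next
      assume ?R
      then obtain g where g: "g \<in> hom_set R T Y0" "\<And>x. x \<in> carrier N \<Longrightarrow> g (i x) = \<eta> x"
          "\<And>x. x \<in> carrier T \<Longrightarrow> d (g x) = \<alpha> (p x)"
        by blast
      note cl = cl hom_closed[OF T(2)] hom_closed[OF T(3)] hom_closed[OF g(1)]
      have "(\<lambda>x\<in>carrier T. (g x, p x)) \<in> hom_set R T P" (is "?h \<in> _")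
        by (rule hom_setI[OF T(1)])
          (simp_all add: P_simps H_iff cl g(3) hom_add[OF g(1)] hom_add[OF T(3)] hom_smult[OF g(1)] hom_smult[OF T(3)])
      moreover have "compose (carrier N) ?h i = \<iota>"
        using \<iota> by (rule compose_eqI) (simp add: cl g(2) T(6) \<iota>_def)
      moreover have "compose (carrier T) \<rho> ?h = p"
        using T(3) by (rule compose_eqI) (simp add: \<rho>_def H_iff cl g(3))
      ultimately show "ext_equiv R N (T, i, p) E"
        unfolding E ext_equiv_def prod.case by blast
    qed
  qed
  show "\<exists>E' :: ('r, 'm, 'm) ext. short_exact R M N E' \<and> ext_equiv R N E E'"
    if inf: "infinite (UNIV :: 'm set)"
  proof -
    obtain \<phi> :: "'m \<times> 'm \<Rightarrow> 'm" where "inj \<phi>" by (rule infinite_imp_inj_square[OF inf])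
    then have "inj_on \<phi> (carrier P)" by (auto intro: inj_on_subset)
    then show ?thesis
      using short_exact_transport[OF mods(1,2) short_exact[unfolded E]] E by metis
  qed
qed

section \<open>Exactness under Hom functors\<close>

lemma cycles_Hom_from:
  "cycles (Hom_from R A C) n = {f \<in> hom_set R A (Obj C n). \<forall>x\<in>carrier A. Diff C n (f x) = \<zero>\<^bsub>Obj C (n - 1)\<^esub>}"
  by (auto simp: cycles_def Hom_from_def hom_module_def compose_def restrict_def fun_eq_iff)

lemma boundaries_Hom_from:
  "boundaries (Hom_from R A C) n = compose (carrier A) (Diff C (n + 1)) ` hom_set R A (Obj C (n + 1))"
  by (simp add: boundaries_def Hom_from_def hom_module_def)

lemma cycles_Hom_to:
  "cycles (Hom_to R C B) n =
     {f \<in> hom_set R (Obj C (- n)) B. \<forall>x\<in>carrier (Obj C (1 - n)). f (Diff C (1 - n) x) = \<zero>\<^bsub>B\<^esub>}"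
  by (auto simp: cycles_def Hom_to_def hom_module_def compose_def restrict_def fun_eq_iff)

lemma boundaries_Hom_to:
  "boundaries (Hom_to R C B) n =
     (\<lambda>f. compose (carrier (Obj C (- n))) f (Diff C (- n))) ` hom_set R (Obj C (- n - 1)) B"
  by (simp add: boundaries_def Hom_to_def hom_module_def)

lemma Hom_from_exactD:
  assumes "Hom_from_exact R \<X> C" "A \<in> \<X>" "f \<in> hom_set R A (Obj C n)"
    and "\<And>x. x \<in> carrier A \<Longrightarrow> Diff C n (f x) = \<zero>\<^bsub>Obj C (n - 1)\<^esub>"
  obtains h where "h \<in> hom_set R A (Obj C (n + 1))" "\<And>x. x \<in> carrier A \<Longrightarrow> Diff C (n + 1) (h x) = f x"
proof -
  have "f \<in> boundaries (Hom_from R A C) n"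
    using assms unfolding Hom_from_exact_def exact_complex_def by (auto simp: cycles_Hom_from)
  then show ?thesis
    using that by (auto simp: boundaries_Hom_from compose_eq)
qed

lemma Hom_to_exactD:
  assumes "Hom_to_exact R \<Y> C" "B \<in> \<Y>" "f \<in> hom_set R (Obj C n) B"
    and "\<And>x. x \<in> carrier (Obj C (n + 1)) \<Longrightarrow> f (Diff C (n + 1) x) = \<zero>\<^bsub>B\<^esub>"
  obtains h where "h \<in> hom_set R (Obj C (n - 1)) B" "\<And>x. x \<in> carrier (Obj C n) \<Longrightarrow> h (Diff C n x) = f x"
proof -
  have "f \<in> cycles (Hom_to R C B) (- n)"
    using assms by (auto simp: cycles_Hom_to add.commute)
  then have "f \<in> boundaries (Hom_to R C B) (- n)"
    using assms unfolding Hom_to_exact_def exact_complex_def by auto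
  then show ?thesis
    using that by (auto simp: boundaries_Hom_to compose_eq)
qed

lemma is_complexD:
  assumes "is_complex R C"
  shows "module R (Obj C n)" "Diff C n \<in> hom_set R (Obj C n) (Obj C (n - 1))"
    and "x \<in> carrier (Obj C (n + 1)) \<Longrightarrow> Diff C n (Diff C (n + 1) x) = \<zero>\<^bsub>Obj C (n - 1)\<^esub>"
proof -
  show "x \<in> carrier (Obj C (n + 1)) \<Longrightarrow> Diff C n (Diff C (n + 1) x) = \<zero>\<^bsub>Obj C (n - 1)\<^esub>"
    using assms compose_eqD[of "carrier (Obj C (n + 1))" "Diff C n" "Diff C (n + 1)"]
    by (fastforce simp: is_complex_def zero_hom_def)
qed (use assms in \<open>auto simp: is_complex_def\<close>)

text \<open>Boundaries are cycles because \<open>C\<close> is a complex, so exactness reduces to the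
  lifting condition \<open>ex\<close>.\<close>

lemma Hom_from_exactI:
  assumes C: "is_complex R C" and X: "\<And>A. A \<in> \<X> \<Longrightarrow> module R A"
    and ex: "\<And>A n f. A \<in> \<X> \<Longrightarrow> f \<in> hom_set R A (Obj C n) \<Longrightarrow>
      (\<And>x. x \<in> carrier A \<Longrightarrow> Diff C n (f x) = \<zero>\<^bsub>Obj C (n - 1)\<^esub>) \<Longrightarrow>
      \<exists>h\<in>hom_set R A (Obj C (n + 1)). \<forall>x\<in>carrier A. Diff C (n + 1) (h x) = f x"
  shows "Hom_from_exact R \<X> C"
  unfolding Hom_from_exact_def exact_complex_def
proof (intro ballI allI equalityI subsetI)
  fix A n f assume A: "A \<in> \<X>" "f \<in> cycles (Hom_from R A C) n"
  then obtain h where h: "h \<in> hom_set R A (Obj C (n + 1))" "\<forall>x\<in>carrier A. Diff C (n + 1) (h x) = f x"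
      and f: "f \<in> hom_set R A (Obj C n)"
    using ex[OF A(1), of f n] by (auto simp: cycles_Hom_from)
  have "compose (carrier A) (Diff C (n + 1)) h = f"
    using f by (rule compose_eqI) (use h(2) in blast)
  then show "f \<in> boundaries (Hom_from R A C) n"
    using h(1) by (auto simp: boundaries_Hom_from)
next
  fix A n f assume A: "A \<in> \<X>" "f \<in> boundaries (Hom_from R A C) n"
  then obtain h where h: "h \<in> hom_set R A (Obj C (n + 1))" "f = compose (carrier A) (Diff C (n + 1)) h"
    by (auto simp: boundaries_Hom_from)
  have "f \<in> hom_set R A (Obj C n)"
    unfolding h(2) using hom_compose[OF X[OF A(1)] h(1) is_complexD(2)[OF C]] by simp
  then show "f \<in> cycles (Hom_from R A C) n"
    using hom_closed[OF h(1)] is_complexD(3)[OF C] by (auto simp: cycles_Hom_from h(2) compose_eq)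
qed

lemma Hom_to_exactI:
  assumes C: "is_complex R C" and Y: "\<And>B. B \<in> \<Y> \<Longrightarrow> module R B"
    and ex: "\<And>B n f. B \<in> \<Y> \<Longrightarrow> f \<in> hom_set R (Obj C n) B \<Longrightarrow>
      (\<And>x. x \<in> carrier (Obj C (n + 1)) \<Longrightarrow> f (Diff C (n + 1) x) = \<zero>\<^bsub>B\<^esub>) \<Longrightarrow>
      \<exists>h\<in>hom_set R (Obj C (n - 1)) B. \<forall>x\<in>carrier (Obj C n). h (Diff C n x) = f x"
  shows "Hom_to_exact R \<Y> C"
  unfolding Hom_to_exact_def exact_complex_def
proof (intro ballI allI equalityI subsetI)
  fix B n f assume B: "B \<in> \<Y>" "f \<in> cycles (Hom_to R C B) n"
  then have f: "f \<in> hom_set R (Obj C (- n)) B" by (simp add: cycles_Hom_to)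
  obtain h where h: "h \<in> hom_set R (Obj C (- n - 1)) B" "\<forall>x\<in>carrier (Obj C (- n)). h (Diff C (- n) x) = f x"
    using ex[OF B(1) f] B(2) by (auto simp: cycles_Hom_to)
  have "compose (carrier (Obj C (- n))) h (Diff C (- n)) = f"
    using f by (rule compose_eqI) (use h(2) in blast)
  then show "f \<in> boundaries (Hom_to R C B) n"
    using h(1) by (auto simp: boundaries_Hom_to)
next
  fix B n f assume B: "B \<in> \<Y>" "f \<in> boundaries (Hom_to R C B) n"
  then obtain h where h: "h \<in> hom_set R (Obj C (- n - 1)) B"
      "f = compose (carrier (Obj C (- n))) h (Diff C (- n))"
    by (auto simp: boundaries_Hom_to)
  have "f \<in> hom_set R (Obj C (- n)) B"
    unfolding h(2) by (rule hom_compose[OF is_complexD(1,2)[OF C] h(1)])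
  moreover have "f (Diff C (1 - n) x) = \<zero>\<^bsub>B\<^esub>" if "x \<in> carrier (Obj C (1 - n))" for x
    using that is_complexD(3)[OF C, of x "- n"] hom_closed[OF is_complexD(2)[OF C, of "1 - n"] that]
      hom_zero[OF is_complexD(1)[OF C] Y[OF B(1)] h(1)]
    by (simp add: h(2) compose_eq)
  ultimately show "f \<in> cycles (Hom_to R C B) n"
    by (auto simp: cycles_Hom_to)
qed

section \<open>Hom-exactness of short exact sequences\<close>

lemma module_zero_module: "cring R \<Longrightarrow> module R zero_module"
  by (intro moduleI abelian_groupI) (auto simp: zero_module_def)

lemma ext_complex_sel:
  "Obj (ext_complex M N (T, i, p)) n =
     (if n = 1 then N else if n = 0 then T else if n = - 1 then M else zero_module)"
  "Diff (ext_complex M N (T, i, p)) n =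
     (if n = 1 then i else if n = 0 then p
      else zero_hom (Obj (ext_complex M N (T, i, p)) n) (Obj (ext_complex M N (T, i, p)) (n - 1)))"
  by (auto simp: ext_complex_def Let_def)

lemma is_complex_ext_complex:
  assumes "module R M" "module R N" "short_exact R M N (T, i, p)"
  shows "is_complex R (ext_complex M N (T, i, p))" (is "is_complex R ?C")
proof -
  note T = short_exactD[OF assms(3)]
  interpret M: module R M by fact
  have Obj: "module R (Obj ?C n)" for n
    using assms T by (simp add: ext_complex_sel(1) module_zero_module M.is_cring)
  have Diff: "Diff ?C n \<in> hom_set R (Obj ?C n) (Obj ?C (n - 1))" for n
  proof (cases "n = 0 \<or> n = 1")
    case True
    then show ?thesis using T by (auto simp: ext_complex_sel)
  next
    case False
    then have "Diff ?C n = zero_hom (Obj ?C n) (Obj ?C (n - 1))" by (simp add: ext_complex_sel(2))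
    then show ?thesis using zero_hom_in_hom_set[OF Obj Obj] by simp
  qed
  have "Diff ?C n (Diff ?C (n + 1) x) = \<zero>\<^bsub>Obj ?C (n - 1)\<^esub>" if "x \<in> carrier (Obj ?C (n + 1))" for n x
  proof (cases "n = 0")
    case True
    then show ?thesis using that T(6) by (simp add: ext_complex_sel)
  next
    case False
    \<comment> \<open>Off degrees 0 and 1 the differential is zero by definition. For
      \<open>n = 1\<close> this concerns the inner map, for the other \<open>n\<close> the outer
      one; only \<open>n = 0\<close> rests on \<open>p i = 0\<close>.\<close>
    have *: "Diff ?C m y = \<zero>\<^bsub>Obj ?C (m - 1)\<^esub>" if "y \<in> carrier (Obj ?C m)" "m \<noteq> 0" "m \<noteq> 1" for m y
      using that by (simp add: ext_complex_sel(2) zero_hom_def)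
    show ?thesis
    proof (cases "n = 1")
      case True
      then show ?thesis
        using *[OF that] hom_zero[OF Obj Obj Diff, of n] by simp
    next
      case False
      then show ?thesis
        using \<open>n \<noteq> 0\<close> hom_closed[OF Diff that] by (intro *) simp_all
    qed
  qed
  then have "compose (carrier (Obj ?C (n + 1))) (Diff ?C n) (Diff ?C (n + 1)) =
      zero_hom (Obj ?C (n + 1)) (Obj ?C (n - 1))" for n
    by (simp add: compose_def zero_hom_def cong: restrict_cong)
  then show ?thesis using Obj Diff by (simp add: is_complex_def)
qed

text \<open>Hom out of \<open>A\<close> is left exact, so the Hom complex of a short exact sequence
  can fail to be exact only at Hom(A, M), where exactness says that maps to \<open>M\<close> lift to
  \<open>T\<close>.\<close>

lemma Hom_from_exact_ext_complex_iff:
  assumes "module R M" "module R N" "short_exact R M N (T, i, p)" "\<forall>A\<in>\<X>. module R A"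
  shows "Hom_from_exact R \<X> (ext_complex M N (T, i, p)) \<longleftrightarrow>
    (\<forall>A\<in>\<X>. \<forall>f\<in>hom_set R A M. \<exists>h\<in>hom_set R A T. \<forall>x\<in>carrier A. p (h x) = f x)"
    (is "Hom_from_exact R \<X> ?C \<longleftrightarrow> ?R")
proof
  assume L: "Hom_from_exact R \<X> ?C"
  show ?R
  proof (intro ballI)
    fix A f assume A: "A \<in> \<X>" "f \<in> hom_set R A M"
    obtain h where "h \<in> hom_set R A (Obj ?C (- 1 + 1))" "\<And>x. x \<in> carrier A \<Longrightarrow> Diff ?C (- 1 + 1) (h x) = f x"
      by (rule Hom_from_exactD[OF L A(1), of f "- 1"])
        (use A hom_closed[OF A(2)] in \<open>auto simp: ext_complex_sel zero_hom_def\<close>)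
    then show "\<exists>h\<in>hom_set R A T. \<forall>x\<in>carrier A. p (h x) = f x"
      by (auto simp: ext_complex_sel)
  qed
next
  assume R: ?R
  note T = short_exactD[OF assms(3)]
  note C = is_complex_ext_complex[OF assms(1-3)]
  show "Hom_from_exact R \<X> ?C"
  proof (rule Hom_from_exactI[OF C assms(4)[rule_format]])
    fix A n f assume A: "A \<in> \<X>" and f: "f \<in> hom_set R A (Obj ?C n)"
      and df: "\<And>x. x \<in> carrier A \<Longrightarrow> Diff ?C n (f x) = \<zero>\<^bsub>Obj ?C (n - 1)\<^esub>"
    note A' = assms(4)[rule_format, OF A]
    consider "n = 0" | "n = - 1" | "n \<noteq> 0" "n \<noteq> - 1" by blast
    then show "\<exists>h\<in>hom_set R A (Obj ?C (n + 1)). \<forall>x\<in>carrier A. Diff ?C (n + 1) (h x) = f x"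
    proof cases
      case 1
      have f': "f \<in> hom_set R A T" using f 1 by (simp add: ext_complex_sel)
      have "f ` carrier A \<subseteq> i ` carrier N"
        using df T(7) hom_closed[OF f'] 1 by (auto simp: ext_complex_sel)
      then obtain h where "h \<in> hom_set R A N" "\<And>x. x \<in> carrier A \<Longrightarrow> i (h x) = f x"
        using factor_through_mono[OF A' assms(2) T(1,2,4) f'] by blast
      then show ?thesis using 1 by (auto simp: ext_complex_sel)
    next
      case 2
      then show ?thesis using f R A by (auto simp: ext_complex_sel)
    next
      case 3
      \<comment> \<open>In these degrees only the zero map is a cycle: \<open>i\<close> is injective
        for \<open>n = 1\<close>, and the module is zero otherwise. It is the image of the zero
        map.\<close>
      have "f x = \<zero>\<^bsub>Obj ?C n\<^esub>" if "x \<in> carrier A" for x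
      proof (cases "n = 1")
        case True
        then have "f x \<in> carrier N" "i (f x) = \<zero>\<^bsub>T\<^esub>"
          using hom_closed[OF f that] df[OF that] by (simp_all add: ext_complex_sel)
        then show ?thesis
          using True hom_inj_on_iff[OF assms(2) T(1,2)] T(4) by (simp add: ext_complex_sel)
      next
        case False
        then show ?thesis
          using 3 hom_closed[OF f that] by (simp add: ext_complex_sel zero_module_def)
      qed
      moreover have "zero_hom A (Obj ?C (n + 1)) \<in> hom_set R A (Obj ?C (n + 1))"
        by (rule zero_hom_in_hom_set[OF A' is_complexD(1)[OF C]])
      moreover have "Diff ?C (n + 1) \<zero>\<^bsub>Obj ?C (n + 1)\<^esub> = \<zero>\<^bsub>Obj ?C n\<^esub>"
        using hom_zero[OF is_complexD(1)[OF C] is_complexD(1)[OF C] is_complexD(2)[OF C], of "n + 1"] by simp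
      ultimately show ?thesis
        by (intro bexI[of _ "zero_hom A (Obj ?C (n + 1))"]) (simp_all add: zero_hom_def)
    qed
  qed
qed

text \<open>Hom into \<open>B\<close> turns cokernels into kernels, so exactness can fail only at
  Hom(N, B), where it asks that maps from \<open>N\<close> extend to \<open>T\<close>.\<close>

lemma Hom_to_exact_ext_complex_iff:
  assumes "module R M" "module R N" "short_exact R M N (T, i, p)" "\<forall>B\<in>\<Y>. module R B"
  shows "Hom_to_exact R \<Y> (ext_complex M N (T, i, p)) \<longleftrightarrow>
    (\<forall>B\<in>\<Y>. \<forall>f\<in>hom_set R N B. \<exists>h\<in>hom_set R T B. \<forall>x\<in>carrier N. h (i x) = f x)"
    (is "Hom_to_exact R \<Y> ?C \<longleftrightarrow> ?R")
proof
  assume L: "Hom_to_exact R \<Y> ?C"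
  show ?R
  proof (intro ballI)
    fix B f assume B: "B \<in> \<Y>" "f \<in> hom_set R N B"
    obtain h where "h \<in> hom_set R (Obj ?C (1 - 1)) B" "\<And>x. x \<in> carrier (Obj ?C 1) \<Longrightarrow> h (Diff ?C 1 x) = f x"
      by (rule Hom_to_exactD[OF L B(1), of f "1"])
        (use B hom_zero[OF assms(2) assms(4)[rule_format, OF B(1)] B(2)] in \<open>auto simp: ext_complex_sel zero_hom_def\<close>)
    then show "\<exists>h\<in>hom_set R T B. \<forall>x\<in>carrier N. h (i x) = f x"
      by (auto simp: ext_complex_sel)
  qed
next
  assume R: ?R
  note T = short_exactD[OF assms(3)]
  note C = is_complex_ext_complex[OF assms(1-3)]
  show "Hom_to_exact R \<Y> ?C"
  proof (rule Hom_to_exactI[OF C assms(4)[rule_format]])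
    fix B n f assume B: "B \<in> \<Y>" and f: "f \<in> hom_set R (Obj ?C n) B"
      and fd: "\<And>x. x \<in> carrier (Obj ?C (n + 1)) \<Longrightarrow> f (Diff ?C (n + 1) x) = \<zero>\<^bsub>B\<^esub>"
    note B' = assms(4)[rule_format, OF B]
    consider "n = 0" | "n = 1" | "n \<noteq> 0" "n \<noteq> 1" by blast
    then show "\<exists>h\<in>hom_set R (Obj ?C (n - 1)) B. \<forall>x\<in>carrier (Obj ?C n). h (Diff ?C n x) = f x"
    proof cases
      case 1
      have f': "f \<in> hom_set R T B" using f 1 by (simp add: ext_complex_sel)
      have "f x = \<zero>\<^bsub>B\<^esub>" if "x \<in> carrier T" "p x = \<zero>\<^bsub>M\<^esub>" for x
        using T(7)[OF that] fd 1 by (auto simp: ext_complex_sel)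
      then obtain h where "h \<in> hom_set R M B" "\<And>x. x \<in> carrier T \<Longrightarrow> h (p x) = f x"
        using factor_through_epi[OF T(1) assms(1) B' T(3,5) f'] by blast
      then show ?thesis using 1 by (auto simp: ext_complex_sel)
    next
      case 2
      then show ?thesis using f R B by (auto simp: ext_complex_sel)
    next
      case 3
      \<comment> \<open>A map on \<open>M\<close> that vanishes after \<open>p\<close> is zero
        because \<open>p\<close> is onto; in the remaining degrees the source is zero.\<close>
      have "f x = \<zero>\<^bsub>B\<^esub>" if x: "x \<in> carrier (Obj ?C n)" for x
      proof (cases "n = - 1")
        case True
        then have "x \<in> p ` carrier T" using x T(5) by (simp add: ext_complex_sel)
        then show ?thesis using True fd by (auto simp: ext_complex_sel)
      next
        case False
        then have "x = \<zero>\<^bsub>Obj ?C n\<^esub>"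
          using 3 x by (simp add: ext_complex_sel zero_module_def)
        then show ?thesis
          using hom_zero[OF is_complexD(1)[OF C] B' f] by simp
      qed
      moreover have "zero_hom (Obj ?C (n - 1)) B \<in> hom_set R (Obj ?C (n - 1)) B"
        by (rule zero_hom_in_hom_set[OF is_complexD(1)[OF C] B'])
      ultimately show ?thesis
        using hom_closed[OF is_complexD(2)[OF C]]
        by (intro bexI[of _ "zero_hom (Obj ?C (n - 1)) B"]) (simp_all add: zero_hom_def)
    qed
  qed
qed

section \<open>Homology of Hom complexes\<close>

lemma carrier_hom_module: "carrier (hom_module R A B) = hom_set R A B"
  by (simp add: hom_module_def)

text \<open>Commutativity of \<open>R\<close> enters here: a scalar multiple of a linear map is
  linear because scalars commute.\<close>

lemma module_hom_module:
  assumes "module R A" "module R B"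
  shows "module R (hom_module R A B)"
proof -
  interpret A: module R A by fact
  interpret B: module R B by fact
  note [simp] = hom_module_def
  have smult: "(\<lambda>x\<in>carrier A. r \<odot>\<^bsub>B\<^esub> f x) \<in> hom_set R A B" if "r \<in> carrier R" "f \<in> hom_set R A B" for r f
    using that hom_closed[OF that(2)]
    by (intro hom_setI[OF assms(1)])
      (auto simp: hom_add[OF that(2)] hom_smult[OF that(2)] B.smult_r_distr B.smult_assoc1[symmetric] A.R.m_comm)
  have "abelian_group (hom_module R A B)"
  proof (rule abelian_groupI)
    fix f assume "f \<in> carrier (hom_module R A B)"
    then have f: "f \<in> hom_set R A B" by simp
    have "(\<lambda>x\<in>carrier A. \<ominus>\<^bsub>B\<^esub> f x) \<oplus>\<^bsub>hom_module R A B\<^esub> f = \<zero>\<^bsub>hom_module R A B\<^esub>"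
      using hom_closed[OF f] by (simp add: B.l_neg cong: restrict_cong)
    with hom_uminus_in_hom_set[OF assms f] show "\<exists>g\<in>carrier (hom_module R A B). g \<oplus>\<^bsub>hom_module R A B\<^esub> f = \<zero>\<^bsub>hom_module R A B\<^esub>"
      unfolding carrier_hom_module by blast
    show "\<zero>\<^bsub>hom_module R A B\<^esub> \<oplus>\<^bsub>hom_module R A B\<^esub> f = f"
      using hom_closed[OF f] restrict_hom[OF f] by (simp cong: restrict_cong)
  qed (use hom_add_in_hom_set[OF assms] zero_hom_in_hom_set[OF assms] in
    \<open>auto simp: zero_hom_def hom_closed B.a_ac cong: restrict_cong\<close>)
  then show ?thesis
    by (rule moduleI[OF A.is_cring])
      (use smult in \<open>auto simp: restrict_hom hom_closed B.smult_l_distr B.smult_r_distr B.smult_assoc1 cong: restrict_cong\<close>)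
qed

lemma is_complexI:
  assumes "\<And>n. module R (Obj C n)" "\<And>n. Diff C n \<in> hom_set R (Obj C n) (Obj C (n - 1))"
    and "\<And>n x. x \<in> carrier (Obj C (n + 1)) \<Longrightarrow> Diff C n (Diff C (n + 1) x) = \<zero>\<^bsub>Obj C (n - 1)\<^esub>"
  shows "is_complex R C"
  using assms by (simp add: is_complex_def compose_def zero_hom_def cong: restrict_cong)

lemma is_complex_Hom_to:
  assumes C: "is_complex R C" and B: "module R B"
  shows "is_complex R (Hom_to R C B)"
proof (rule is_complexI)
  note D = is_complexD[OF C]
  have sel: "Obj (Hom_to R C B) n = hom_module R (Obj C (- n)) B"
      "Diff (Hom_to R C B) n = (\<lambda>f\<in>carrier (Obj (Hom_to R C B) n). compose (carrier (Obj C (1 - n))) f (Diff C (1 - n)))" for n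
    by (simp_all add: Hom_to_def carrier_hom_module)
  show mod: "module R (Obj (Hom_to R C B) n)" for n
    unfolding sel by (rule module_hom_module[OF D(1) B])
  have cl: "compose (carrier (Obj C (1 - n))) f (Diff C (1 - n)) \<in> hom_set R (Obj C (1 - n)) B"
    if "f \<in> hom_set R (Obj C (- n)) B" for n f
    using hom_compose[OF D(1,2)[of "1 - n"]] that by simp
  have dcl: "Diff C (1 - n) x \<in> carrier (Obj C (- n))" if "x \<in> carrier (Obj C (1 - n))" for n x
    using hom_closed[OF D(2) that] by simp
  show "Diff (Hom_to R C B) n \<in> hom_set R (Obj (Hom_to R C B) n) (Obj (Hom_to R C B) (n - 1))" for n
    unfolding sel(2) using mod
    by (rule hom_setI) (use cl dcl in \<open>auto simp: sel(1) hom_module_def compose_def cong: restrict_cong\<close>)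
  show "Diff (Hom_to R C B) n (Diff (Hom_to R C B) (n + 1) f) = \<zero>\<^bsub>Obj (Hom_to R C B) (n - 1)\<^esub>"
    if "f \<in> carrier (Obj (Hom_to R C B) (n + 1))" for n f
  proof -
    have f: "f \<in> hom_set R (Obj C (- (n + 1))) B" using that by (simp add: sel(1) carrier_hom_module)
    have "f (Diff C (- n) (Diff C (1 - n) x)) = \<zero>\<^bsub>B\<^esub>" if "x \<in> carrier (Obj C (1 - n))" for x
      using that D(3)[of x "- n"] hom_zero[OF D(1) B f] by simp
    then show ?thesis
      using f cl[OF f] dcl by (simp add: sel hom_module_def compose_def cong: restrict_cong)
  qed
qed

lemma is_complex_Hom_from:
  assumes C: "is_complex R C" and A: "module R A"
  shows "is_complex R (Hom_from R A C)"
proof (rule is_complexI)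
  note D = is_complexD[OF C]
  have sel: "Obj (Hom_from R A C) n = hom_module R A (Obj C n)"
      "Diff (Hom_from R A C) n = (\<lambda>f\<in>carrier (Obj (Hom_from R A C) n). compose (carrier A) (Diff C n) f)" for n
    by (simp_all add: Hom_from_def carrier_hom_module)
  show mod: "module R (Obj (Hom_from R A C) n)" for n
    unfolding sel by (rule module_hom_module[OF A D(1)])
  have cl: "compose (carrier A) (Diff C n) f \<in> hom_set R A (Obj C (n - 1))"
    if "f \<in> hom_set R A (Obj C n)" for n f
    using hom_compose[OF A that D(2)] .
  show "Diff (Hom_from R A C) n \<in> hom_set R (Obj (Hom_from R A C) n) (Obj (Hom_from R A C) (n - 1))" for n
    unfolding sel(2) using mod
    by (rule hom_setI)
      (use cl in \<open>auto simp: sel(1) hom_module_def compose_def hom_closed hom_add[OF D(2)] hom_smult[OF D(2)] cong: restrict_cong\<close>)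
  show "Diff (Hom_from R A C) n (Diff (Hom_from R A C) (n + 1) f) = \<zero>\<^bsub>Obj (Hom_from R A C) (n - 1)\<^esub>"
    if "f \<in> carrier (Obj (Hom_from R A C) (n + 1))" for n f
  proof -
    have f: "f \<in> hom_set R A (Obj C (n + 1))" using that by (simp add: sel(1) carrier_hom_module)
    have "Diff C n (Diff C (n + 1) (f x)) = \<zero>\<^bsub>Obj C (n - 1)\<^esub>" if "x \<in> carrier A" for x
      using D(3) hom_closed[OF f that] .
    then show ?thesis
      using f cl[OF f] by (simp add: sel hom_module_def compose_def cong: restrict_cong)
  qed
qed

text \<open>\<open>homology\<close> forms cosets in the module of cycles, this one in all of
  \<open>Obj C n\<close>. The sets agree, since a coset involves only the addition.\<close>

definition homology_class :: "('r, 'm) cplx \<Rightarrow> int \<Rightarrow> 'm \<Rightarrow> 'm set" where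
  "homology_class C n z = boundaries C n +>\<^bsub>Obj C n\<^esub> z"

lemma mem_homology_class_iff:
  "w \<in> homology_class C n z \<longleftrightarrow> (\<exists>b\<in>boundaries C n. w = b \<oplus>\<^bsub>Obj C n\<^esub> z)"
  by (auto simp: homology_class_def a_r_coset_def')

lemma carrier_homology: "carrier (homology C n) = homology_class C n ` cycles C n"
  by (auto simp: homology_def quot_module_def A_RCOSETS_def' a_r_coset_def' homology_class_def)

text \<open>The last claim is what lets a fact about cocycles be applied to each representative in
  the unions that define \<open>xi\<close> and \<open>xi'\<close>.\<close>

lemma homology_class:
  assumes "is_complex R C" "z \<in> cycles C n"
  shows homology_class_self: "z \<in> homology_class C n z"
    and homology_class_eq: "w \<in> homology_class C n z \<Longrightarrow> homology_class C n w = homology_class C n z"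
    and homology_class_cycles: "homology_class C n z \<subseteq> cycles C n"
proof -
  note D = is_complexD[OF assms(1)]
  interpret C: module R "Obj C n" by (rule D(1))
  have z: "z \<in> carrier (Obj C n)" using assms(2) by (simp add: cycles_def)
  have "Diff C (n + 1) \<in> hom_set R (Obj C (n + 1)) (Obj C n)"
    using D(2)[of "n + 1"] by simp
  then have B: "submodule (boundaries C n) R (Obj C n)"
    unfolding boundaries_def by (rule submodule_image[OF D(1,1)])
  interpret B: abelian_subgroup "boundaries C n" "Obj C n"
    by (rule abelian_subgroup_submodule[OF D(1) B])
  have sub: "boundaries C n \<subseteq> cycles C n"
    using D(3) B.a_subset by (auto simp: boundaries_def cycles_def)
  show "z \<in> homology_class C n z"
    unfolding homology_class_def by (rule B.a_rcos_self[OF z])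
  show "homology_class C n w = homology_class C n z" if "w \<in> homology_class C n z"
    using B.a_repr_independence'[OF _ z] that by (simp add: homology_class_def)
  have Z: "submodule (cycles C n) R (Obj C n)"
    unfolding cycles_def by (rule submodule_kernel[OF D(1) D(1) D(2)])
  show "homology_class C n z \<subseteq> cycles C n"
    using sub assms(2) by (auto simp: mem_homology_class_iff intro!: C.submoduleE(5)[OF Z])
qed

text \<open>The union in the definition of \<open>homology_map\<close> runs over all representatives of the class; they
  all contribute the same set.\<close>

lemma homology_map:
  assumes C: "is_complex R C" and D: "is_complex R D" and z: "z \<in> cycles C n"
    and cycles: "\<And>w. w \<in> cycles C n \<Longrightarrow> \<phi> w \<in> cycles D n"
    and boundaries: "\<And>b. b \<in> boundaries C n \<Longrightarrow> \<phi> b \<in> boundaries D n"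
    and add: "\<And>w b. w \<in> cycles C n \<Longrightarrow> b \<in> boundaries C n \<Longrightarrow> \<phi> (b \<oplus>\<^bsub>Obj C n\<^esub> w) = \<phi> b \<oplus>\<^bsub>Obj D n\<^esub> \<phi> w"
  shows "homology_map C D \<phi> n (homology_class C n z) = homology_class D n (\<phi> z)"
proof -
  have "homology_class D n (\<phi> w) = homology_class D n (\<phi> z)" if "w \<in> homology_class C n z" for w
  proof (rule homology_class_eq[OF D cycles[OF z]])
    show "\<phi> w \<in> homology_class D n (\<phi> z)"
      using that add[OF z] boundaries by (auto simp: mem_homology_class_iff)
  qed
  then have "(\<Union>w\<in>homology_class C n z. homology_class D n (\<phi> w)) = homology_class D n (\<phi> z)"
    using homology_class_self[OF C z] by blast
  then show ?thesis
    using z by (simp add: homology_map_def carrier_homology homology_class_def)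
qed

section \<open>Resolutions and lifts of the identity\<close>

text \<open>For the augmented sequences, \<open>resolution\<close> and \<open>coresolution\<close>
  state exactness only; that consecutive maps there compose to zero is recovered from it.\<close>

lemma exact_imp_is_complex:
  assumes "\<And>n. module R (Obj C n)" "\<And>n. Diff C n \<in> hom_set R (Obj C n) (Obj C (n - 1))" "exact_complex C"
  shows "is_complex R C"
proof (rule is_complexI[OF assms(1,2)])
  fix n x assume "x \<in> carrier (Obj C (n + 1))"
  then have "Diff C (n + 1) x \<in> cycles C n"
    using assms(3) by (simp add: exact_complex_def boundaries_def)
  then show "Diff C n (Diff C (n + 1) x) = \<zero>\<^bsub>Obj C (n - 1)\<^esub>" by (simp add: cycles_def)
qed

lemma augment_sel:
  "Obj (augment X \<epsilon> M) n = (if n = - 1 then M else Obj X n)"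
  "Diff (augment X \<epsilon> M) n = (if n = 0 then \<epsilon> else if n = - 1 then zero_hom M (Obj X (- 2)) else Diff X n)"
  by (auto simp: augment_def)

lemma coaugment_sel:
  "Obj (coaugment Y \<eta> N) n = (if n = 1 then N else Obj Y n)"
  "Diff (coaugment Y \<eta> N) n = (if n = 1 then \<eta> else if n = 2 then zero_hom (Obj Y 2) N else Diff Y n)"
  by (auto simp: coaugment_def)

lemma resolutionD:
  assumes "resolution R \<X> M X \<epsilon>" "module R M"
  shows "is_complex R X" "is_complex R (augment X \<epsilon> M)" "exact_complex (augment X \<epsilon> M)"
    and "\<epsilon> \<in> hom_set R (Obj X 0) M" "\<epsilon> ` carrier (Obj X 0) = carrier M"
    and "{x \<in> carrier (Obj X 0). \<epsilon> x = \<zero>\<^bsub>M\<^esub>} = Diff X 1 ` carrier (Obj X 1)"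
    and "{x \<in> carrier (Obj X 1). Diff X 1 x = \<zero>\<^bsub>Obj X 0\<^esub>} = Diff X 2 ` carrier (Obj X 2)"
    and "Diff X 1 \<in> hom_set R (Obj X 1) (Obj X 0)" "Diff X 2 \<in> hom_set R (Obj X 2) (Obj X 1)"
    and "n \<ge> 0 \<Longrightarrow> Obj X n \<in> \<X>" "n < 0 \<Longrightarrow> carrier (Obj X n) = {\<zero>\<^bsub>Obj X n\<^esub>}"
proof -
  show X: "is_complex R X" and ex: "exact_complex (augment X \<epsilon> M)" and \<epsilon>: "\<epsilon> \<in> hom_set R (Obj X 0) M"
    using assms by (auto simp: resolution_def)
  note D = is_complexD[OF X]
  have "Diff (augment X \<epsilon> M) n \<in> hom_set R (Obj (augment X \<epsilon> M) n) (Obj (augment X \<epsilon> M) (n - 1))" for n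
    using \<epsilon> D(2)[of n] zero_hom_in_hom_set[OF assms(2) D(1)] by (simp add: augment_sel)
  then show "is_complex R (augment X \<epsilon> M)"
    using D(1) assms(2) ex by (intro exact_imp_is_complex) (simp_all add: augment_sel)
  have c: "cycles (augment X \<epsilon> M) n = boundaries (augment X \<epsilon> M) n" for n
    using ex by (simp add: exact_complex_def)
  show "\<epsilon> ` carrier (Obj X 0) = carrier M"
    using c[of "- 1"] by (simp add: cycles_def boundaries_def augment_sel zero_hom_def cong: conj_cong)
  show "{x \<in> carrier (Obj X 0). \<epsilon> x = \<zero>\<^bsub>M\<^esub>} = Diff X 1 ` carrier (Obj X 1)"
    using c[of 0] by (simp add: cycles_def boundaries_def augment_sel)
  show "{x \<in> carrier (Obj X 1). Diff X 1 x = \<zero>\<^bsub>Obj X 0\<^esub>} = Diff X 2 ` carrier (Obj X 2)"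
    using c[of 1] by (simp add: cycles_def boundaries_def augment_sel)
  show "Diff X 1 \<in> hom_set R (Obj X 1) (Obj X 0)" "Diff X 2 \<in> hom_set R (Obj X 2) (Obj X 1)"
    using D(2)[of 1] D(2)[of 2] by simp_all
  show "n \<ge> 0 \<Longrightarrow> Obj X n \<in> \<X>" "n < 0 \<Longrightarrow> carrier (Obj X n) = {\<zero>\<^bsub>Obj X n\<^esub>}"
    using assms by (auto simp: resolution_def)
qed

lemma coresolutionD:
  assumes "coresolution R \<Y> N Y \<eta>" "module R N"
  shows "is_complex R Y" "is_complex R (coaugment Y \<eta> N)" "exact_complex (coaugment Y \<eta> N)"
    and "\<eta> \<in> hom_set R N (Obj Y 0)" "inj_on \<eta> (carrier N)"
    and "{x \<in> carrier (Obj Y 0). Diff Y 0 x = \<zero>\<^bsub>Obj Y (- 1)\<^esub>} = \<eta> ` carrier N"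
    and "{x \<in> carrier (Obj Y (- 1)). Diff Y (- 1) x = \<zero>\<^bsub>Obj Y (- 2)\<^esub>} = Diff Y 0 ` carrier (Obj Y 0)"
    and "Diff Y 0 \<in> hom_set R (Obj Y 0) (Obj Y (- 1))" "Diff Y (- 1) \<in> hom_set R (Obj Y (- 1)) (Obj Y (- 2))"
    and "n \<le> 0 \<Longrightarrow> Obj Y n \<in> \<Y>" "n > 0 \<Longrightarrow> carrier (Obj Y n) = {\<zero>\<^bsub>Obj Y n\<^esub>}"
proof -
  show Y: "is_complex R Y" and ex: "exact_complex (coaugment Y \<eta> N)" and \<eta>: "\<eta> \<in> hom_set R N (Obj Y 0)"
    using assms by (auto simp: coresolution_def)
  note D = is_complexD[OF Y]
  interpret N: module R N by fact
  have "Diff (coaugment Y \<eta> N) n \<in> hom_set R (Obj (coaugment Y \<eta> N) n) (Obj (coaugment Y \<eta> N) (n - 1))" for n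
    using \<eta> D(2)[of n] zero_hom_in_hom_set[OF D(1) assms(2)] by (simp add: coaugment_sel)
  then show "is_complex R (coaugment Y \<eta> N)"
    using D(1) assms(2) ex by (intro exact_imp_is_complex) (simp_all add: coaugment_sel)
  have c: "cycles (coaugment Y \<eta> N) n = boundaries (coaugment Y \<eta> N) n" for n
    using ex by (simp add: exact_complex_def)
  show "n \<le> 0 \<Longrightarrow> Obj Y n \<in> \<Y>" and pos: "n > 0 \<Longrightarrow> carrier (Obj Y n) = {\<zero>\<^bsub>Obj Y n\<^esub>}" for n
    using assms by (auto simp: coresolution_def)
  \<comment> \<open>The boundaries in degree 1 come from the zero map on the one-element module in
    degree 2, so exactness there is injectivity of \<open>\<eta>\<close>.\<close>
  have "{x \<in> carrier N. \<eta> x = \<zero>\<^bsub>Obj Y 0\<^esub>} = {\<zero>\<^bsub>N\<^esub>}"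
    using c[of 1] pos[of 2] by (simp add: cycles_def boundaries_def coaugment_sel zero_hom_def)
  then show "inj_on \<eta> (carrier N)"
    unfolding hom_inj_on_iff[OF assms(2) D(1) \<eta>] by blast
  show "{x \<in> carrier (Obj Y 0). Diff Y 0 x = \<zero>\<^bsub>Obj Y (- 1)\<^esub>} = \<eta> ` carrier N"
    using c[of 0] by (simp add: cycles_def boundaries_def coaugment_sel)
  show "{x \<in> carrier (Obj Y (- 1)). Diff Y (- 1) x = \<zero>\<^bsub>Obj Y (- 2)\<^esub>} = Diff Y 0 ` carrier (Obj Y 0)"
    using c[of "- 1"] by (simp add: cycles_def boundaries_def coaugment_sel)
  show "Diff Y 0 \<in> hom_set R (Obj Y 0) (Obj Y (- 1))" "Diff Y (- 1) \<in> hom_set R (Obj Y (- 1)) (Obj Y (- 2))"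
    using D(2)[of 0] D(2)[of "- 1"] by simp_all
qed

section \<open>Exact complexes seen by projectives and injectives\<close>

lemma hom_set_image_submodule:
  "f \<in> hom_set R A B \<Longrightarrow> f ` carrier A \<subseteq> H \<Longrightarrow> f \<in> hom_set R A (B\<lparr>carrier := H\<rparr>)"
  by (auto simp: hom_set_def PiE_def)

text \<open>Through this, a projective resolution lifts into any resolution of \<open>M\<close>, and
  \<open>\<kappa>\<close> becomes an instance of the same comparison as
  \<open>\<theta>\<close>.\<close>

lemma Hom_from_exact_projective:
  assumes C: "is_complex R C" and ex: "exact_complex C" and \<P>: "\<And>A. A \<in> \<P> \<Longrightarrow> projective R A"
  shows "Hom_from_exact R \<P> C"
proof (rule Hom_from_exactI[OF C])
  note D = is_complexD[OF C]
  show "module R A" if "A \<in> \<P>" for A using \<P>[OF that] by (simp add: projective_def)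
  fix A n f assume A: "A \<in> \<P>" and f: "f \<in> hom_set R A (Obj C n)"
    and df: "\<And>x. x \<in> carrier A \<Longrightarrow> Diff C n (f x) = \<zero>\<^bsub>Obj C (n - 1)\<^esub>"
  have d: "Diff C (n + 1) \<in> hom_set R (Obj C (n + 1)) (Obj C n)" using D(2)[of "n + 1"] by simp
  \<comment> \<open>Projectivity lifts along surjections only, so both \<open>f\<close> and the
    differential are regarded as maps to the boundaries, onto which the differential is surjective.
    \<open>f\<close> lands there because cycles are boundaries.\<close>
  let ?B = "(Obj C n)\<lparr>carrier := boundaries C n\<rparr>"
  have "submodule (boundaries C n) R (Obj C n)"
    unfolding boundaries_def by (rule submodule_image[OF D(1,1) d])
  then have B: "module R ?B" using D(1) by (rule submodule.submodule_is_module)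
  have "f ` carrier A \<subseteq> cycles C n" using df hom_closed[OF f] by (auto simp: cycles_def)
  then have f': "f \<in> hom_set R A ?B"
    using f ex by (intro hom_set_image_submodule) (auto simp: exact_complex_def)
  have d': "Diff C (n + 1) \<in> hom_set R (Obj C (n + 1)) ?B"
    using d by (rule hom_set_image_submodule) (simp add: boundaries_def)
  have "Diff C (n + 1) ` carrier (Obj C (n + 1)) = carrier ?B" by (simp add: boundaries_def)
  then obtain h where "h \<in> hom_set R A (Obj C (n + 1))" "compose (carrier A) (Diff C (n + 1)) h = f"
    using \<P>[OF A] D(1) B d' f' unfolding projective_def by metis
  then show "\<exists>h\<in>hom_set R A (Obj C (n + 1)). \<forall>x\<in>carrier A. Diff C (n + 1) (h x) = f x"
    by (metis compose_eq)
qed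

lemma Hom_to_exact_injective:
  assumes C: "is_complex R C" and ex: "exact_complex C" and \<I>: "\<And>A. A \<in> \<I> \<Longrightarrow> injective R A"
  shows "Hom_to_exact R \<I> C"
proof (rule Hom_to_exactI[OF C])
  note D = is_complexD[OF C]
  show I: "module R A" if "A \<in> \<I>" for A using \<I>[OF that] by (simp add: injective_def)
  fix A n f assume A: "A \<in> \<I>" and f: "f \<in> hom_set R (Obj C n) A"
    and fd: "\<And>x. x \<in> carrier (Obj C (n + 1)) \<Longrightarrow> f (Diff C (n + 1) x) = \<zero>\<^bsub>A\<^esub>"
  \<comment> \<open>\<open>f\<close> descends to the image of the differential because it kills the
    boundaries, which form the kernel of \<open>Diff C n\<close>; injectivity then extends the
    result along the inclusion of that image.\<close>
  let ?H = "Diff C n ` carrier (Obj C n)"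
  let ?B = "(Obj C (n - 1))\<lparr>carrier := ?H\<rparr>"
  have "submodule ?H R (Obj C (n - 1))" by (rule submodule_image[OF D(1,1,2)])
  then have B: "module R ?B" using D(1) by (rule submodule.submodule_is_module)
  have d': "Diff C n \<in> hom_set R (Obj C n) ?B"
    using D(2) by (rule hom_set_image_submodule) simp
  have ker: "f x = \<zero>\<^bsub>A\<^esub>" if "x \<in> carrier (Obj C n)" "Diff C n x = \<zero>\<^bsub>?B\<^esub>" for x
  proof -
    have "x \<in> boundaries C n"
      using that ex by (auto simp: exact_complex_def cycles_def)
    then show ?thesis using fd by (auto simp: boundaries_def)
  qed
  obtain g where g: "g \<in> hom_set R ?B A" "\<And>x. x \<in> carrier (Obj C n) \<Longrightarrow> g (Diff C n x) = f x"
    by (rule factor_through_epi[OF D(1) B I[OF A] d' _ f]) (simp, blast intro: ker, blast)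
  have "(\<lambda>x\<in>carrier ?B. x) \<in> hom_set R ?B (Obj C (n - 1))"
    using B by (rule hom_setI) (auto simp: hom_closed[OF D(2)])
  moreover have "inj_on (\<lambda>x\<in>carrier ?B. x) (carrier ?B)" by (simp add: inj_on_def)
  ultimately obtain h where h: "h \<in> hom_set R (Obj C (n - 1)) A"
      "compose (carrier ?B) h (\<lambda>x\<in>carrier ?B. x) = g"
    using \<I>[OF A] D(1) B g(1) unfolding injective_def by metis
  have "h (Diff C n x) = f x" if "x \<in> carrier (Obj C n)" for x
    using that compose_eqD[OF h(2), of "Diff C n x"] g(2) by simp
  then show "\<exists>h\<in>hom_set R (Obj C (n - 1)) A. \<forall>x\<in>carrier (Obj C n). h (Diff C n x) = f x"
    using h(1) by blast
qed

text \<open>The recursion is shifted by one: \<open>g n\<close> acts in degree \<open>n - 1\<close>,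
  so that it starts with the identity of \<open>M\<close> in degree -1. The invariant makes
  \<open>g n\<close> after \<open>Diff C n\<close> a cycle, which is what Hom-exactness turns into
  \<open>g (Suc n)\<close>.\<close>

lemma lift_of_id_exists:
  assumes M: "module R M" and P: "resolution R \<P> M P \<epsilon>P" and X: "resolution R \<X> M X \<epsilon>X"
    and ex: "Hom_from_exact R \<P> (augment X \<epsilon>X M)"
  shows "\<exists>f. lift_of_id R P \<epsilon>P X \<epsilon>X f"
proof -
  define C where "C = augment P \<epsilon>P M"
  define D where "D = augment X \<epsilon>X M"
  note C = is_complexD[OF resolutionD(2)[OF P M], folded C_def]
  note D = is_complexD[OF resolutionD(2)[OF X M], folded D_def]
  note D' = is_complexD[OF resolutionD(1)[OF X M]] and C' = is_complexD[OF resolutionD(1)[OF P M]]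
  have "\<exists>g. \<forall>n. (g n \<in> hom_set R (Obj C (int n - 1)) (Obj D (int n - 1)) \<and>
        (\<forall>x\<in>carrier (Obj C (int n)). Diff D (int n - 1) (g n (Diff C (int n) x)) = \<zero>\<^bsub>Obj D (int n - 2)\<^esub>) \<and>
        (n = 0 \<longrightarrow> g n = (\<lambda>x\<in>carrier M. x))) \<and>
      (\<forall>x\<in>carrier (Obj C (int n)). Diff D (int n) (g (Suc n) x) = g n (Diff C (int n) x))"
  proof (rule dependent_nat_choice)
    have "Diff C 0 x \<in> carrier M" if "x \<in> carrier (Obj C 0)" for x
      using hom_closed[OF C(2) that] by (simp add: C_def augment_sel)
    then show "\<exists>g. g \<in> hom_set R (Obj C (int 0 - 1)) (Obj D (int 0 - 1)) \<and>
        (\<forall>x\<in>carrier (Obj C (int 0)). Diff D (int 0 - 1) (g (Diff C (int 0) x)) = \<zero>\<^bsub>Obj D (int 0 - 2)\<^esub>) \<and>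
        (0 = (0::nat) \<longrightarrow> g = (\<lambda>x\<in>carrier M. x))"
      using hom_id[OF M] by (intro exI[of _ "\<lambda>x\<in>carrier M. x"]) (simp add: C_def D_def augment_sel zero_hom_def)
  next
    fix g n
    assume "g \<in> hom_set R (Obj C (int n - 1)) (Obj D (int n - 1)) \<and>
        (\<forall>x\<in>carrier (Obj C (int n)). Diff D (int n - 1) (g (Diff C (int n) x)) = \<zero>\<^bsub>Obj D (int n - 2)\<^esub>) \<and>
        (n = 0 \<longrightarrow> g = (\<lambda>x\<in>carrier M. x))"
    then have g: "g \<in> hom_set R (Obj C (int n - 1)) (Obj D (int n - 1))"
      "\<And>x. x \<in> carrier (Obj C (int n)) \<Longrightarrow> Diff D (int n - 1) (g (Diff C (int n) x)) = \<zero>\<^bsub>Obj D (int n - 2)\<^esub>"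
      by auto
    let ?f = "compose (carrier (Obj C (int n))) g (Diff C (int n))"
    have f: "?f \<in> hom_set R (Obj C (int n)) (Obj D (int n - 1))"
      by (rule hom_compose[OF C(1,2) g(1)])
    have Cn: "Obj C (int n) \<in> \<P>" using resolutionD(10)[OF P M] by (simp add: C_def augment_sel)
    obtain h where h: "h \<in> hom_set R (Obj C (int n)) (Obj D (int n - 1 + 1))"
      "\<And>x. x \<in> carrier (Obj C (int n)) \<Longrightarrow> Diff D (int n - 1 + 1) (h x) = ?f x"
      by (rule Hom_from_exactD[OF ex[folded D_def] Cn f]) (use g(2) in \<open>simp_all add: compose_eq\<close>)
    have "Diff D (int n) (h (Diff C (int n + 1) x)) = \<zero>\<^bsub>Obj D (int n - 1)\<^esub>"
      if x: "x \<in> carrier (Obj C (int n + 1))" for x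
    proof -
      have "Diff C (int n + 1) x \<in> carrier (Obj C (int n))" using hom_closed[OF C(2) x] by simp
      then show ?thesis
        using h(2) C(3)[OF x] hom_zero[OF C(1) D(1) g(1)] by (simp add: compose_eq)
    qed
    then show "\<exists>h. (h \<in> hom_set R (Obj C (int (Suc n) - 1)) (Obj D (int (Suc n) - 1)) \<and>
        (\<forall>x\<in>carrier (Obj C (int (Suc n))). Diff D (int (Suc n) - 1) (h (Diff C (int (Suc n)) x)) = \<zero>\<^bsub>Obj D (int (Suc n) - 2)\<^esub>) \<and>
        (Suc n = 0 \<longrightarrow> h = (\<lambda>x\<in>carrier M. x))) \<and>
      (\<forall>x\<in>carrier (Obj C (int n)). Diff D (int n) (h x) = g (Diff C (int n) x))"
      using h by (intro exI[of _ h]) (simp add: compose_eq add.commute)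
  qed
  then obtain g where g: "\<And>n. g n \<in> hom_set R (Obj C (int n - 1)) (Obj D (int n - 1))"
      "g 0 = (\<lambda>x\<in>carrier M. x)"
      "\<And>n x. x \<in> carrier (Obj C (int n)) \<Longrightarrow> Diff D (int n) (g (Suc n) x) = g n (Diff C (int n) x)"
    by metis
  define f where "f k = (if k < 0 then zero_hom (Obj P k) (Obj X k) else g (Suc (nat k)))" for k
  have f: "f k \<in> hom_set R (Obj P k) (Obj X k)" for k
    using g(1)[of "Suc (nat k)"] zero_hom_in_hom_set[OF C'(1) D'(1)]
    by (auto simp: f_def C_def D_def augment_sel)
  have comm: "Diff X k (f k x) = f (k - 1) (Diff P k x)" if x: "x \<in> carrier (Obj P k)" for k x
  proof (cases "k > 0")
    case True
    then have "f (k - 1) = g (nat k)" by (simp add: f_def nat_diff_distrib)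
    then show ?thesis
      using g(3)[of x "nat k"] x True by (simp add: f_def C_def D_def augment_sel)
  next
    case False
    \<comment> \<open>For \<open>k \<le> 0\<close> both composites end in a zero module; at
      \<open>k = 0\<close> the recursion relates \<open>f 0\<close> to the augmentations
      instead.\<close>
    then have "carrier (Obj X (k - 1)) = {\<zero>\<^bsub>Obj X (k - 1)\<^esub>}"
      using resolutionD(11)[OF X M] by simp
    then show ?thesis
      using hom_closed[OF D'(2) hom_closed[OF f x]] hom_closed[OF f hom_closed[OF C'(2) x]] by simp
  qed
  have "compose (carrier (Obj P k)) (Diff X k) (f k) = compose (carrier (Obj P k)) (f (k - 1)) (Diff P k)" for k
    using comm by (simp add: compose_def cong: restrict_cong)
  moreover have "compose (carrier (Obj P 0)) \<epsilon>X (f 0) = \<epsilon>P"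
  proof (rule compose_eqI[OF resolutionD(4)[OF P M]])
    fix x assume x: "x \<in> carrier (Obj P 0)"
    then show "\<epsilon>X (f 0 x) = \<epsilon>P x"
      using g(3)[of x 0] g(2) hom_closed[OF resolutionD(4)[OF P M] x]
      by (simp add: f_def C_def D_def augment_sel)
  qed
  ultimately show ?thesis
    using f by (auto simp: lift_of_id_def chain_map_def)
qed

text \<open>Here \<open>g n\<close> acts in degree \<open>1 - n\<close>, beginning with the identity
  of \<open>N\<close> in degree 1. The invariant says that \<open>Diff D\<close> after
  \<open>g n\<close> kills the incoming boundaries of \<open>C\<close>, so that it extends along the
  outgoing differential of \<open>C\<close>.\<close>

lemma extension_of_id_exists:
  assumes N: "module R N" and Y: "coresolution R \<Y> N Y \<eta>Y" and I: "coresolution R \<I> N I \<eta>I"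
    and ex: "Hom_to_exact R \<I> (coaugment Y \<eta>Y N)"
  shows "\<exists>f. extension_of_id R N Y \<eta>Y I \<eta>I f"
proof -
  define C where "C = coaugment Y \<eta>Y N"
  define D where "D = coaugment I \<eta>I N"
  note C = is_complexD[OF coresolutionD(2)[OF Y N], folded C_def]
  note D = is_complexD[OF coresolutionD(2)[OF I N], folded D_def]
  note D' = is_complexD[OF coresolutionD(1)[OF I N]] and C' = is_complexD[OF coresolutionD(1)[OF Y N]]
  have "\<exists>g. \<forall>n. (g n \<in> hom_set R (Obj C (1 - int n)) (Obj D (1 - int n)) \<and>
        (\<forall>x\<in>carrier (Obj C (2 - int n)). Diff D (1 - int n) (g n (Diff C (2 - int n) x)) = \<zero>\<^bsub>Obj D (- int n)\<^esub>) \<and>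
        (n = 0 \<longrightarrow> g n = (\<lambda>x\<in>carrier N. x))) \<and>
      (\<forall>x\<in>carrier (Obj C (1 - int n)). Diff D (1 - int n) (g n x) = g (Suc n) (Diff C (1 - int n) x))"
  proof (rule dependent_nat_choice)
    interpret N: module R N by fact
    \<comment> \<open>For \<open>n = 0\<close> the incoming differential is the zero map into
      \<open>N\<close>, so the invariant amounts to \<open>\<eta>I\<close> preserving zero.\<close>
    have "\<eta>I \<zero>\<^bsub>N\<^esub> = \<zero>\<^bsub>Obj I 0\<^esub>" by (rule hom_zero[OF N D'(1) coresolutionD(4)[OF I N]])
    then show "\<exists>g. g \<in> hom_set R (Obj C (1 - int 0)) (Obj D (1 - int 0)) \<and>
        (\<forall>x\<in>carrier (Obj C (2 - int 0)). Diff D (1 - int 0) (g (Diff C (2 - int 0) x)) = \<zero>\<^bsub>Obj D (- int 0)\<^esub>) \<and>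
        (0 = (0::nat) \<longrightarrow> g = (\<lambda>x\<in>carrier N. x))"
      using hom_id[OF N]
      by (intro exI[of _ "\<lambda>x\<in>carrier N. x"]) (simp add: C_def D_def coaugment_sel zero_hom_def)
  next
    fix g n
    assume "g \<in> hom_set R (Obj C (1 - int n)) (Obj D (1 - int n)) \<and>
        (\<forall>x\<in>carrier (Obj C (2 - int n)). Diff D (1 - int n) (g (Diff C (2 - int n) x)) = \<zero>\<^bsub>Obj D (- int n)\<^esub>) \<and>
        (n = 0 \<longrightarrow> g = (\<lambda>x\<in>carrier N. x))"
    then have g: "g \<in> hom_set R (Obj C (1 - int n)) (Obj D (1 - int n))"
      "\<And>x. x \<in> carrier (Obj C (2 - int n)) \<Longrightarrow> Diff D (1 - int n) (g (Diff C (2 - int n) x)) = \<zero>\<^bsub>Obj D (- int n)\<^esub>"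
      by auto
    let ?f = "compose (carrier (Obj C (1 - int n))) (Diff D (1 - int n)) g"
    have d: "Diff D (1 - int n) \<in> hom_set R (Obj D (1 - int n)) (Obj D (- int n))"
      using D(2)[of "1 - int n"] by simp
    have f: "?f \<in> hom_set R (Obj C (1 - int n)) (Obj D (- int n))"
      by (rule hom_compose[OF C(1) g(1) d])
    have Dn: "Obj D (- int n) \<in> \<I>" using coresolutionD(10)[OF I N] by (simp add: D_def coaugment_sel)
    have f0: "?f (Diff C (1 - int n + 1) x) = \<zero>\<^bsub>Obj D (- int n)\<^esub>" if "x \<in> carrier (Obj C (1 - int n + 1))" for x
      using that g(2)[of x] hom_closed[OF C(2) that] by (simp add: compose_eq)
    obtain h where h: "h \<in> hom_set R (Obj C (1 - int n - 1)) (Obj D (- int n))"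
      "\<And>x. x \<in> carrier (Obj C (1 - int n)) \<Longrightarrow> h (Diff C (1 - int n) x) = ?f x"
      by (rule Hom_to_exactD[OF ex[folded C_def] Dn f f0]) blast+
    have "Diff D (- int n) (h (Diff C (1 - int n) x)) = \<zero>\<^bsub>Obj D (- int n - 1)\<^esub>"
      if x: "x \<in> carrier (Obj C (1 - int n))" for x
      using h(2)[OF x] D(3)[of "g x" "- int n"] hom_closed[OF g(1) x] x by (simp add: compose_eq)
    then show "\<exists>h. (h \<in> hom_set R (Obj C (1 - int (Suc n))) (Obj D (1 - int (Suc n))) \<and>
        (\<forall>x\<in>carrier (Obj C (2 - int (Suc n))). Diff D (1 - int (Suc n)) (h (Diff C (2 - int (Suc n)) x)) = \<zero>\<^bsub>Obj D (- int (Suc n))\<^esub>) \<and>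
        (Suc n = 0 \<longrightarrow> h = (\<lambda>x\<in>carrier N. x))) \<and>
      (\<forall>x\<in>carrier (Obj C (1 - int n)). Diff D (1 - int n) (g x) = h (Diff C (1 - int n) x))"
      using h minus_diff_commute[of "int n" 1] by (intro exI[of _ h]) (simp add: compose_eq)
  qed
  then obtain g where g: "\<And>n. g n \<in> hom_set R (Obj C (1 - int n)) (Obj D (1 - int n))"
      "g 0 = (\<lambda>x\<in>carrier N. x)"
      "\<And>n x. x \<in> carrier (Obj C (1 - int n)) \<Longrightarrow> Diff D (1 - int n) (g n x) = g (Suc n) (Diff C (1 - int n) x)"
    by metis
  define f where "f k = (if k > 0 then zero_hom (Obj Y k) (Obj I k) else g (Suc (nat (- k))))" for k
  have f: "f k \<in> hom_set R (Obj Y k) (Obj I k)" for k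
    using g(1)[of "Suc (nat (- k))"] zero_hom_in_hom_set[OF C'(1) D'(1)]
    by (auto simp: f_def C_def D_def coaugment_sel)
  have comm: "Diff I k (f k x) = f (k - 1) (Diff Y k x)" if x: "x \<in> carrier (Obj Y k)" for k x
  proof (cases "k > 0")
    case True
    \<comment> \<open>For \<open>k > 0\<close> it is the source that is zero, so both sides are
      values at zero.\<close>
    then have "x = \<zero>\<^bsub>Obj Y k\<^esub>" using coresolutionD(11)[OF Y N, of k] x by simp
    then show ?thesis
      using hom_zero[OF C'(1) D'(1) f] hom_zero[OF C'(1) C'(1) C'(2)] hom_zero[OF D'(1) D'(1) D'(2)] by simp
  next
    case False
    then have "nat (1 - k) = Suc (nat (- k))" by simp
    then show ?thesis
      using g(3)[of x "Suc (nat (- k))"] x False by (simp add: f_def C_def D_def coaugment_sel)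
  qed
  have "compose (carrier (Obj Y k)) (Diff I k) (f k) = compose (carrier (Obj Y k)) (f (k - 1)) (Diff Y k)" for k
    using comm by (simp add: compose_def cong: restrict_cong)
  moreover have "compose (carrier N) (f 0) \<eta>Y = \<eta>I"
  proof (rule compose_eqI[OF coresolutionD(4)[OF I N]])
    fix x assume x: "x \<in> carrier N"
    then show "f 0 (\<eta>Y x) = \<eta>I x"
      using g(3)[of x 0] g(2) by (simp add: f_def C_def D_def coaugment_sel)
  qed
  ultimately show ?thesis
    using f by (auto simp: extension_of_id_def chain_map_def)
qed

section \<open>Extensions classified by cocycles\<close>

text \<open>The middle terms of \<open>E\<close> and \<open>E'\<close> may live on different types:
  this identifies the class of a pushout or pullback with the class of its copy on
  \<open>'m\<close>.\<close>

lemma ext_class_eq: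
  fixes M N :: "('r, 'm) module"
  assumes "module R M" "module R N" "short_exact R M N E" "short_exact R M N E'" "ext_equiv R N E E'"
  shows "ext_class R M N E = ext_class R M N E'"
proof -
  have "ext_equiv R N E F \<longleftrightarrow> ext_equiv R N E' F" for F :: "('r, 'm, 'm) ext"
    using ext_equiv_trans[OF assms(3,5)] ext_equiv_trans[OF assms(4) ext_equiv_sym[OF assms]] by blast
  then show ?thesis by (simp add: ext_class_def)
qed

lemma ext_equiv_refl:
  assumes "short_exact R M N E"
  shows "ext_equiv R N E E"
proof -
  obtain T i p where E: "E = (T, i, p)" by (cases E) auto
  note T = short_exactD[OF assms[unfolded E]]
  show ?thesis
    unfolding E ext_equiv_def prod.case
    by (intro bexI[OF _ hom_id[OF T(1)]] conjI compose_eqI[OF T(2)] compose_eqI[OF T(3)])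
      (simp_all add: hom_closed[OF T(2)])
qed

section \<open>Cocycles on a resolution of \<open>M\<close> and pushouts\<close>

lemma cocycle_res_iff:
  "\<alpha> \<in> cycles (Hom_to R X N) (- 1) \<longleftrightarrow>
    \<alpha> \<in> hom_set R (Obj X 1) N \<and> (\<forall>x\<in>carrier (Obj X 2). \<alpha> (Diff X 2 x) = \<zero>\<^bsub>N\<^esub>)"
  by (simp add: cycles_Hom_to)

lemma coboundaries_res:
  "boundaries (Hom_to R X N) (- 1) = (\<lambda>\<beta>. compose (carrier (Obj X 1)) \<beta> (Diff X 1)) ` hom_set R (Obj X 0) N"
  by (simp add: boundaries_Hom_to)

lemma homology_class_res_iff:
  assumes "z \<in> hom_set R (Obj X 1) N" "\<alpha> \<in> hom_set R (Obj X 1) N"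
  shows "z \<in> homology_class (Hom_to R X N) (- 1) \<alpha> \<longleftrightarrow>
    (\<exists>\<beta>\<in>hom_set R (Obj X 0) N. \<forall>x\<in>carrier (Obj X 1). z x = \<beta> (Diff X 1 x) \<oplus>\<^bsub>N\<^esub> \<alpha> x)"
proof -
  have "z = compose (carrier (Obj X 1)) \<beta> (Diff X 1) \<oplus>\<^bsub>Obj (Hom_to R X N) (- 1)\<^esub> \<alpha> \<longleftrightarrow>
      (\<forall>x\<in>carrier (Obj X 1). z x = \<beta> (Diff X 1 x) \<oplus>\<^bsub>N\<^esub> \<alpha> x)" for \<beta>
    using hom_extensional[OF assms(1)]
    by (auto simp: Hom_to_def hom_module_def compose_eq intro!: extensionalityI)
  then show ?thesis
    by (simp add: mem_homology_class_iff coboundaries_res)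
qed

definition ext_of_cocycle ::
  "'r ring \<Rightarrow> ('r, 'm) module \<Rightarrow> ('r, 'm) module \<Rightarrow> ('r, 'm) cplx \<Rightarrow> ('m \<Rightarrow> 'm) \<Rightarrow> ('m \<Rightarrow> 'm) \<Rightarrow>
   ('r, 'm, 'm) ext set" where
  "ext_of_cocycle R M N X \<epsilon> \<alpha> =
     {(T, i, p). short_exact R M N (T, i, p) \<and>
        (\<exists>g\<in>hom_set R (Obj X 0) T. (\<forall>x\<in>carrier (Obj X 0). p (g x) = \<epsilon> x) \<and>
           (\<forall>x\<in>carrier (Obj X 1). g (Diff X 1 x) = i (\<alpha> x)))}"

context
  fixes R :: "'r ring" and M N :: "('r, 'm) module" and X :: "('r, 'm) cplx" and \<epsilon> and \<X>
  assumes M: "module R M" and N: "module R N" and inf: "infinite (UNIV :: 'm set)"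
    and X: "resolution R \<X> M X \<epsilon>"
begin

private lemmas rX = resolutionD[OF X M]
private lemmas cX = is_complexD[OF rX(1)]

text \<open>The second claim supplies a member on \<open>'m\<close>. Without one, unequal cohomology
  classes could share the empty class, and injectivity would be lost.\<close>

lemma ext_of_cocycle_pushout:
  assumes \<alpha>: "\<alpha> \<in> cycles (Hom_to R X N) (- 1)"
  shows "ext_class R M N
      (pushout_extension N (quot_module (Obj X 1) (boundaries X 1)) (Obj X 0)
         (induced_map (Obj X 1) (boundaries X 1) (Diff X 1)) \<epsilon>
         (induced_map (Obj X 1) (boundaries X 1) \<alpha>)) = ext_of_cocycle R M N X \<epsilon> \<alpha>" (is "ext_class R M N ?E = _")
    and "\<exists>E'. short_exact R M N E' \<and> E' \<in> ext_of_cocycle R M N X \<epsilon> \<alpha> \<and>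
      ext_of_cocycle R M N X \<epsilon> \<alpha> = ext_class R M N E'"
proof -
  have \<alpha>': "\<alpha> \<in> hom_set R (Obj X 1) N" "\<forall>x\<in>boundaries X 1. \<alpha> x = \<zero>\<^bsub>N\<^esub>"
    using \<alpha> by (auto simp: cocycle_res_iff boundaries_def)
  have B: "submodule (boundaries X 1) R (Obj X 1)"
    using submodule_image[OF cX(1) cX(1) rX(9)] by (simp add: boundaries_def)
  have B': "{x \<in> carrier (Obj X 1). Diff X 1 x = \<zero>\<^bsub>Obj X 0\<^esub>} = boundaries X 1"
    by (simp add: boundaries_def rX(7))
  note po = pushout_extension[OF M N cX(1) cX(1) rX(4,5,8,6) B B' \<alpha>']
  show 1: "ext_class R M N ?E = ext_of_cocycle R M N X \<epsilon> \<alpha>"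
    using po(2) by (auto simp: ext_class_def ext_of_cocycle_def is_extension_iff_short_exact[OF M N])
  obtain E' :: "('r, 'm, 'm) ext" where E': "short_exact R M N E'" "ext_equiv R N ?E E'"
    using po(3)[OF inf] by blast
  have "ext_class R M N E' = ext_of_cocycle R M N X \<epsilon> \<alpha>"
    unfolding 1[symmetric] by (rule ext_class_eq[OF M N po(1) E', symmetric])
  moreover have "E' \<in> ext_class R M N E'"
    using E'(1) ext_equiv_refl[OF E'(1)] by (simp add: ext_class_def is_extension_iff_short_exact[OF M N])
  ultimately show "\<exists>E'. short_exact R M N E' \<and> E' \<in> ext_of_cocycle R M N X \<epsilon> \<alpha> \<and>
      ext_of_cocycle R M N X \<epsilon> \<alpha> = ext_class R M N E'"
    using E'(1) by metis
qed

text \<open>An inclusion suffices, because \<open>z\<close> and \<open>\<alpha>\<close> can be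
  exchanged: being cohomologous is symmetric.\<close>

lemma ext_of_cocycle_mono:
  assumes \<alpha>: "\<alpha> \<in> cycles (Hom_to R X N) (- 1)" and z: "z \<in> homology_class (Hom_to R X N) (- 1) \<alpha>"
  shows "ext_of_cocycle R M N X \<epsilon> \<alpha> \<subseteq> ext_of_cocycle R M N X \<epsilon> z"
proof
  fix E assume "E \<in> ext_of_cocycle R M N X \<epsilon> \<alpha>"
  then obtain T i p g where E: "E = (T, i, p)" "short_exact R M N (T, i, p)" and g: "g \<in> hom_set R (Obj X 0) T"
      "\<And>x. x \<in> carrier (Obj X 0) \<Longrightarrow> p (g x) = \<epsilon> x"
      "\<And>x. x \<in> carrier (Obj X 1) \<Longrightarrow> g (Diff X 1 x) = i (\<alpha> x)"
    by (auto simp: ext_of_cocycle_def)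
  note T = short_exactD[OF E(2)]
  interpret T: module R T by (rule T(1))
  interpret M: module R M by (rule M)
  have "z \<in> cycles (Hom_to R X N) (- 1)"
    using homology_class_cycles[OF is_complex_Hom_to[OF rX(1) N] \<alpha>] z by blast
  then have hom: "z \<in> hom_set R (Obj X 1) N" "\<alpha> \<in> hom_set R (Obj X 1) N"
    using \<alpha> by (simp_all add: cocycle_res_iff)
  from z obtain \<beta> where \<beta>: "\<beta> \<in> hom_set R (Obj X 0) N"
      "\<And>x. x \<in> carrier (Obj X 1) \<Longrightarrow> z x = \<beta> (Diff X 1 x) \<oplus>\<^bsub>N\<^esub> \<alpha> x"
    unfolding homology_class_res_iff[OF hom] by blast
  define g' where "g' = (\<lambda>x\<in>carrier (Obj X 0). compose (carrier (Obj X 0)) i \<beta> x \<oplus>\<^bsub>T\<^esub> g x)"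
  have "g' \<in> hom_set R (Obj X 0) T"
    unfolding g'_def by (rule hom_add_in_hom_set[OF cX(1) T(1) hom_compose[OF cX(1) \<beta>(1) T(2)] g(1)])
  moreover have "p (g' x) = \<epsilon> x" if "x \<in> carrier (Obj X 0)" for x
    using that hom_closed[OF rX(4) that]
    by (simp add: g'_def compose_eq hom_add[OF T(3)] hom_closed[OF T(2)] hom_closed[OF \<beta>(1)] hom_closed[OF g(1)] T(6) g(2))
  moreover have "g' (Diff X 1 x) = i (z x)" if "x \<in> carrier (Obj X 1)" for x
    using that hom_closed[OF rX(8) that] hom_closed[OF hom(2) that]
    by (simp add: g'_def compose_eq \<beta>(2) g(3) hom_add[OF T(2)] hom_closed[OF \<beta>(1)])
  ultimately show "E \<in> ext_of_cocycle R M N X \<epsilon> z"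
    using E by (auto simp: ext_of_cocycle_def)
qed

lemma ext_of_cocycle_eq_iff:
  assumes \<alpha>: "\<alpha> \<in> cycles (Hom_to R X N) (- 1)" and z: "z \<in> cycles (Hom_to R X N) (- 1)"
  shows "ext_of_cocycle R M N X \<epsilon> z = ext_of_cocycle R M N X \<epsilon> \<alpha> \<longleftrightarrow>
    z \<in> homology_class (Hom_to R X N) (- 1) \<alpha>" (is "?L \<longleftrightarrow> ?R")
proof
  note H = is_complex_Hom_to[OF rX(1) N]
  assume zR: ?R
  then have "\<alpha> \<in> homology_class (Hom_to R X N) (- 1) z"
    using homology_class_eq[OF H \<alpha> zR] homology_class_self[OF H \<alpha>] by simp
  then show ?L
    using ext_of_cocycle_mono[OF \<alpha> zR] ext_of_cocycle_mono[OF z] by (intro equalityI)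
next
  assume L: ?L
  have hom: "z \<in> hom_set R (Obj X 1) N" "\<alpha> \<in> hom_set R (Obj X 1) N"
    using \<alpha> z by (simp_all add: cocycle_res_iff)
  \<comment> \<open>Equal classes have a common member as they are nonempty, so the maps belonging
    to \<open>\<alpha>\<close> and \<open>z\<close> go to the same \<open>T\<close> and can be
    subtracted.\<close>
  obtain T i p where E: "(T, i, p) \<in> ext_of_cocycle R M N X \<epsilon> \<alpha>" "(T, i, p) \<in> ext_of_cocycle R M N X \<epsilon> z"
  proof -
    obtain E where "E \<in> ext_of_cocycle R M N X \<epsilon> \<alpha>"
      using ext_of_cocycle_pushout(2)[OF \<alpha>] by blast
    then show ?thesis using that L by (cases E) auto
  qed
  from E(1) obtain g where T: "short_exact R M N (T, i, p)" and g: "g \<in> hom_set R (Obj X 0) T"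
      "\<And>x. x \<in> carrier (Obj X 0) \<Longrightarrow> p (g x) = \<epsilon> x"
      "\<And>x. x \<in> carrier (Obj X 1) \<Longrightarrow> g (Diff X 1 x) = i (\<alpha> x)"
    by (auto simp: ext_of_cocycle_def)
  from E(2) obtain g' where g': "g' \<in> hom_set R (Obj X 0) T"
      "\<And>x. x \<in> carrier (Obj X 0) \<Longrightarrow> p (g' x) = \<epsilon> x"
      "\<And>x. x \<in> carrier (Obj X 1) \<Longrightarrow> g' (Diff X 1 x) = i (z x)"
    by (auto simp: ext_of_cocycle_def)
  note T = short_exactD[OF T]
  interpret T: module R T by (rule T(1))
  interpret N: module R N by (rule N)
  let ?f = "\<lambda>x\<in>carrier (Obj X 0). g' x \<ominus>\<^bsub>T\<^esub> g x"
  have f: "?f \<in> hom_set R (Obj X 0) T" by (rule hom_diff_in_hom_set[OF cX(1) T(1) g'(1) g(1)])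
  have "?f x \<in> i ` carrier N" if "x \<in> carrier (Obj X 0)" for x
    using that hom_closed[OF f that] hom_closed[OF rX(4) that] module_diff_zero_iff[OF M]
    by (intro T(7)) (simp_all add: hom_diff[OF T(1) M T(3)] hom_closed[OF g(1)] hom_closed[OF g'(1)] g g')
  then obtain \<beta> where \<beta>: "\<beta> \<in> hom_set R (Obj X 0) N" "\<And>x. x \<in> carrier (Obj X 0) \<Longrightarrow> i (\<beta> x) = ?f x"
    using factor_through_mono[OF cX(1) N T(1,2,4) f] by blast
  have "z x = \<beta> (Diff X 1 x) \<oplus>\<^bsub>N\<^esub> \<alpha> x" if x: "x \<in> carrier (Obj X 1)" for x
  proof (rule inj_onD[OF T(4)])
    note cl = hom_closed[OF rX(8) x] hom_closed[OF hom(1) x] hom_closed[OF hom(2) x]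
    show "i (z x) = i (\<beta> (Diff X 1 x) \<oplus>\<^bsub>N\<^esub> \<alpha> x)"
      using cl x by (simp add: hom_add[OF T(2)] hom_closed[OF \<beta>(1)] \<beta>(2) g(3) g'(3)
          module_diff_add_cancel[OF T(1)] hom_closed[OF T(2)])
    show "z x \<in> carrier N" "\<beta> (Diff X 1 x) \<oplus>\<^bsub>N\<^esub> \<alpha> x \<in> carrier N"
      using cl hom_closed[OF \<beta>(1)] by simp_all
  qed
  then show ?R unfolding homology_class_res_iff[OF hom] using \<beta>(1) by blast
qed

text \<open>Cohomologous cocycles give the same class, which collapses the union in
  \<open>xi\<close>. The resolution is arbitrary here, so the formula for the classical map also
  defines the relative one.\<close>

lemma xi_homology_class:
  assumes \<alpha>: "\<alpha> \<in> cycles (Hom_to R X N) (- 1)"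
  shows "xi R M N X \<epsilon> (homology_class (Hom_to R X N) (- 1) \<alpha>) = ext_of_cocycle R M N X \<epsilon> \<alpha>"
proof -
  note H = homology_class[OF is_complex_Hom_to[OF rX(1) N] \<alpha>]
  have "xi R M N X \<epsilon> (homology_class (Hom_to R X N) (- 1) \<alpha>) =
      (\<Union>z\<in>homology_class (Hom_to R X N) (- 1) \<alpha>. ext_of_cocycle R M N X \<epsilon> z)"
    unfolding xi_def using H(3) by (intro SUP_cong refl ext_of_cocycle_pushout(1)) auto
  also have "\<dots> = ext_of_cocycle R M N X \<epsilon> \<alpha>"
    using H(1,3) ext_of_cocycle_eq_iff[OF \<alpha>] by blast
  finally show ?thesis .
qed

text \<open>The set is a whole equivalence class, represented by each of its members. Hence two such
  sets, even for different resolutions of \<open>M\<close>, are equal as soon as they have one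
  extension in common.\<close>

lemma ext_of_cocycle_eq_ext_class:
  assumes \<alpha>: "\<alpha> \<in> cycles (Hom_to R X N) (- 1)" and E: "E \<in> ext_of_cocycle R M N X \<epsilon> \<alpha>"
  shows "ext_of_cocycle R M N X \<epsilon> \<alpha> = ext_class R M N E"
proof -
  obtain E' :: "('r, 'm, 'm) ext" where E': "short_exact R M N E'" "ext_of_cocycle R M N X \<epsilon> \<alpha> = ext_class R M N E'"
    using ext_of_cocycle_pushout(2)[OF \<alpha>] by metis
  then have "short_exact R M N E" "ext_equiv R N E' E"
    using E by (auto simp: ext_class_def is_extension_iff_short_exact[OF M N])
  then show ?thesis
    using ext_class_eq[OF M N E'(1)] E'(2) by simp
qed

lemma bij_betw_xi:
  assumes proper: "Hom_from_exact R \<X> (augment X \<epsilon> M)" and mod: "\<forall>A\<in>\<X>. module R A"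
  shows "bij_betw (xi R M N X \<epsilon>) (carrier (Ext_res R X N 1)) (e_from R \<X> M N)"
proof -
  let ?Z = "cycles (Hom_to R X N) (- 1)" and ?c = "homology_class (Hom_to R X N) (- 1)"
  note H = homology_class[OF is_complex_Hom_to[OF rX(1) N]]
  have carr: "carrier (Ext_res R X N 1) = ?c ` ?Z"
    by (simp add: Ext_res_def carrier_homology)
  have "inj_on (xi R M N X \<epsilon>) (?c ` ?Z)"
  proof (intro inj_onI, elim imageE)
    fix c c' z z' assume *: "xi R M N X \<epsilon> c = xi R M N X \<epsilon> c'" "c = ?c z" "z \<in> ?Z" "c' = ?c z'" "z' \<in> ?Z"
    then have z: "z \<in> ?c z'"
      using ext_of_cocycle_eq_iff[of z' z] by (simp add: xi_homology_class)
    show "c = c'" using H(2)[OF *(5) z] *(2,4) by simp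
  qed
  moreover have "xi R M N X \<epsilon> ` ?c ` ?Z = ext_of_cocycle R M N X \<epsilon> ` ?Z"
    by (simp add: image_image xi_homology_class cong: image_cong_simp)
  moreover have "ext_of_cocycle R M N X \<epsilon> ` ?Z = e_from R \<X> M N"
  proof (intro equalityI subsetI)
    fix K assume "K \<in> ext_of_cocycle R M N X \<epsilon> ` ?Z"
    then obtain \<alpha> where \<alpha>: "\<alpha> \<in> ?Z" "K = ext_of_cocycle R M N X \<epsilon> \<alpha>"
      by (rule imageE)
    obtain T i p where E: "short_exact R M N (T, i, p)" "(T, i, p) \<in> ext_of_cocycle R M N X \<epsilon> \<alpha>"
        "ext_of_cocycle R M N X \<epsilon> \<alpha> = ext_class R M N (T, i, p)"
      using ext_of_cocycle_pushout(2)[OF \<alpha>(1)] by (metis prod_cases3)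
    obtain g where g: "g \<in> hom_set R (Obj X 0) T" "\<And>x. x \<in> carrier (Obj X 0) \<Longrightarrow> p (g x) = \<epsilon> x"
      using E(2) by (auto simp: ext_of_cocycle_def)
    have "Hom_from_exact R \<X> (ext_complex M N (T, i, p))"
      unfolding Hom_from_exact_ext_complex_iff[OF M N E(1) mod]
    proof (intro ballI)
      fix A f assume A: "A \<in> \<X>" and f: "f \<in> hom_set R A M"
      \<comment> \<open>Properness, used in degree -1 where the augmented complex has
        \<open>M\<close>, lifts \<open>f\<close> to \<open>Obj X 0\<close>; composing with
        \<open>g\<close> yields the lift to \<open>T\<close>.\<close>
      obtain h where h: "h \<in> hom_set R A (Obj (augment X \<epsilon> M) (- 1 + 1))"
          "\<And>x. x \<in> carrier A \<Longrightarrow> Diff (augment X \<epsilon> M) (- 1 + 1) (h x) = f x"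
        by (rule Hom_from_exactD[OF proper A, of f "- 1"])
          (use f hom_closed[OF f] in \<open>auto simp: augment_sel zero_hom_def\<close>)
      then have h': "h \<in> hom_set R A (Obj X 0)" "\<And>x. x \<in> carrier A \<Longrightarrow> \<epsilon> (h x) = f x"
        by (simp_all add: augment_sel)
      show "\<exists>h\<in>hom_set R A T. \<forall>x\<in>carrier A. p (h x) = f x"
        using h' g(2) hom_closed[OF h'(1)]
        by (intro bexI[OF _ hom_compose[OF mod[rule_format, OF A] h'(1) g(1)]]) (simp add: compose_eq)
    qed
    then show "K \<in> e_from R \<X> M N"
      unfolding e_from_def is_extension_iff_short_exact[OF M N] \<alpha>(2) E(3) using E(1) by blast
  next
    fix K assume "K \<in> e_from R \<X> M N"
    then obtain T i p where K: "K = ext_class R M N (T, i, p)" "short_exact R M N (T, i, p)"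
        and ex: "Hom_from_exact R \<X> (ext_complex M N (T, i, p))"
      by (auto simp: e_from_def is_extension_iff_short_exact[OF M N])
    note T = short_exactD[OF K(2)]
    \<comment> \<open>Conversely \<open>Obj X 0\<close> is itself a test object for the exact
      extension, so the augmentation lifts to \<open>g\<close>.\<close>
    have "Obj X 0 \<in> \<X>" by (rule rX(10)) simp
    then obtain g where g: "g \<in> hom_set R (Obj X 0) T" "\<And>x. x \<in> carrier (Obj X 0) \<Longrightarrow> p (g x) = \<epsilon> x"
      using ex rX(4) unfolding Hom_from_exact_ext_complex_iff[OF M N K(2) mod] by blast
    \<comment> \<open>\<open>p g d = \<epsilon> d = 0\<close>, so \<open>g d\<close> factors through
      \<open>i\<close>; the factor is the cocycle attached to the extension.\<close>
    let ?f = "compose (carrier (Obj X 1)) g (Diff X 1)"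
    have f: "?f \<in> hom_set R (Obj X 1) T" by (rule hom_compose[OF cX(1) rX(8) g(1)])
    have "?f x \<in> i ` carrier N" if "x \<in> carrier (Obj X 1)" for x
    proof (rule T(7)[OF hom_closed[OF f that]])
      have "\<epsilon> (Diff X 1 x) = \<zero>\<^bsub>M\<^esub>" using rX(6) that by blast
      then show "p (?f x) = \<zero>\<^bsub>M\<^esub>"
        using that hom_closed[OF rX(8) that] g(2) by (simp add: compose_eq)
    qed
    then obtain \<alpha> where \<alpha>: "\<alpha> \<in> hom_set R (Obj X 1) N" "\<And>x. x \<in> carrier (Obj X 1) \<Longrightarrow> i (\<alpha> x) = ?f x"
      using factor_through_mono[OF cX(1) N T(1,2,4) f] by blast
    have "\<alpha> (Diff X 2 x) = \<zero>\<^bsub>N\<^esub>" if x: "x \<in> carrier (Obj X 2)" for x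
    proof -
      have d: "Diff X 2 x \<in> carrier (Obj X 1)" "Diff X 1 (Diff X 2 x) = \<zero>\<^bsub>Obj X 0\<^esub>"
        using x rX(7) by blast+
      \<comment> \<open>\<open>i \<alpha> d\<close> equals \<open>g d d\<close>, which is zero, and
        \<open>i\<close> is injective.\<close>
      then have "i (\<alpha> (Diff X 2 x)) = \<zero>\<^bsub>T\<^esub>"
        using \<alpha>(2) hom_zero[OF cX(1) T(1) g(1)] by (simp add: compose_eq)
      then show ?thesis
        using T(4) hom_closed[OF \<alpha>(1) d(1)] hom_inj_on_iff[OF N T(1,2)] by blast
    qed
    then have Z: "\<alpha> \<in> ?Z" using \<alpha>(1) by (simp add: cocycle_res_iff)
    have "(T, i, p) \<in> ext_of_cocycle R M N X \<epsilon> \<alpha>"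
      using K(2) g \<alpha>(2) by (auto simp: ext_of_cocycle_def compose_eq)
    then have "K = ext_of_cocycle R M N X \<epsilon> \<alpha>"
      using ext_of_cocycle_eq_ext_class[OF Z] K(1) by simp
    then show "K \<in> ext_of_cocycle R M N X \<epsilon> ` ?Z" using Z by simp
  qed
  ultimately show ?thesis by (simp add: bij_betw_def carr)
qed

end

text \<open>The hypothesis \<open>ex\<close> holds for a class \<open>\<P>\<close> of projectives,
  and for a subclass of \<open>\<X>\<close> when \<open>X\<close> is proper, so both kinds of
  comparison map are covered at once.\<close>

lemma xi_comparison_res:
  fixes M N :: "('r, 'm) module"
  assumes M: "module R M" and N: "module R N" and inf: "infinite (UNIV :: 'm set)"
    and P: "resolution R \<P> M P \<epsilon>P" and X: "resolution R \<X> M X \<epsilon>X"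
    and ex: "Hom_from_exact R \<P> (augment X \<epsilon>X M)" and c: "c \<in> carrier (Ext_res R X N 1)"
  shows "comparison_res R P \<epsilon>P X \<epsilon>X N 1 c \<in> carrier (Ext_res R P N 1)"
    and "xi R M N P \<epsilon>P (comparison_res R P \<epsilon>P X \<epsilon>X N 1 c) = xi R M N X \<epsilon>X c"
proof -
  note rX = resolutionD[OF X M] and rP = resolutionD[OF P M]
  note cX = is_complexD[OF rX(1)] and cP = is_complexD[OF rP(1)]
  \<comment> \<open>The very lift chosen in \<open>comparison_res\<close>, of which only the lifting
    property enters.\<close>
  define f where "f = (SOME f. lift_of_id R P \<epsilon>P X \<epsilon>X f)"
  have "lift_of_id R P \<epsilon>P X \<epsilon>X f"
    unfolding f_def by (rule someI_ex[OF lift_of_id_exists[OF M P X ex]])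
  then have f: "\<And>n. f n \<in> hom_set R (Obj P n) (Obj X n)"
      "\<And>n. compose (carrier (Obj P n)) (Diff X n) (f n) = compose (carrier (Obj P n)) (f (n - 1)) (Diff P n)"
      "compose (carrier (Obj P 0)) \<epsilon>X (f 0) = \<epsilon>P"
    by (auto simp: lift_of_id_def chain_map_def)
  have f_comm: "f (n - 1) (Diff P n x) = Diff X n (f n x)" if "x \<in> carrier (Obj P n)" for n x
    using fun_cong[OF f(2)[of n], of x] that by (simp add: compose_eq)
  have f1: "f 0 (Diff P 1 x) = Diff X 1 (f 1 x)" if "x \<in> carrier (Obj P 1)" for x
    using f_comm[OF that] by simp
  have f2: "f 1 (Diff P 2 x) = Diff X 2 (f 2 x)" if "x \<in> carrier (Obj P 2)" for x
    using f_comm[OF that] by simp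
  let ?\<phi> = "\<lambda>\<alpha>. compose (carrier (Obj P 1)) \<alpha> (f 1)"
  obtain \<alpha> where \<alpha>: "\<alpha> \<in> cycles (Hom_to R X N) (- 1)" "c = homology_class (Hom_to R X N) (- 1) \<alpha>"
    using c by (auto simp: Ext_res_def carrier_homology)
  have \<phi>: "?\<phi> w \<in> cycles (Hom_to R P N) (- 1)" if "w \<in> cycles (Hom_to R X N) (- 1)" for w
  proof -
    have w: "w \<in> hom_set R (Obj X 1) N" "\<And>x. x \<in> carrier (Obj X 2) \<Longrightarrow> w (Diff X 2 x) = \<zero>\<^bsub>N\<^esub>"
      using that by (simp_all add: cocycle_res_iff)
    show ?thesis
      using w(2) hom_closed[OF f(1)] hom_closed[OF rP(9)] hom_compose[OF cP(1) f(1) w(1)]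
      by (simp add: cocycle_res_iff compose_eq f2)
  qed
  have "homology_map (Hom_to R X N) (Hom_to R P N) ?\<phi> (- 1) c = homology_class (Hom_to R P N) (- 1) (?\<phi> \<alpha>)"
    unfolding \<alpha>(2)
  proof (rule homology_map[OF is_complex_Hom_to[OF rX(1) N] is_complex_Hom_to[OF rP(1) N] \<alpha>(1) \<phi>])
    fix b assume "b \<in> boundaries (Hom_to R X N) (- 1)"
    then obtain \<beta> where \<beta>: "\<beta> \<in> hom_set R (Obj X 0) N" "b = compose (carrier (Obj X 1)) \<beta> (Diff X 1)"
      by (auto simp: coboundaries_res)
    have "compose (carrier (Obj P 0)) \<beta> (f 0) \<in> hom_set R (Obj P 0) N"
      by (rule hom_compose[OF cP(1) f(1) \<beta>(1)])
    moreover have "?\<phi> b = compose (carrier (Obj P 1)) (compose (carrier (Obj P 0)) \<beta> (f 0)) (Diff P 1)"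
      using hom_closed[OF f(1), of _ 1] hom_closed[OF rP(8)]
      by (intro extensionalityI[OF compose_extensional compose_extensional]) (simp add: compose_eq \<beta>(2) f1)
    ultimately show "?\<phi> b \<in> boundaries (Hom_to R P N) (- 1)"
      by (auto simp: coboundaries_res)
  next
    fix w b
    show "?\<phi> (b \<oplus>\<^bsub>Obj (Hom_to R X N) (- 1)\<^esub> w) = ?\<phi> b \<oplus>\<^bsub>Obj (Hom_to R P N) (- 1)\<^esub> ?\<phi> w"
      using hom_closed[OF f(1)] by (simp add: Hom_to_def hom_module_def compose_def cong: restrict_cong)
  qed
  then have comp: "comparison_res R P \<epsilon>P X \<epsilon>X N 1 c = homology_class (Hom_to R P N) (- 1) (?\<phi> \<alpha>)"
    by (simp add: comparison_res_def f_def Let_def)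
  then show "comparison_res R P \<epsilon>P X \<epsilon>X N 1 c \<in> carrier (Ext_res R P N 1)"
    using \<phi>[OF \<alpha>(1)] by (simp add: Ext_res_def carrier_homology)
  \<comment> \<open>One extension in the class of \<open>\<alpha>\<close> is shown to lie also in
    the class of \<open>\<alpha>\<close> composed with \<open>f 1\<close>: its middle term stays,
    and \<open>g\<close> is composed with \<open>f 0\<close>.\<close>
  obtain E where E: "E \<in> ext_of_cocycle R M N X \<epsilon>X \<alpha>"
    using ext_of_cocycle_pushout(2)[OF M N inf X \<alpha>(1)] by blast
  then obtain T i p g where Tip: "E = (T, i, p)" "short_exact R M N (T, i, p)" and g: "g \<in> hom_set R (Obj X 0) T"
      "\<And>x. x \<in> carrier (Obj X 0) \<Longrightarrow> p (g x) = \<epsilon>X x"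
      "\<And>x. x \<in> carrier (Obj X 1) \<Longrightarrow> g (Diff X 1 x) = i (\<alpha> x)"
    by (auto simp: ext_of_cocycle_def)
  have "E \<in> ext_of_cocycle R M N P \<epsilon>P (?\<phi> \<alpha>)"
    unfolding ext_of_cocycle_def Tip(1) mem_Collect_eq prod.case
  proof (intro conjI Tip(2) bexI[of _ "compose (carrier (Obj P 0)) g (f 0)"] ballI)
    show "compose (carrier (Obj P 0)) g (f 0) \<in> hom_set R (Obj P 0) T"
      by (rule hom_compose[OF cP(1) f(1) g(1)])
    show "p (compose (carrier (Obj P 0)) g (f 0) x) = \<epsilon>P x" if "x \<in> carrier (Obj P 0)" for x
      using that compose_eqD[OF f(3) that] hom_closed[OF f(1) that] by (simp add: compose_eq g(2))
    show "compose (carrier (Obj P 0)) g (f 0) (Diff P 1 x) = i (?\<phi> \<alpha> x)" if "x \<in> carrier (Obj P 1)" for x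
      using that hom_closed[OF f(1) that] hom_closed[OF rP(8) that] by (simp add: compose_eq g(3) f1)
  qed
  then show "xi R M N P \<epsilon>P (comparison_res R P \<epsilon>P X \<epsilon>X N 1 c) = xi R M N X \<epsilon>X c"
    unfolding comp unfolding \<alpha>(2) xi_homology_class[OF M N inf X \<alpha>(1)] xi_homology_class[OF M N inf P \<phi>[OF \<alpha>(1)]]
    using ext_of_cocycle_eq_ext_class[OF M N inf X \<alpha>(1) E]
      ext_of_cocycle_eq_ext_class[OF M N inf P \<phi>[OF \<alpha>(1)], of E] by simp
qed

section \<open>Cocycles into a coresolution of \<open>N\<close> and pullbacks\<close>

lemma cocycle_cores_iff:
  "\<alpha> \<in> cycles (Hom_from R M Y) (- 1) \<longleftrightarrow>
    \<alpha> \<in> hom_set R M (Obj Y (- 1)) \<and> (\<forall>x\<in>carrier M. Diff Y (- 1) (\<alpha> x) = \<zero>\<^bsub>Obj Y (- 2)\<^esub>)"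
  by (simp add: cycles_Hom_from)

lemma coboundaries_cores:
  "boundaries (Hom_from R M Y) (- 1) = compose (carrier M) (Diff Y 0) ` hom_set R M (Obj Y 0)"
  by (simp add: boundaries_Hom_from)

lemma homology_class_cores_iff:
  assumes "z \<in> hom_set R M (Obj Y (- 1))" "\<alpha> \<in> hom_set R M (Obj Y (- 1))"
  shows "z \<in> homology_class (Hom_from R M Y) (- 1) \<alpha> \<longleftrightarrow>
    (\<exists>\<beta>\<in>hom_set R M (Obj Y 0). \<forall>x\<in>carrier M. z x = Diff Y 0 (\<beta> x) \<oplus>\<^bsub>Obj Y (- 1)\<^esub> \<alpha> x)"
proof -
  have "z = compose (carrier M) (Diff Y 0) \<beta> \<oplus>\<^bsub>Obj (Hom_from R M Y) (- 1)\<^esub> \<alpha> \<longleftrightarrow>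
      (\<forall>x\<in>carrier M. z x = Diff Y 0 (\<beta> x) \<oplus>\<^bsub>Obj Y (- 1)\<^esub> \<alpha> x)" for \<beta>
    using hom_extensional[OF assms(1)]
    by (auto simp: Hom_from_def hom_module_def compose_eq intro!: extensionalityI)
  then show ?thesis
    by (simp add: mem_homology_class_iff coboundaries_cores)
qed

definition coext_of_cocycle ::
  "'r ring \<Rightarrow> ('r, 'm) module \<Rightarrow> ('r, 'm) module \<Rightarrow> ('r, 'm) cplx \<Rightarrow> ('m \<Rightarrow> 'm) \<Rightarrow> ('m \<Rightarrow> 'm) \<Rightarrow>
   ('r, 'm, 'm) ext set" where
  "coext_of_cocycle R M N Y \<eta> \<alpha> =
     {(T, i, p). short_exact R M N (T, i, p) \<and>
        (\<exists>g\<in>hom_set R T (Obj Y 0). (\<forall>x\<in>carrier N. g (i x) = \<eta> x) \<and>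
           (\<forall>x\<in>carrier T. Diff Y 0 (g x) = \<alpha> (p x)))}"

context
  fixes R :: "'r ring" and M N :: "('r, 'm) module" and Y :: "('r, 'm) cplx" and \<eta> and \<Y>
  assumes M: "module R M" and N: "module R N" and inf: "infinite (UNIV :: 'm set)"
    and Y: "coresolution R \<Y> N Y \<eta>"
begin

private lemmas rY = coresolutionD[OF Y N]
private lemmas cY = is_complexD[OF rY(1)]

lemma coext_of_cocycle_pullback:
  assumes \<alpha>: "\<alpha> \<in> cycles (Hom_from R M Y) (- 1)"
  shows "ext_class R M N (pullback_extension M N (Obj Y 0) \<eta> (Diff Y 0) \<alpha>) = coext_of_cocycle R M N Y \<eta> \<alpha>"
      (is "ext_class R M N ?E = _")
    and "\<exists>E'. short_exact R M N E' \<and> E' \<in> coext_of_cocycle R M N Y \<eta> \<alpha> \<and>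
      coext_of_cocycle R M N Y \<eta> \<alpha> = ext_class R M N E'"
proof -
  have \<alpha>': "\<alpha> \<in> hom_set R M (Obj Y (- 1))" using \<alpha> by (simp add: cocycle_cores_iff)
  \<comment> \<open>A cocycle takes values in the kernel of \<open>Diff Y (- 1)\<close>, which is
    the image of \<open>Diff Y 0\<close> by exactness.\<close>
  have im: "\<alpha> ` carrier M \<subseteq> Diff Y 0 ` carrier (Obj Y 0)"
    unfolding rY(7)[symmetric] using \<alpha> hom_closed[OF \<alpha>'] by (auto simp: cocycle_cores_iff)
  note pb = pullback_extension[OF M N cY(1) cY(1) rY(4,5,8,6) \<alpha>' im]
  \<comment> \<open>The universal property of the pullback describes morphisms into it, while
    \<open>ext_class\<close> asks for morphisms out of it; the symmetry of equivalence reconciles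
    the two.\<close>
  have "ext_equiv R N ?E (T, i, p) \<longleftrightarrow> (\<exists>g\<in>hom_set R T (Obj Y 0).
      (\<forall>x\<in>carrier N. g (i x) = \<eta> x) \<and> (\<forall>x\<in>carrier T. Diff Y 0 (g x) = \<alpha> (p x)))"
    if "short_exact R M N (T, i, p)" for T :: "('r, 'm) module" and i p
    unfolding pb(2)[OF that, symmetric]
    using ext_equiv_sym[OF M N pb(1) that] ext_equiv_sym[OF M N that pb(1)] by blast
  then show 1: "ext_class R M N ?E = coext_of_cocycle R M N Y \<eta> \<alpha>"
    by (auto simp: ext_class_def coext_of_cocycle_def is_extension_iff_short_exact[OF M N])
  obtain E' :: "('r, 'm, 'm) ext" where E': "short_exact R M N E'" "ext_equiv R N ?E E'"
    using pb(3)[OF inf] by blast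
  have "ext_class R M N E' = coext_of_cocycle R M N Y \<eta> \<alpha>"
    unfolding 1[symmetric] by (rule ext_class_eq[OF M N pb(1) E', symmetric])
  moreover have "E' \<in> ext_class R M N E'"
    using E'(1) ext_equiv_refl[OF E'(1)] by (simp add: ext_class_def is_extension_iff_short_exact[OF M N])
  ultimately show "\<exists>E'. short_exact R M N E' \<and> E' \<in> coext_of_cocycle R M N Y \<eta> \<alpha> \<and>
      coext_of_cocycle R M N Y \<eta> \<alpha> = ext_class R M N E'"
    using E'(1) by metis
qed

lemma coext_of_cocycle_mono:
  assumes \<alpha>: "\<alpha> \<in> cycles (Hom_from R M Y) (- 1)" and z: "z \<in> homology_class (Hom_from R M Y) (- 1) \<alpha>"
  shows "coext_of_cocycle R M N Y \<eta> \<alpha> \<subseteq> coext_of_cocycle R M N Y \<eta> z"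
proof
  fix E assume "E \<in> coext_of_cocycle R M N Y \<eta> \<alpha>"
  then obtain T i p g where E: "E = (T, i, p)" "short_exact R M N (T, i, p)" and g: "g \<in> hom_set R T (Obj Y 0)"
      "\<And>x. x \<in> carrier N \<Longrightarrow> g (i x) = \<eta> x"
      "\<And>x. x \<in> carrier T \<Longrightarrow> Diff Y 0 (g x) = \<alpha> (p x)"
    by (auto simp: coext_of_cocycle_def)
  note T = short_exactD[OF E(2)]
  interpret Y0: module R "Obj Y 0" by (rule cY(1))
  have "z \<in> cycles (Hom_from R M Y) (- 1)"
    using homology_class_cycles[OF is_complex_Hom_from[OF rY(1) M] \<alpha>] z by blast
  then have hom: "z \<in> hom_set R M (Obj Y (- 1))" "\<alpha> \<in> hom_set R M (Obj Y (- 1))"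
    using \<alpha> by (simp_all add: cocycle_cores_iff)
  from z obtain \<beta> where \<beta>: "\<beta> \<in> hom_set R M (Obj Y 0)"
      "\<And>x. x \<in> carrier M \<Longrightarrow> z x = Diff Y 0 (\<beta> x) \<oplus>\<^bsub>Obj Y (- 1)\<^esub> \<alpha> x"
    unfolding homology_class_cores_iff[OF hom] by blast
  \<comment> \<open>\<open>\<beta> p\<close> vanishes on the image of \<open>i\<close>, so the sum
    still restricts to \<open>\<eta>\<close>; under \<open>Diff Y 0\<close> it adds the coboundary
    of \<open>\<beta>\<close>, evaluated after \<open>p\<close>.\<close>
  define g' where "g' = (\<lambda>x\<in>carrier T. compose (carrier T) \<beta> p x \<oplus>\<^bsub>Obj Y 0\<^esub> g x)"
  have "g' \<in> hom_set R T (Obj Y 0)"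
    unfolding g'_def by (rule hom_add_in_hom_set[OF T(1) cY(1) hom_compose[OF T(1) T(3) \<beta>(1)] g(1)])
  moreover have "g' (i x) = \<eta> x" if "x \<in> carrier N" for x
    using that hom_closed[OF T(2) that] hom_closed[OF rY(4) that] hom_zero[OF M cY(1) \<beta>(1)]
    by (simp add: g'_def compose_eq T(6) g(2))
  moreover have "Diff Y 0 (g' x) = z (p x)" if "x \<in> carrier T" for x
    using that hom_closed[OF T(3) that] hom_closed[OF g(1) that]
    by (simp add: g'_def compose_eq \<beta>(2) g(3) hom_add[OF rY(8)] hom_closed[OF \<beta>(1)])
  ultimately show "E \<in> coext_of_cocycle R M N Y \<eta> z"
    using E by (auto simp: coext_of_cocycle_def)
qed

lemma coext_of_cocycle_eq_iff:
  assumes \<alpha>: "\<alpha> \<in> cycles (Hom_from R M Y) (- 1)" and z: "z \<in> cycles (Hom_from R M Y) (- 1)"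
  shows "coext_of_cocycle R M N Y \<eta> z = coext_of_cocycle R M N Y \<eta> \<alpha> \<longleftrightarrow>
    z \<in> homology_class (Hom_from R M Y) (- 1) \<alpha>" (is "?L \<longleftrightarrow> ?R")
proof
  note H = is_complex_Hom_from[OF rY(1) M]
  assume zR: ?R
  then have "\<alpha> \<in> homology_class (Hom_from R M Y) (- 1) z"
    using homology_class_eq[OF H \<alpha> zR] homology_class_self[OF H \<alpha>] by simp
  then show ?L
    using coext_of_cocycle_mono[OF \<alpha> zR] coext_of_cocycle_mono[OF z] by (intro equalityI)
next
  assume L: ?L
  have hom: "z \<in> hom_set R M (Obj Y (- 1))" "\<alpha> \<in> hom_set R M (Obj Y (- 1))"
    using \<alpha> z by (simp_all add: cocycle_cores_iff)
  obtain T i p where E: "(T, i, p) \<in> coext_of_cocycle R M N Y \<eta> \<alpha>" "(T, i, p) \<in> coext_of_cocycle R M N Y \<eta> z"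
  proof -
    obtain E where "E \<in> coext_of_cocycle R M N Y \<eta> \<alpha>"
      using coext_of_cocycle_pullback(2)[OF \<alpha>] by blast
    then show ?thesis using that L by (cases E) auto
  qed
  from E(1) obtain g where T: "short_exact R M N (T, i, p)" and g: "g \<in> hom_set R T (Obj Y 0)"
      "\<And>x. x \<in> carrier N \<Longrightarrow> g (i x) = \<eta> x"
      "\<And>x. x \<in> carrier T \<Longrightarrow> Diff Y 0 (g x) = \<alpha> (p x)"
    by (auto simp: coext_of_cocycle_def)
  from E(2) obtain g' where g': "g' \<in> hom_set R T (Obj Y 0)"
      "\<And>x. x \<in> carrier N \<Longrightarrow> g' (i x) = \<eta> x"
      "\<And>x. x \<in> carrier T \<Longrightarrow> Diff Y 0 (g' x) = z (p x)"
    by (auto simp: coext_of_cocycle_def)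
  note T = short_exactD[OF T]
  \<comment> \<open>Both maps restrict to \<open>\<eta>\<close> on \<open>N\<close>, so their
    difference vanishes there and descends to \<open>M\<close>.\<close>
  let ?f = "\<lambda>x\<in>carrier T. g' x \<ominus>\<^bsub>Obj Y 0\<^esub> g x"
  have f: "?f \<in> hom_set R T (Obj Y 0)" by (rule hom_diff_in_hom_set[OF T(1) cY(1) g'(1) g(1)])
  have f0: "?f x = \<zero>\<^bsub>Obj Y 0\<^esub>" if x: "x \<in> carrier T" "p x = \<zero>\<^bsub>M\<^esub>" for x
  proof -
    obtain n where n: "n \<in> carrier N" "x = i n" using T(7)[OF x] by auto
    then show ?thesis
      using x(1) module_diff_zero_iff[OF cY(1)] hom_closed[OF rY(4)] by (simp add: g(2) g'(2))
  qed
  obtain \<beta> where \<beta>: "\<beta> \<in> hom_set R M (Obj Y 0)" "\<And>x. x \<in> carrier T \<Longrightarrow> \<beta> (p x) = ?f x"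
    by (rule factor_through_epi[OF T(1) M cY(1) T(3,5) f f0]; assumption?) (rule that; assumption)
  have "z m = Diff Y 0 (\<beta> m) \<oplus>\<^bsub>Obj Y (- 1)\<^esub> \<alpha> m" if m: "m \<in> carrier M" for m
  proof -
    obtain x where x: "x \<in> carrier T" "m = p x" using m T(5) by blast
    note cl = hom_closed[OF g(1) x(1)] hom_closed[OF g'(1) x(1)]
    have "Diff Y 0 (\<beta> m) = z m \<ominus>\<^bsub>Obj Y (- 1)\<^esub> \<alpha> m"
      using x cl by (simp add: \<beta>(2) hom_diff[OF cY(1) cY(1) rY(8)] g(3) g'(3))
    then show ?thesis
      using module_diff_add_cancel[OF cY(1)] hom_closed[OF hom(1) m] hom_closed[OF hom(2) m] by simp
  qed
  then show ?R unfolding homology_class_cores_iff[OF hom] using \<beta>(1) by blast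
qed

lemma xi'_homology_class:
  assumes \<alpha>: "\<alpha> \<in> cycles (Hom_from R M Y) (- 1)"
  shows "xi' R M N Y \<eta> (homology_class (Hom_from R M Y) (- 1) \<alpha>) = coext_of_cocycle R M N Y \<eta> \<alpha>"
proof -
  note H = homology_class[OF is_complex_Hom_from[OF rY(1) M] \<alpha>]
  have "xi' R M N Y \<eta> (homology_class (Hom_from R M Y) (- 1) \<alpha>) =
      (\<Union>z\<in>homology_class (Hom_from R M Y) (- 1) \<alpha>. coext_of_cocycle R M N Y \<eta> z)"
    unfolding xi'_def using H(3) by (intro SUP_cong refl coext_of_cocycle_pullback(1)) auto
  also have "\<dots> = coext_of_cocycle R M N Y \<eta> \<alpha>"
    using H(1,3) coext_of_cocycle_eq_iff[OF \<alpha>] by blast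
  finally show ?thesis .
qed

lemma coext_of_cocycle_eq_ext_class:
  assumes \<alpha>: "\<alpha> \<in> cycles (Hom_from R M Y) (- 1)" and E: "E \<in> coext_of_cocycle R M N Y \<eta> \<alpha>"
  shows "coext_of_cocycle R M N Y \<eta> \<alpha> = ext_class R M N E"
proof -
  obtain E' :: "('r, 'm, 'm) ext" where E': "short_exact R M N E'" "coext_of_cocycle R M N Y \<eta> \<alpha> = ext_class R M N E'"
    using coext_of_cocycle_pullback(2)[OF \<alpha>] by metis
  then have "short_exact R M N E" "ext_equiv R N E' E"
    using E by (auto simp: ext_class_def is_extension_iff_short_exact[OF M N])
  then show ?thesis
    using ext_class_eq[OF M N E'(1)] E'(2) by simp
qed

lemma bij_betw_xi':
  assumes proper: "Hom_to_exact R \<Y> (coaugment Y \<eta> N)" and mod: "\<forall>B\<in>\<Y>. module R B"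
  shows "bij_betw (xi' R M N Y \<eta>) (carrier (Ext_cores R M Y 1)) (e_to R \<Y> M N)"
proof -
  let ?Z = "cycles (Hom_from R M Y) (- 1)" and ?c = "homology_class (Hom_from R M Y) (- 1)"
  note H = homology_class[OF is_complex_Hom_from[OF rY(1) M]]
  have carr: "carrier (Ext_cores R M Y 1) = ?c ` ?Z"
    by (simp add: Ext_cores_def carrier_homology)
  have "inj_on (xi' R M N Y \<eta>) (?c ` ?Z)"
  proof (intro inj_onI, elim imageE)
    fix c c' z z' assume *: "xi' R M N Y \<eta> c = xi' R M N Y \<eta> c'" "c = ?c z" "z \<in> ?Z" "c' = ?c z'" "z' \<in> ?Z"
    then have z: "z \<in> ?c z'"
      using coext_of_cocycle_eq_iff[of z' z] by (simp add: xi'_homology_class)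
    show "c = c'" using H(2)[OF *(5) z] *(2,4) by simp
  qed
  moreover have "xi' R M N Y \<eta> ` ?c ` ?Z = coext_of_cocycle R M N Y \<eta> ` ?Z"
    by (simp add: image_image xi'_homology_class cong: image_cong_simp)
  moreover have "coext_of_cocycle R M N Y \<eta> ` ?Z = e_to R \<Y> M N"
  proof (intro equalityI subsetI)
    fix K assume "K \<in> coext_of_cocycle R M N Y \<eta> ` ?Z"
    then obtain \<alpha> where \<alpha>: "\<alpha> \<in> ?Z" "K = coext_of_cocycle R M N Y \<eta> \<alpha>"
      by (rule imageE)
    obtain T i p where E: "short_exact R M N (T, i, p)" "(T, i, p) \<in> coext_of_cocycle R M N Y \<eta> \<alpha>"
        "coext_of_cocycle R M N Y \<eta> \<alpha> = ext_class R M N (T, i, p)"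
      using coext_of_cocycle_pullback(2)[OF \<alpha>(1)] by (metis prod_cases3)
    note T = short_exactD[OF E(1)]
    obtain g where g: "g \<in> hom_set R T (Obj Y 0)" "\<And>x. x \<in> carrier N \<Longrightarrow> g (i x) = \<eta> x"
      using E(2) by (auto simp: coext_of_cocycle_def)
    have "Hom_to_exact R \<Y> (ext_complex M N (T, i, p))"
      unfolding Hom_to_exact_ext_complex_iff[OF M N E(1) mod]
    proof (intro ballI)
      fix B f assume B: "B \<in> \<Y>" and f: "f \<in> hom_set R N B"
      \<comment> \<open>Properness extends \<open>f\<close> along \<open>\<eta>\<close> to
        \<open>Obj Y 0\<close>, and composition with \<open>g\<close> gives the extension to
        \<open>T\<close>.\<close>
      obtain h where h: "h \<in> hom_set R (Obj (coaugment Y \<eta> N) (1 - 1)) B"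
          "\<And>x. x \<in> carrier (Obj (coaugment Y \<eta> N) 1) \<Longrightarrow> h (Diff (coaugment Y \<eta> N) 1 x) = f x"
        by (rule Hom_to_exactD[OF proper B, of f 1])
          (use f hom_zero[OF N mod[rule_format, OF B] f] in \<open>auto simp: coaugment_sel zero_hom_def\<close>)
      then have h': "h \<in> hom_set R (Obj Y 0) B" "\<And>x. x \<in> carrier N \<Longrightarrow> h (\<eta> x) = f x"
        by (simp_all add: coaugment_sel)
      show "\<exists>h\<in>hom_set R T B. \<forall>x\<in>carrier N. h (i x) = f x"
        using h' g(2) hom_closed[OF T(2)]
        by (intro bexI[OF _ hom_compose[OF T(1) g(1) h'(1)]]) (simp add: compose_eq)
    qed
    then show "K \<in> e_to R \<Y> M N"
      unfolding e_to_def is_extension_iff_short_exact[OF M N] \<alpha>(2) E(3) using E(1) by blast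
  next
    fix K assume "K \<in> e_to R \<Y> M N"
    then obtain T i p where K: "K = ext_class R M N (T, i, p)" "short_exact R M N (T, i, p)"
        and ex: "Hom_to_exact R \<Y> (ext_complex M N (T, i, p))"
      by (auto simp: e_to_def is_extension_iff_short_exact[OF M N])
    note T = short_exactD[OF K(2)]
    \<comment> \<open>Conversely, exactness tested on \<open>Obj Y 0\<close> extends
      \<open>\<eta>\<close> to \<open>g\<close> on \<open>T\<close>.\<close>
    have "Obj Y 0 \<in> \<Y>" by (rule rY(10)) simp
    then obtain g where g: "g \<in> hom_set R T (Obj Y 0)" "\<And>x. x \<in> carrier N \<Longrightarrow> g (i x) = \<eta> x"
      using ex rY(4) unfolding Hom_to_exact_ext_complex_iff[OF M N K(2) mod] by blast
    \<comment> \<open>After \<open>i\<close> this map is \<open>Diff Y 0\<close> composed with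
      \<open>\<eta>\<close>, hence zero; it therefore factors through \<open>p\<close>, and the
      factor is the cocycle.\<close>
    let ?f = "compose (carrier T) (Diff Y 0) g"
    have f: "?f \<in> hom_set R T (Obj Y (- 1))" by (rule hom_compose[OF T(1) g(1) rY(8)])
    have f0: "?f x = \<zero>\<^bsub>Obj Y (- 1)\<^esub>" if x: "x \<in> carrier T" "p x = \<zero>\<^bsub>M\<^esub>" for x
    proof -
      obtain n where n: "n \<in> carrier N" "x = i n" using T(7)[OF x] by auto
      then have "Diff Y 0 (\<eta> n) = \<zero>\<^bsub>Obj Y (- 1)\<^esub>" using rY(6) by blast
      then show ?thesis using n x(1) by (simp add: compose_eq g(2))
    qed
    obtain \<alpha> where \<alpha>: "\<alpha> \<in> hom_set R M (Obj Y (- 1))" "\<And>x. x \<in> carrier T \<Longrightarrow> \<alpha> (p x) = ?f x"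
      by (rule factor_through_epi[OF T(1) M cY(1) T(3,5) f f0]; assumption?) (rule that; assumption)
    \<comment> \<open>As \<open>p\<close> is onto, the values of \<open>\<alpha>\<close> are
      boundaries, and boundaries are cycles.\<close>
    have "Diff Y (- 1) (\<alpha> m) = \<zero>\<^bsub>Obj Y (- 2)\<^esub>" if m: "m \<in> carrier M" for m
    proof -
      obtain x where x: "x \<in> carrier T" "m = p x" using m T(5) by blast
      then have "\<alpha> m \<in> Diff Y 0 ` carrier (Obj Y 0)"
        using hom_closed[OF g(1) x(1)] by (simp add: \<alpha>(2) compose_eq)
      then show ?thesis unfolding rY(7)[symmetric] by simp
    qed
    then have Z: "\<alpha> \<in> ?Z" using \<alpha>(1) by (simp add: cocycle_cores_iff)
    have "(T, i, p) \<in> coext_of_cocycle R M N Y \<eta> \<alpha>"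
      using K(2) g \<alpha>(2) by (auto simp: coext_of_cocycle_def compose_eq)
    then have "K = coext_of_cocycle R M N Y \<eta> \<alpha>"
      using coext_of_cocycle_eq_ext_class[OF Z] K(1) by simp
    then show "K \<in> coext_of_cocycle R M N Y \<eta> ` ?Z" using Z by simp
  qed
  ultimately show ?thesis by (simp add: bij_betw_def carr)
qed

end

text \<open>As for resolutions, \<open>ex\<close> is met by a class of injectives, and by a subclass
  of \<open>\<Y>\<close> when \<open>Y\<close> is proper. The common extension keeps its middle
  term, and \<open>g\<close> is followed by \<open>f 0\<close>.\<close>

lemma xi'_comparison_cores:
  fixes M N :: "('r, 'm) module"
  assumes M: "module R M" and N: "module R N" and inf: "infinite (UNIV :: 'm set)"
    and Y: "coresolution R \<Y> N Y \<eta>Y" and I: "coresolution R \<I> N I \<eta>I"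
    and ex: "Hom_to_exact R \<I> (coaugment Y \<eta>Y N)" and c: "c \<in> carrier (Ext_cores R M Y 1)"
  shows "comparison_cores R M N Y \<eta>Y I \<eta>I 1 c \<in> carrier (Ext_cores R M I 1)"
    and "xi' R M N I \<eta>I (comparison_cores R M N Y \<eta>Y I \<eta>I 1 c) = xi' R M N Y \<eta>Y c"
proof -
  note rY = coresolutionD[OF Y N] and rI = coresolutionD[OF I N]
  note cY = is_complexD[OF rY(1)] and cI = is_complexD[OF rI(1)]
  define f where "f = (SOME f. extension_of_id R N Y \<eta>Y I \<eta>I f)"
  have "extension_of_id R N Y \<eta>Y I \<eta>I f"
    unfolding f_def by (rule someI_ex[OF extension_of_id_exists[OF N Y I ex]])
  then have f: "\<And>n. f n \<in> hom_set R (Obj Y n) (Obj I n)"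
      "\<And>n. compose (carrier (Obj Y n)) (Diff I n) (f n) = compose (carrier (Obj Y n)) (f (n - 1)) (Diff Y n)"
      "compose (carrier N) (f 0) \<eta>Y = \<eta>I"
    by (auto simp: extension_of_id_def chain_map_def)
  have f_comm: "Diff I n (f n x) = f (n - 1) (Diff Y n x)" if "x \<in> carrier (Obj Y n)" for n x
    using fun_cong[OF f(2)[of n], of x] that by (simp add: compose_eq)
  have f0: "Diff I 0 (f 0 x) = f (- 1) (Diff Y 0 x)" if "x \<in> carrier (Obj Y 0)" for x
    using f_comm[OF that] by simp
  have f1: "Diff I (- 1) (f (- 1) x) = f (- 2) (Diff Y (- 1) x)" if "x \<in> carrier (Obj Y (- 1))" for x
    using f_comm[OF that] by simp
  let ?\<phi> = "\<lambda>\<alpha>. compose (carrier M) (f (- 1)) \<alpha>"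
  obtain \<alpha> where \<alpha>: "\<alpha> \<in> cycles (Hom_from R M Y) (- 1)" "c = homology_class (Hom_from R M Y) (- 1) \<alpha>"
    using c by (auto simp: Ext_cores_def carrier_homology)
  have \<phi>: "?\<phi> w \<in> cycles (Hom_from R M I) (- 1)" if "w \<in> cycles (Hom_from R M Y) (- 1)" for w
  proof -
    have w: "w \<in> hom_set R M (Obj Y (- 1))" "\<And>x. x \<in> carrier M \<Longrightarrow> Diff Y (- 1) (w x) = \<zero>\<^bsub>Obj Y (- 2)\<^esub>"
      using that by (simp_all add: cocycle_cores_iff)
    show ?thesis
      using w(2) hom_closed[OF w(1)] hom_compose[OF M w(1) f(1)] hom_zero[OF cY(1) cI(1) f(1)]
      by (simp add: cocycle_cores_iff compose_eq f1)
  qed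
  have "homology_map (Hom_from R M Y) (Hom_from R M I) ?\<phi> (- 1) c = homology_class (Hom_from R M I) (- 1) (?\<phi> \<alpha>)"
    unfolding \<alpha>(2)
  proof (rule homology_map[OF is_complex_Hom_from[OF rY(1) M] is_complex_Hom_from[OF rI(1) M] \<alpha>(1) \<phi>])
    fix b assume "b \<in> boundaries (Hom_from R M Y) (- 1)"
    then obtain \<beta> where \<beta>: "\<beta> \<in> hom_set R M (Obj Y 0)" "b = compose (carrier M) (Diff Y 0) \<beta>"
      by (auto simp: coboundaries_cores)
    have "compose (carrier M) (f 0) \<beta> \<in> hom_set R M (Obj I 0)"
      by (rule hom_compose[OF M \<beta>(1) f(1)])
    moreover have "?\<phi> b = compose (carrier M) (Diff I 0) (compose (carrier M) (f 0) \<beta>)"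
      using hom_closed[OF \<beta>(1)]
      by (intro extensionalityI[OF compose_extensional compose_extensional]) (simp add: compose_eq \<beta>(2) f0)
    ultimately show "?\<phi> b \<in> boundaries (Hom_from R M I) (- 1)"
      by (auto simp: coboundaries_cores)
  next
    fix w b assume "w \<in> cycles (Hom_from R M Y) (- 1)" "b \<in> boundaries (Hom_from R M Y) (- 1)"
    then have wb: "w \<in> hom_set R M (Obj Y (- 1))" "b \<in> hom_set R M (Obj Y (- 1))"
      using hom_compose[OF M _ rY(8)] by (auto simp: cocycle_cores_iff coboundaries_cores)
    show "?\<phi> (b \<oplus>\<^bsub>Obj (Hom_from R M Y) (- 1)\<^esub> w) = ?\<phi> b \<oplus>\<^bsub>Obj (Hom_from R M I) (- 1)\<^esub> ?\<phi> w"
      using hom_closed[OF wb(1)] hom_closed[OF wb(2)]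
      by (simp add: Hom_from_def hom_module_def compose_def hom_add[OF f(1)] cong: restrict_cong)
  qed
  then have comp: "comparison_cores R M N Y \<eta>Y I \<eta>I 1 c = homology_class (Hom_from R M I) (- 1) (?\<phi> \<alpha>)"
    by (simp add: comparison_cores_def f_def Let_def)
  then show "comparison_cores R M N Y \<eta>Y I \<eta>I 1 c \<in> carrier (Ext_cores R M I 1)"
    using \<phi>[OF \<alpha>(1)] by (simp add: Ext_cores_def carrier_homology)
  obtain E where E: "E \<in> coext_of_cocycle R M N Y \<eta>Y \<alpha>"
    using coext_of_cocycle_pullback(2)[OF M N inf Y \<alpha>(1)] by blast
  then obtain T i p g where Tip: "E = (T, i, p)" "short_exact R M N (T, i, p)" and g: "g \<in> hom_set R T (Obj Y 0)"
      "\<And>x. x \<in> carrier N \<Longrightarrow> g (i x) = \<eta>Y x"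
      "\<And>x. x \<in> carrier T \<Longrightarrow> Diff Y 0 (g x) = \<alpha> (p x)"
    by (auto simp: coext_of_cocycle_def)
  note T = short_exactD[OF Tip(2)]
  have "E \<in> coext_of_cocycle R M N I \<eta>I (?\<phi> \<alpha>)"
    unfolding coext_of_cocycle_def Tip(1) mem_Collect_eq prod.case
  proof (intro conjI Tip(2) bexI[of _ "compose (carrier T) (f 0) g"] ballI)
    show "compose (carrier T) (f 0) g \<in> hom_set R T (Obj I 0)"
      by (rule hom_compose[OF T(1) g(1) f(1)])
    show "compose (carrier T) (f 0) g (i x) = \<eta>I x" if "x \<in> carrier N" for x
      using compose_eqD[OF f(3) that] hom_closed[OF T(2) that] that by (simp add: compose_eq g(2))
    show "Diff I 0 (compose (carrier T) (f 0) g x) = ?\<phi> \<alpha> (p x)" if "x \<in> carrier T" for x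
      using that hom_closed[OF g(1) that] hom_closed[OF T(3) that] by (simp add: compose_eq g(3) f0)
  qed
  then show "xi' R M N I \<eta>I (comparison_cores R M N Y \<eta>Y I \<eta>I 1 c) = xi' R M N Y \<eta>Y c"
    unfolding comp unfolding \<alpha>(2) xi'_homology_class[OF M N inf Y \<alpha>(1)] xi'_homology_class[OF M N inf I \<phi>[OF \<alpha>(1)]]
    using coext_of_cocycle_eq_ext_class[OF M N inf Y \<alpha>(1) E]
      coext_of_cocycle_eq_ext_class[OF M N inf I \<phi>[OF \<alpha>(1)], of E] by simp
qed

section \<open>The relative bijections and their compatibility\<close>

lemma subcategory_module: "subcategory R \<X> \<Longrightarrow> \<forall>A\<in>\<X>. module R A"
  unfolding subcategory_def by (elim conjE)

text \<open>The witness does not mention any projective resolution; hence one and the same map is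
  compatible with \<open>xi\<close> for every choice of \<open>P\<close>.\<close>

lemma relative_xi_xi:
  fixes M N :: "('r, 'm) module"
  assumes M: "module R M" and N: "module R N" and inf: "infinite (UNIV :: 'm set)"
    and \<X>: "subcategory R \<X>" and X: "proper_resolution R \<X> M X \<epsilon>X"
  shows "relative_xi R \<X> M N X \<epsilon>X (xi R M N X \<epsilon>X)"
    and "projective_resolution R M P \<epsilon>P \<Longrightarrow> inj_on (comparison_res R P \<epsilon>P X \<epsilon>X N 1) (carrier (Ext_res R X N 1))"
proof -
  have X': "resolution R \<X> M X \<epsilon>X" "Hom_from_exact R \<X> (augment X \<epsilon>X M)"
    using X by (auto simp: proper_resolution_def)
  have bij: "bij_betw (xi R M N X \<epsilon>X) (carrier (Ext_res R X N 1)) (e_from R \<X> M N)"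
    by (rule bij_betw_xi[OF M N inf X' subcategory_module[OF \<X>]])
  note rX = resolutionD[OF X'(1) M]
  have comp: "xi R M N P \<epsilon>P (comparison_res R P \<epsilon>P X \<epsilon>X N 1 c) = xi R M N X \<epsilon>X c"
    if "projective_resolution R M P \<epsilon>P" "c \<in> carrier (Ext_res R X N 1)" for P \<epsilon>P c
    by (rule xi_comparison_res(2)[OF M N inf that(1)[unfolded projective_resolution_def] X'(1)
          Hom_from_exact_projective[OF rX(2,3)] that(2)]) simp
  show "relative_xi R \<X> M N X \<epsilon>X (xi R M N X \<epsilon>X)"
    using bij comp by (simp add: relative_xi_def)
  show "inj_on (comparison_res R P \<epsilon>P X \<epsilon>X N 1) (carrier (Ext_res R X N 1))"
    if "projective_resolution R M P \<epsilon>P"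
    by (rule inj_onI, rule inj_onD[OF bij_betw_imp_inj_on[OF bij]])
      (simp_all add: comp[OF that, symmetric])
qed

lemma relative_xi'_xi':
  fixes M N :: "('r, 'm) module"
  assumes M: "module R M" and N: "module R N" and inf: "infinite (UNIV :: 'm set)"
    and \<Y>: "subcategory R \<Y>" and Y: "proper_coresolution R \<Y> N Y \<eta>Y"
  shows "relative_xi' R \<Y> M N Y \<eta>Y (xi' R M N Y \<eta>Y)"
    and "injective_resolution R N I \<eta>I \<Longrightarrow> inj_on (comparison_cores R M N Y \<eta>Y I \<eta>I 1) (carrier (Ext_cores R M Y 1))"
proof -
  have Y': "coresolution R \<Y> N Y \<eta>Y" "Hom_to_exact R \<Y> (coaugment Y \<eta>Y N)"
    using Y by (auto simp: proper_coresolution_def)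
  have bij: "bij_betw (xi' R M N Y \<eta>Y) (carrier (Ext_cores R M Y 1)) (e_to R \<Y> M N)"
    by (rule bij_betw_xi'[OF M N inf Y' subcategory_module[OF \<Y>]])
  note rY = coresolutionD[OF Y'(1) N]
  have comp: "xi' R M N I \<eta>I (comparison_cores R M N Y \<eta>Y I \<eta>I 1 c) = xi' R M N Y \<eta>Y c"
    if "injective_resolution R N I \<eta>I" "c \<in> carrier (Ext_cores R M Y 1)" for I \<eta>I c
    by (rule xi'_comparison_cores(2)[OF M N inf Y'(1) that(1)[unfolded injective_resolution_def]
          Hom_to_exact_injective[OF rY(2,3)] that(2)]) simp
  show "relative_xi' R \<Y> M N Y \<eta>Y (xi' R M N Y \<eta>Y)"
    using bij comp by (simp add: relative_xi'_def)
  show "inj_on (comparison_cores R M N Y \<eta>Y I \<eta>I 1) (carrier (Ext_cores R M Y 1))"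
    if "injective_resolution R N I \<eta>I"
    by (rule inj_onI, rule inj_onD[OF bij_betw_imp_inj_on[OF bij]])
      (simp_all add: comp[OF that, symmetric])
qed

text \<open>A function satisfying \<open>relative_xi\<close> is determined on \<open>Ext\<close> as soon as some projective
  resolution exists, so that the arbitrary \<open>\<xi>X\<close>, \<open>\<xi>W\<close> below may be compared with \<open>xi\<close>.\<close>

lemma relative_xi_comparison:
  fixes M N :: "('r, 'm) module"
  assumes M: "module R M" and N: "module R N" and inf: "infinite (UNIV :: 'm set)"
    and \<X>: "subcategory R \<X>" and \<W>: "subcategory R \<W>" and "\<W> \<subseteq> \<X>"
    and X: "proper_resolution R \<X> M X \<epsilon>X" and W: "proper_resolution R \<W> M W \<epsilon>W"
  shows "inj_on (comparison_res R W \<epsilon>W X \<epsilon>X N 1) (carrier (Ext_res R X N 1))"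
    and "projective_resolution R M P \<epsilon>P \<Longrightarrow> relative_xi R \<X> M N X \<epsilon>X \<xi>X \<Longrightarrow> relative_xi R \<W> M N W \<epsilon>W \<xi>W \<Longrightarrow>
      c \<in> carrier (Ext_res R X N 1) \<Longrightarrow> \<xi>W (comparison_res R W \<epsilon>W X \<epsilon>X N 1 c) = \<xi>X c"
proof -
  \<comment> \<open>\<open>\<W> \<subseteq> \<X>\<close> makes the augmented \<open>X\<close> exact
    against \<open>\<W>\<close>, which is what lifts the identity to a map from \<open>W\<close> to
    \<open>X\<close>.\<close>
  have res: "resolution R \<W> M W \<epsilon>W" "resolution R \<X> M X \<epsilon>X" "Hom_from_exact R \<W> (augment X \<epsilon>X M)"
    using X W \<open>\<W> \<subseteq> \<X>\<close> by (auto simp: proper_resolution_def Hom_from_exact_def)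
  note comp = xi_comparison_res[OF M N inf res]
  note rel = relative_xi_xi(1)[OF M N inf \<X> X] relative_xi_xi(1)[OF M N inf \<W> W]
  show "inj_on (comparison_res R W \<epsilon>W X \<epsilon>X N 1) (carrier (Ext_res R X N 1))"
    by (rule inj_onI, rule inj_onD[OF bij_betw_imp_inj_on[OF conjunct1[OF rel(1)[unfolded relative_xi_def]]]])
      (simp_all add: comp(2)[symmetric])
  show "\<xi>W (comparison_res R W \<epsilon>W X \<epsilon>X N 1 c) = \<xi>X c"
    if "projective_resolution R M P \<epsilon>P" "relative_xi R \<X> M N X \<epsilon>X \<xi>X" "relative_xi R \<W> M N W \<epsilon>W \<xi>W"
      "c \<in> carrier (Ext_res R X N 1)"
  proof -
    have "\<xi>X c = xi R M N X \<epsilon>X c"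
      using rel(1) that by (auto simp: relative_xi_def)
    moreover have "\<xi>W d = xi R M N W \<epsilon>W d" if "d \<in> carrier (Ext_res R W N 1)" for d
      using rel(2) that \<open>projective_resolution R M P \<epsilon>P\<close> \<open>relative_xi R \<W> M N W \<epsilon>W \<xi>W\<close>
      by (auto simp: relative_xi_def)
    ultimately show ?thesis using comp[OF that(4)] by simp
  qed
qed

lemma relative_xi'_comparison:
  fixes M N :: "('r, 'm) module"
  assumes M: "module R M" and N: "module R N" and inf: "infinite (UNIV :: 'm set)"
    and \<Y>: "subcategory R \<Y>" and \<V>: "subcategory R \<V>" and "\<V> \<subseteq> \<Y>"
    and Y: "proper_coresolution R \<Y> N Y \<eta>Y" and V: "proper_coresolution R \<V> N V \<eta>V"
  shows "inj_on (comparison_cores R M N Y \<eta>Y V \<eta>V 1) (carrier (Ext_cores R M Y 1))"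
    and "injective_resolution R N I \<eta>I \<Longrightarrow> relative_xi' R \<Y> M N Y \<eta>Y \<xi>Y \<Longrightarrow> relative_xi' R \<V> M N V \<eta>V \<xi>V \<Longrightarrow>
      c \<in> carrier (Ext_cores R M Y 1) \<Longrightarrow> \<xi>V (comparison_cores R M N Y \<eta>Y V \<eta>V 1 c) = \<xi>Y c"
proof -
  \<comment> \<open>\<open>\<V> \<subseteq> \<Y>\<close> makes the coaugmented \<open>Y\<close>
    exact against \<open>\<V>\<close>, which extends the identity to a map from \<open>Y\<close> to
    \<open>V\<close>.\<close>
  have res: "coresolution R \<Y> N Y \<eta>Y" "coresolution R \<V> N V \<eta>V" "Hom_to_exact R \<V> (coaugment Y \<eta>Y N)"
    using Y V \<open>\<V> \<subseteq> \<Y>\<close> by (auto simp: proper_coresolution_def Hom_to_exact_def)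
  note comp = xi'_comparison_cores[OF M N inf res]
  note rel = relative_xi'_xi'(1)[OF M N inf \<Y> Y] relative_xi'_xi'(1)[OF M N inf \<V> V]
  show "inj_on (comparison_cores R M N Y \<eta>Y V \<eta>V 1) (carrier (Ext_cores R M Y 1))"
    by (rule inj_onI, rule inj_onD[OF bij_betw_imp_inj_on[OF conjunct1[OF rel(1)[unfolded relative_xi'_def]]]])
      (simp_all add: comp(2)[symmetric])
  show "\<xi>V (comparison_cores R M N Y \<eta>Y V \<eta>V 1 c) = \<xi>Y c"
    if "injective_resolution R N I \<eta>I" "relative_xi' R \<Y> M N Y \<eta>Y \<xi>Y" "relative_xi' R \<V> M N V \<eta>V \<xi>V"
      "c \<in> carrier (Ext_cores R M Y 1)"
  proof -
    \<comment> \<open>The given injective resolution pins down both arbitrary bijections: each value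
      equals \<open>xi'\<close> for \<open>I\<close> after the comparison with \<open>I\<close>, and
      so does the value of \<open>xi'\<close> for the coresolution itself.\<close>
    have "\<xi>Y c = xi' R M N Y \<eta>Y c"
      using rel(1) that by (auto simp: relative_xi'_def)
    moreover have "\<xi>V d = xi' R M N V \<eta>V d" if "d \<in> carrier (Ext_cores R M V 1)" for d
      using rel(2) that \<open>injective_resolution R N I \<eta>I\<close> \<open>relative_xi' R \<V> M N V \<eta>V \<xi>V\<close>
      by (auto simp: relative_xi'_def)
    ultimately show ?thesis using comp[OF that(4)] by simp
  qed
qed

text \<open>Resolutions and coresolutions are quantified, so the four claims hold for every way of
  computing the Ext modules. The bijections in the second and fourth claim are arbitrary solutions
  of \<open>relative_xi\<close> and \<open>relative_xi'\<close>; a projective or injective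
  resolution is given there to pin them down.\<close>

theorem theorem2p3:
  fixes R :: "'r ring" and M N :: "('r, 'm) module"
    and \<W> \<X> \<V> \<Y> :: "('r, 'm) module set"
  assumes "cring R" and "infinite (UNIV :: 'm set)"
    and "subcategory R \<W>" and "subcategory R \<X>" and "subcategory R \<V>" and "subcategory R \<Y>"
    and "\<W> \<subseteq> \<X>" and "\<V> \<subseteq> \<Y>"
    and "module R M" and "module R N"
  shows
    "(\<forall>X \<epsilon>X. proper_resolution R \<X> M X \<epsilon>X \<longrightarrow>
        (\<exists>\<xi>. relative_xi R \<X> M N X \<epsilon>X \<xi>) \<and>
        (\<forall>P \<epsilon>P. projective_resolution R M P \<epsilon>P \<longrightarrow>
           inj_on (comparison_res R P \<epsilon>P X \<epsilon>X N 1) (carrier (Ext_res R X N 1)))) \<and>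
     (\<forall>X \<epsilon>X W \<epsilon>W. proper_resolution R \<X> M X \<epsilon>X \<and> proper_resolution R \<W> M W \<epsilon>W \<longrightarrow>
        (\<forall>P \<epsilon>P \<xi>X \<xi>W. projective_resolution R M P \<epsilon>P \<and>
             relative_xi R \<X> M N X \<epsilon>X \<xi>X \<and> relative_xi R \<W> M N W \<epsilon>W \<xi>W \<longrightarrow>
           (\<forall>c\<in>carrier (Ext_res R X N 1). \<xi>W (comparison_res R W \<epsilon>W X \<epsilon>X N 1 c) = \<xi>X c)) \<and>
        inj_on (comparison_res R W \<epsilon>W X \<epsilon>X N 1) (carrier (Ext_res R X N 1))) \<and>
     (\<forall>Y \<eta>Y. proper_coresolution R \<Y> N Y \<eta>Y \<longrightarrow>
        (\<exists>\<xi>. relative_xi' R \<Y> M N Y \<eta>Y \<xi>) \<and>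
        (\<forall>I \<eta>I. injective_resolution R N I \<eta>I \<longrightarrow>
           inj_on (comparison_cores R M N Y \<eta>Y I \<eta>I 1) (carrier (Ext_cores R M Y 1)))) \<and>
     (\<forall>Y \<eta>Y V \<eta>V. proper_coresolution R \<Y> N Y \<eta>Y \<and> proper_coresolution R \<V> N V \<eta>V \<longrightarrow>
        (\<forall>I \<eta>I \<xi>Y \<xi>V. injective_resolution R N I \<eta>I \<and>
             relative_xi' R \<Y> M N Y \<eta>Y \<xi>Y \<and> relative_xi' R \<V> M N V \<eta>V \<xi>V \<longrightarrow>
           (\<forall>c\<in>carrier (Ext_cores R M Y 1). \<xi>V (comparison_cores R M N Y \<eta>Y V \<eta>V 1 c) = \<xi>Y c)) \<and>
        inj_on (comparison_cores R M N Y \<eta>Y V \<eta>V 1) (carrier (Ext_cores R M Y 1)))"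
proof -
  note mods = \<open>module R M\<close> \<open>module R N\<close> \<open>infinite (UNIV :: 'm set)\<close>
  note a = relative_xi_xi[OF mods \<open>subcategory R \<X>\<close>]
    and b = relative_xi_comparison[OF mods \<open>subcategory R \<X>\<close> \<open>subcategory R \<W>\<close> \<open>\<W> \<subseteq> \<X>\<close>]
    and c = relative_xi'_xi'[OF mods \<open>subcategory R \<Y>\<close>]
    and d = relative_xi'_comparison[OF mods \<open>subcategory R \<Y>\<close> \<open>subcategory R \<V>\<close> \<open>\<V> \<subseteq> \<Y>\<close>]
  show ?thesis
    by (intro conjI allI impI ballI exI; (elim conjE)?; rule a b c d; assumption)
qed

end
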